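(* If $G=AB$ is a periodic group with locally cyclic subgroups $A$ and $B$, then the Prüfer rank of $G$ does not exceed $3$.
   Context: $G=AB$ means $G=\{ab\mid a\in A,\ b\in B\}$ with $A,B$ subgroups of $G$. A group is locally cyclic if each of its finitely generated subgroups is cyclic. A group $G$ has finite Prüfer rank $r=r(G)$ if each finitely generated subgroup of $G$ can be generated by $r$ elements and $r$ is the least positive integer with this property. *)

theory Defs
  imports "HOL-Algebra.Elementary_Groups"
begin

definition periodic_group :: "('a, 'b) monoid_scheme \<Rightarrow> bool" where
  "periodic_group G \<longleftrightarrow>
     group G \<and> (\<forall>x\<in>carrier G. \<exists>n::nat. n > 0 \<and> x [^]\<^bsub>G\<^esub> n = \<one>\<^bsub>G\<^esub>)"

definition fg_subgroup :: "'a set \<Rightarrow> ('a, 'b) monoid_scheme \<Rightarrow> bool" where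
  "fg_subgroup H G \<longleftrightarrow> (\<exists>S. finite S \<and> S \<subseteq> carrier G \<and> H = generate G S)"

definition locally_cyclic :: "('a, 'b) monoid_scheme \<Rightarrow> bool" where
  "locally_cyclic G \<longleftrightarrow> group G \<and> (\<forall>H. fg_subgroup H G \<longrightarrow> cyclic_group (G\<lparr>carrier := H\<rparr>))"

(* The r generators need not be distinct, hence card S \<le> r. *)
definition fg_subgroups_generated_by :: "('a, 'b) monoid_scheme \<Rightarrow> nat \<Rightarrow> bool" where
  "fg_subgroups_generated_by G r \<longleftrightarrow>
     (\<forall>H. fg_subgroup H G \<longrightarrow>
        (\<exists>S. finite S \<and> card S \<le> r \<and> S \<subseteq> carrier G \<and> H = generate G S))"

(* A relation rather than a function of G, since the rank exists only for some groups.
   The rank is positive by convention, so the trivial group has rank 1. *)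
definition has_prufer_rank :: "('a, 'b) monoid_scheme \<Rightarrow> nat \<Rightarrow> bool" where
  "has_prufer_rank G r \<longleftrightarrow>
     r > 0 \<and> fg_subgroups_generated_by G r \<and>
     (\<forall>s>0. fg_subgroups_generated_by G s \<longrightarrow> r \<le> s)"

end

theory Submission
  imports Defs "HOL-Algebra.Multiplicative_Group" "HOL-Algebra.Group_Action" "HOL-Algebra.Sylow"
    "HOL-Algebra.Zassenhaus"
begin

text \<open>
  A product \<open>G = A B\<close> of abelian subgroups is metabelian by Ito's theorem, so a finitely generated
  subgroup \<open>H\<close> of the periodic group \<open>G\<close> is finite. Modulo the elements of \<open>G'\<close> of order prime to \<open>p\<close>
  the \<open>p\<close>-elements of \<open>G\<close> form a product of a \<open>p\<close>-subgroup of \<open>A\<close> and one of \<open>B\<close>, each of which is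
  cyclic or of Pruefer type, and a finite subset of such a product lies in a finite product
  \<open>\<langle>x\<rangle>\<langle>y\<rangle>\<close>. The successive Frattini subgroups of \<open>\<langle>x\<rangle>\<langle>y\<rangle>\<close> are \<open>\<langle>x\<^sup>q\<rangle>\<langle>y\<^sup>q\<rangle>\<close> with \<open>q\<close> a power of
  \<open>p\<close>, and the \<open>p\<close>-th power of an element outside one of them lies outside the next (if \<open>p = 2\<close>, from the
  second one on). As for powerful \<open>p\<close>-groups this bounds the number of generators of every subgroup,
  by \<open>2\<close> if \<open>p\<close> is odd and by \<open>3\<close> if \<open>p = 2\<close>, so the Sylow subgroups of \<open>H\<close> satisfy these bounds. If
  \<open>H\<close> needed four generators, an abelian chief factor \<open>N/N\<^sub>0\<close> would have so many complements that
  \<open>H\<close> has an elementary abelian \<open>p\<close>-section of order \<open>|N/N\<^sub>0|\<^sup>3\<close>, which contradicts them.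
\<close>

section \<open>Commutation modulo a normal subgroup\<close>

text \<open>A finitely generated subgroup of \<open>A B\<close> need not be a product of subgroups
  of \<open>A\<close> and \<open>B\<close>. Hence every bound on generators is proved for all
  subgroups of a product at once, not only for products. The bounds for odd \<open>p\<close> and for
  \<open>p = 2\<close> differ because, in class two, \<open>(u v)^p\<close> carries a commutator to
  the power \<open>p (p - 1) / 2\<close>, a multiple of \<open>p\<close> only for odd
  \<open>p\<close>. For \<open>p = 2\<close> only the Frattini subgroup is under control, and
  returning from it to the group costs the third generator. Bounds for Sylow subgroups do not bound
  the whole group by themselves: the symmetric group of degree 3 has cyclic Sylow subgroups but
  needs two generators. With 3 for \<open>p = 2\<close> a fourth generator could therefore appear.
  It is excluded by counting. Three generators, one of them kept fixed outside the centraliser of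
  the factor, leave \<open>q^2\<close> lifts with \<open>q = |N/N0|\<close>; this exceeds
  \<open>q\<close>, so three complements in general position exist. The section of order
  \<open>q^3\<close> is too big if \<open>p\<close> is odd, and for \<open>p = 2\<close> it leaves
  only \<open>q = 2\<close>, where the action on the factor is trivial.\<close>

definition commute_mod :: "('a, 'b) monoid_scheme \<Rightarrow> 'a set \<Rightarrow> 'a \<Rightarrow> 'a \<Rightarrow> bool" where
  "commute_mod G N x y \<longleftrightarrow> x \<otimes>\<^bsub>G\<^esub> y \<otimes>\<^bsub>G\<^esub> inv\<^bsub>G\<^esub> x \<otimes>\<^bsub>G\<^esub> inv\<^bsub>G\<^esub> y \<in> N"

context group
begin

lemma inv_mult_cancel [simp]:
  assumes "x \<in> carrier G" "y \<in> carrier G"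
  shows "inv x \<otimes> (x \<otimes> y) = y" "x \<otimes> (inv x \<otimes> y) = y"
  using assms by (simp_all flip: m_assoc)

lemma subgroup_nat_pow_closed:
  assumes "subgroup H G" "x \<in> H"
  shows "x [^] (n::nat) \<in> H"
  by (induction n) (use assms in \<open>auto simp: subgroup.one_closed subgroup.m_closed\<close>)

lemma subgroup_mem_carrier: "subgroup H G \<Longrightarrow> x \<in> H \<Longrightarrow> x \<in> carrier G"
  by (rule subgroup.mem_carrier)

lemma normal_conj_closed:
  assumes "N \<lhd> G" "g \<in> carrier G" "x \<in> N"
  shows "g \<otimes> x \<otimes> inv g \<in> N" "inv g \<otimes> x \<otimes> g \<in> N"
  using normal.inv_op_closed2[OF assms] normal.inv_op_closed1[OF assms] by simp_all

lemma commute_inv: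
  assumes "x \<otimes> y = y \<otimes> x" "x \<in> carrier G" "y \<in> carrier G"
  shows "x \<otimes> inv y = inv y \<otimes> x"
proof -
  have "inv y \<otimes> (x \<otimes> y) \<otimes> inv y = inv y \<otimes> (y \<otimes> x) \<otimes> inv y"
    using assms by simp
  then show ?thesis using assms(2,3) by (simp add: m_assoc)
qed

lemma rcos_eq_iff:
  assumes "subgroup N G" "x \<in> carrier G" "y \<in> carrier G"
  shows "N #> x = N #> y \<longleftrightarrow> x \<otimes> inv y \<in> N"
  using assms by (metis rcos_self repr_independence subgroup.rcos_module group_axioms)

lemma rcos_eq_self_iff:
  assumes "subgroup N G" "x \<in> carrier G"
  shows "N #> x = N \<longleftrightarrow> x \<in> N"
  using rcos_eq_iff[OF assms(1,2), of \<one>] assms by (simp add: subgroup.subset)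

text \<open>Links two views of commutation: the commutator form passes to intersections, larger sets
  and subgroups by set reasoning, while the equation in \<open>G Mod N\<close> gives access to the
  laws of a group.\<close>

lemma commute_mod_iff_rcos:
  assumes "N \<lhd> G" "x \<in> carrier G" "y \<in> carrier G"
  shows "commute_mod G N x y \<longleftrightarrow>
    (N #> x) \<otimes>\<^bsub>G Mod N\<^esub> (N #> y) = (N #> y) \<otimes>\<^bsub>G Mod N\<^esub> (N #> x)"
proof -
  have "x \<otimes> y \<otimes> inv (y \<otimes> x) = x \<otimes> y \<otimes> inv x \<otimes> inv y"
    using assms by (simp add: inv_mult_group m_assoc)
  then show ?thesis
    using assms rcos_eq_iff[of N "x \<otimes> y" "y \<otimes> x"]
    by (simp add: commute_mod_def normal.rcos_sum normal_imp_subgroup)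
qed

lemma commute_mod_sym:
  assumes "N \<lhd> G" "x \<in> carrier G" "y \<in> carrier G" "commute_mod G N x y"
  shows "commute_mod G N y x"
  using assms commute_mod_iff_rcos by simp

lemma rcos_in_FactGroup: "x \<in> carrier G \<Longrightarrow> N #> x \<in> carrier (G Mod N)"
  by (simp add: carrier_FactGroup)

text \<open>The set is the preimage of the centraliser of \<open>N #> x\<close> in
  \<open>G Mod N\<close>. It reduces commutation modulo \<open>N\<close> to a check on
  generators.\<close>

lemma subgroup_commute_mod:
  assumes N: "N \<lhd> G" and x: "x \<in> carrier G"
  shows "subgroup {y \<in> carrier G. commute_mod G N x y} G"
proof -
  interpret N: normal N G by (rule N)
  interpret Q: group "G Mod N" by (rule N.factorgroup_is_group)
  interpret h: group_hom G "G Mod N" "\<lambda>a. N #> a"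
    by unfold_locales (rule N.r_coset_hom_Mod)
  show ?thesis
  proof (rule subgroupI)
    show "{y \<in> carrier G. commute_mod G N x y} \<noteq> {}"
      using x by (auto simp: commute_mod_def intro!: exI[of _ \<one>])
    fix a assume a: "a \<in> {y \<in> carrier G. commute_mod G N x y}"
    then show "inv a \<in> {y \<in> carrier G. commute_mod G N x y}"
      using x commute_mod_iff_rcos[OF N x] Q.commute_inv[of "N #> x" "N #> a"]
      by (auto simp: rcos_in_FactGroup)
    fix b assume b: "b \<in> {y \<in> carrier G. commute_mod G N x y}"
    have "(N #> x) \<otimes>\<^bsub>G Mod N\<^esub> ((N #> a) \<otimes>\<^bsub>G Mod N\<^esub> (N #> b))
        = ((N #> a) \<otimes>\<^bsub>G Mod N\<^esub> (N #> b)) \<otimes>\<^bsub>G Mod N\<^esub> (N #> x)"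
      using a b x commute_mod_iff_rcos[OF N x] Q.m_assoc rcos_in_FactGroup
      by (smt (verit, ccfv_SIG) mem_Collect_eq)
    then show "a \<otimes> b \<in> {y \<in> carrier G. commute_mod G N x y}"
      using a b x commute_mod_iff_rcos[OF N x] h.hom_mult[of a b] by simp
  qed auto
qed

lemma commute_mod_normal:
  assumes "N \<lhd> G" "x \<in> carrier G" "y \<in> N"
  shows "commute_mod G N x y" "commute_mod G N y x"
proof -
  have y: "y \<in> carrier G" and s: "subgroup N G" using assms normal_imp_subgroup subgroup_mem_carrier by blast+
  show "commute_mod G N x y"
    unfolding commute_mod_def
    using normal_conj_closed[OF assms] assms(3) s subgroup.m_closed subgroup.m_inv_closed by metis
  then show "commute_mod G N y x" using commute_mod_sym assms y by blast
qed

lemma nat_pow_mult_mod: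
  assumes N: "N \<lhd> G" and x: "x \<in> carrier G" and y: "y \<in> carrier G" and "commute_mod G N x y"
  shows "N #> (x \<otimes> y) [^] (n::nat) = N #> (x [^] n \<otimes> y [^] n)"
proof -
  interpret N: normal N G by (rule N)
  interpret Q: group "G Mod N" by (rule N.factorgroup_is_group)
  have "((N #> x) \<otimes>\<^bsub>G Mod N\<^esub> (N #> y)) [^]\<^bsub>G Mod N\<^esub> n
      = (N #> x) [^]\<^bsub>G Mod N\<^esub> n \<otimes>\<^bsub>G Mod N\<^esub> (N #> y) [^]\<^bsub>G Mod N\<^esub> n"
    using assms commute_mod_iff_rcos by (intro Q.pow_mult_distrib) (auto simp: rcos_in_FactGroup)
  then show ?thesis
    using x y by (simp add: N.FactGroup_pow N.rcos_sum)
qed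

lemma set_mult_normal_subgroup:
  assumes "subgroup H G" "N \<lhd> G"
  shows "subgroup (H <#> N) G"
  using mult_norm_subgroup[OF assms(2,1)] commut_normal[OF assms] by simp

lemma set_mult_memI: "h \<in> H \<Longrightarrow> k \<in> K \<Longrightarrow> h \<otimes> k \<in> H <#> K"
  unfolding set_mult_def by blast

lemma set_mult_memE:
  assumes "g \<in> H <#> K" obtains h k where "h \<in> H" "k \<in> K" "g = h \<otimes> k"
  using assms unfolding set_mult_def by blast

lemma set_mult_supersets:
  assumes "subgroup H G" "subgroup K G"
  shows "H \<subseteq> H <#> K" "K \<subseteq> H <#> K"
proof -
  have "h \<otimes> \<one> \<in> H <#> K" if "h \<in> H" for h
    using that subgroup.one_closed[OF assms(2)] by (rule set_mult_memI)
  then show "H \<subseteq> H <#> K" using subgroup_mem_carrier[OF assms(1)] by auto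
  have "\<one> \<otimes> k \<in> H <#> K" if "k \<in> K" for k
    using subgroup.one_closed[OF assms(1)] that by (rule set_mult_memI)
  then show "K \<subseteq> H <#> K" using subgroup_mem_carrier[OF assms(2)] by auto
qed

lemma ord_pos:
  assumes "x \<in> carrier G" "x [^] (n::nat) = \<one>" "n > 0"
  shows "ord x > 0"
  using assms ord_eq_0 by auto

lemma generate_singleton_nat:
  assumes "x \<in> carrier G" "ord x > 0"
  shows "generate G {x} = {x [^] k | k::nat. True}"
  using generate_pow_nat[of x] assms by auto

end

section \<open>Finite \<open>p\<close>-groups\<close>

locale finite_p_group = group G for G (structure) +
  fixes p :: nat
  assumes prime: "prime p" and order_power: "\<exists>n. order G = p ^ n"
begin

lemma finite_carrier: "finite (carrier G)"
  using order_power prime order_gt_0_iff_finite by (metis prime_gt_0_nat zero_less_power)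

lemma ord_positive: "g \<in> carrier G \<Longrightarrow> ord g > 0"
  using finite_carrier ord_ge_1 by fastforce

lemma pow_p_power: "\<exists>n. \<forall>x\<in>carrier G. x [^] (p ^ n) = \<one>"
  using order_power pow_order_eq_1 by metis

lemma dvd_order_cases:
  assumes "d dvd order G"
  shows "d = 1 \<or> p dvd d"
proof -
  obtain n where "d dvd p ^ n" using order_power assms by auto
  then obtain k where "d = p ^ k" using prime divides_primepow_nat by blast
  then show ?thesis by (cases k) auto
qed

lemma finite_p_group_subgroup:
  assumes "subgroup H G"
  shows "finite_p_group (G\<lparr>carrier := H\<rparr>) p"
proof -
  have "card H dvd order G" using lagrange[OF assms] by (metis dvd_triv_right)
  then obtain k where "card H = p ^ k" using prime divides_primepow_nat order_power by metis
  then show ?thesis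
    using assms subgroup.subgroup_is_group prime
    by (auto simp: finite_p_group_def finite_p_group_axioms_def order_def)
qed

lemma finite_p_group_FactGroup:
  assumes "N \<lhd> G"
  shows "finite_p_group (G Mod N) p"
proof -
  have "order (G Mod N) dvd order G"
    using lagrange[of N] assms by (metis FactGroup_def dvd_triv_left normal_imp_subgroup order_def partial_object.select_convs(1))
  then obtain k where "order (G Mod N) = p ^ k" using prime divides_primepow_nat order_power by metis
  then show ?thesis
    using assms normal.factorgroup_is_group prime
    by (auto simp: finite_p_group_def finite_p_group_axioms_def)
qed

text \<open>Class equation: were no nontrivial element of \<open>K\<close> central,
  \<open>K - {\<one>}\<close> would split into conjugacy classes of sizes divisible by
  \<open>p\<close>, while \<open>card K\<close> is divisible by \<open>p\<close> as well.\<close>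

lemma normal_meets_center:
  assumes K: "K \<lhd> G" and "K \<noteq> {\<one>}"
  shows "\<exists>w\<in>K. w \<noteq> \<one> \<and> (\<forall>g\<in>carrier G. g \<otimes> w = w \<otimes> g)"
proof (rule ccontr)
  assume neg: "\<not> ?thesis"
  define \<phi> where "\<phi> = (\<lambda>g. (\<lambda>h \<in> carrier G. g \<otimes> h \<otimes> (inv g)))"
  interpret group_action G "carrier G" \<phi>
    unfolding \<phi>_def by (rule action_by_conjugation)
  have K': "subgroup K G" using K by (rule normal_imp_subgroup)
  have KG: "K \<subseteq> carrier G" using K' by (rule subgroup.subset)
  have finK: "finite K" using KG finite_carrier finite_subset by blast
  define P where "P = orbit G \<phi> ` (K - {\<one>})"
  have orb: "orbit G \<phi> x = {g \<otimes> x \<otimes> inv g | g. g \<in> carrier G}" if "x \<in> K" for x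
    using that KG unfolding orbit_def \<phi>_def by auto
  have orbK: "orbit G \<phi> x \<subseteq> K - {\<one>}" if x: "x \<in> K - {\<one>}" for x
  proof
    fix y assume "y \<in> orbit G \<phi> x"
    then obtain g where g: "g \<in> carrier G" "y = g \<otimes> x \<otimes> inv g" using orb x by auto
    have "y \<noteq> \<one>"
    proof
      assume "y = \<one>"
      then have "inv g \<otimes> (g \<otimes> x \<otimes> inv g) \<otimes> g = inv g \<otimes> \<one> \<otimes> g" using g(2) by simp
      moreover have "x \<in> carrier G" using x KG by auto
      ultimately show False using g(1) x by (simp add: m_assoc)
    qed
    then show "y \<in> K - {\<one>}" using normal_conj_closed[OF K g(1)] g x by auto
  qed
  have self: "x \<in> orbit G \<phi> x" if "x \<in> K" for x
    using orb[OF that] that KG by (auto intro!: exI[of _ \<one>])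
  have UP: "\<Union>P = K - {\<one>}" using orbK self unfolding P_def by blast
  have disj: "pairwise disjnt P"
  proof (rule pairwiseI)
    fix A B assume "A \<in> P" "B \<in> P" "A \<noteq> B"
    moreover have "A \<in> orbits G (carrier G) \<phi>" "B \<in> orbits G (carrier G) \<phi>"
      using \<open>A \<in> P\<close> \<open>B \<in> P\<close> KG unfolding P_def orbits_def by auto
    ultimately show "disjnt A B"
      using orbit_partition unfolding partition_def disjnt_def by blast
  qed
  have dvd: "p dvd card A" if A_in: "A \<in> P" for A
  proof -
    obtain x where x: "x \<in> K - {\<one>}" "A = orbit G \<phi> x" using A_in P_def by auto
    have "card A dvd order G"
      using orbit_stabilizer_theorem[of x] x KG by (metis DiffD1 dvd_triv_left subsetD)
    moreover have "card A \<noteq> 1"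
    proof
      assume "card A = 1"
      then have A: "A = {x}" using self[of x] x by (metis DiffD1 card_1_singletonE singletonD)
      have "g \<otimes> x = x \<otimes> g" if "g \<in> carrier G" for g
      proof -
        have "g \<otimes> x \<otimes> inv g = x" using A orb[of x] x that by auto
        then show ?thesis using that x KG by (metis DiffD1 inv_solve_right' m_closed subsetD)
      qed
      then show False using neg x by blast
    qed
    ultimately show ?thesis using dvd_order_cases by blast
  qed
  have "card (K - {\<one>}) = (\<Sum>A\<in>P. card A)"
    using card_Union_disjoint[OF disj] UP finK by (metis Union_upper finite_Diff finite_subset)
  then have 1: "p dvd card (K - {\<one>})" using dvd by (simp add: dvd_sum)
  have one: "\<one> \<in> K" using K' by (rule subgroup.one_closed)
  have cK: "card K = Suc (card (K - {\<one>}))" using one finK by (metis card_Suc_Diff1)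
  have "card K \<noteq> 1" using \<open>K \<noteq> {\<one>}\<close> one by (metis card_1_singletonE singletonD)
  moreover have "card K dvd order G" using lagrange[OF K'] by (metis dvd_triv_right)
  ultimately have "p dvd card K" using dvd_order_cases by blast
  then show False using 1 cK prime
    by (metis Suc_eq_plus1 dvd_add_right_iff nat_dvd_1_iff_1 not_prime_1)
qed

text \<open>\<open>normal_meets_center\<close> for the image of \<open>K\<close> in
  \<open>G Mod N\<close>. In this relative form the nilpotency of finite \<open>p\<close>-groups
  enters the proof.\<close>

lemma central_mod:
  assumes N: "N \<lhd> G" and K: "K \<lhd> G" and "N \<subset> K"
  shows "\<exists>w\<in>K - N. \<forall>g\<in>carrier G. commute_mod G N g w"
proof -
  interpret N: normal N G by (rule N)
  interpret Q: finite_p_group "G Mod N" p by (rule finite_p_group_FactGroup[OF N])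
  interpret h: group_hom G "G Mod N" "\<lambda>a. N #> a"
    by unfold_locales (rule N.r_coset_hom_Mod)
  have KG: "K \<subseteq> carrier G" using K normal_imp_subgroup subgroup.subset by blast
  have "(\<lambda>a. N #> a) ` K \<lhd> G Mod N"
    by (rule normal.surj_hom_normal_subgroup[OF K h.group_hom_axioms]) (simp add: carrier_FactGroup)
  moreover obtain k where k: "k \<in> K" "k \<notin> N" using \<open>N \<subset> K\<close> by blast
  then have "N #> k \<noteq> N" using rcos_eq_self_iff N.subgroup_axioms KG by blast
  then have "(\<lambda>a. N #> a) ` K \<noteq> {\<one>\<^bsub>G Mod N\<^esub>}" using k by auto
  ultimately obtain w where w: "w \<in> K" "N #> w \<noteq> \<one>\<^bsub>G Mod N\<^esub>"
     "\<forall>g\<in>carrier (G Mod N). g \<otimes>\<^bsub>G Mod N\<^esub> (N #> w) = (N #> w) \<otimes>\<^bsub>G Mod N\<^esub> g"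
    using Q.normal_meets_center[of "(\<lambda>a. N #> a) ` K"] by auto
  have "w \<notin> N" using w(1,2) rcos_eq_self_iff[OF N.subgroup_axioms, of w] KG by auto
  moreover have "commute_mod G N g w" if "g \<in> carrier G" for g
    using commute_mod_iff_rcos[OF N that] w KG rcos_in_FactGroup[OF that] by blast
  ultimately show ?thesis using w(1) by blast
qed

end

section \<open>Maximal subgroups of finite \<open>p\<close>-groups\<close>

context group
begin

lemma nat_pow_mult_mem_iff:
  assumes N: "N \<lhd> G" and x: "x \<in> carrier G" "y \<in> carrier G" and "commute_mod G N x y"
  shows "(x \<otimes> y) [^] (n::nat) \<in> N \<longleftrightarrow> x [^] n \<otimes> y [^] n \<in> N"
  using nat_pow_mult_mod[OF assms, of n] rcos_eq_self_iff[OF normal_imp_subgroup[OF N]] x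
  by (metis m_closed nat_pow_closed)

lemma subgroup_normalizer:
  assumes W: "subgroup W G"
  shows "subgroup {g \<in> carrier G. \<forall>x\<in>W. g \<otimes> x \<otimes> inv g \<in> W \<and> inv g \<otimes> x \<otimes> g \<in> W} G"
proof (rule subgroupI)
  have WG: "x \<in> carrier G" if "x \<in> W" for x using that W subgroup_mem_carrier by blast
  show "{g \<in> carrier G. \<forall>x\<in>W. g \<otimes> x \<otimes> inv g \<in> W \<and> inv g \<otimes> x \<otimes> g \<in> W} \<noteq> {}"
    using WG by (auto intro!: exI[of _ \<one>])
  fix a assume a: "a \<in> {g \<in> carrier G. \<forall>x\<in>W. g \<otimes> x \<otimes> inv g \<in> W \<and> inv g \<otimes> x \<otimes> g \<in> W}"
  then show "inv a \<in> {g \<in> carrier G. \<forall>x\<in>W. g \<otimes> x \<otimes> inv g \<in> W \<and> inv g \<otimes> x \<otimes> g \<in> W}"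
    by auto
  fix b assume b: "b \<in> {g \<in> carrier G. \<forall>x\<in>W. g \<otimes> x \<otimes> inv g \<in> W \<and> inv g \<otimes> x \<otimes> g \<in> W}"
  have "a \<otimes> b \<otimes> x \<otimes> inv (a \<otimes> b) = a \<otimes> (b \<otimes> x \<otimes> inv b) \<otimes> inv a"
       "inv (a \<otimes> b) \<otimes> x \<otimes> (a \<otimes> b) = inv b \<otimes> (inv a \<otimes> x \<otimes> a) \<otimes> b" if "x \<in> W" for x
    using a b WG[OF that] by (simp_all add: m_assoc inv_mult_group)
  then show "a \<otimes> b \<in> {g \<in> carrier G. \<forall>x\<in>W. g \<otimes> x \<otimes> inv g \<in> W \<and> inv g \<otimes> x \<otimes> g \<in> W}"
    using a b by auto
qed auto

text \<open>Bezout for \<open>j\<close> and \<open>p\<close>. It turns membership of a power into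
  divisibility of the exponent; exponents modulo \<open>p\<close> are read off in this way
  later.\<close>

lemma nat_pow_mem_prime:
  assumes W: "subgroup W G" and z: "z \<in> carrier G" and "prime p" and zp: "z [^] p \<in> W"
    and zj: "z [^] (j::nat) \<in> W" and "\<not> p dvd j"
  shows "z \<in> W"
proof -
  have "coprime j p" using \<open>prime p\<close> \<open>\<not> p dvd j\<close>     using prime_imp_coprime by (metis coprime_commute)
  moreover have "j \<noteq> 0" using \<open>\<not> p dvd j\<close> by (metis dvd_0_right)
  ultimately obtain a b where ab: "j * a = p * b + 1"
    using bezout_nat[of j p] by (auto simp: coprime_iff_gcd_eq_1)
  have "(z [^] j) [^] a = (z [^] p) [^] b \<otimes> z"
    using z ab by (simp add: nat_pow_pow)
  moreover have "(z [^] j) [^] a \<in> W" "(z [^] p) [^] b \<in> W"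
    using W zp zj by (auto intro: subgroup_nat_pow_closed)
  ultimately have "inv ((z [^] p) [^] b) \<otimes> ((z [^] p) [^] b \<otimes> z) \<in> W"
    using W by (metis subgroup.m_closed subgroup.m_inv_closed)
  then show ?thesis using z by simp
qed

text \<open>The cosets of \<open>N\<close> by \<open>h [^] i\<close> for \<open>i < p\<close> are
  distinct: a coincidence puts some \<open>h [^] (j - i)\<close> with \<open>0 < j - i < p\<close>
  into \<open>N\<close>, and together with \<open>h [^] p\<close> this forces \<open>h\<close> into
  \<open>N\<close>.\<close>

lemma card_cosets_of_prime_pow:
  fixes p :: nat
  assumes N: "subgroup N G" and h: "h \<in> carrier G" "h \<notin> N" "h [^] p \<in> N" and p: "prime p"
  shows "card ((\<lambda>(i, n). n \<otimes> h [^] i) ` ({..<p} \<times> N)) = p * card N"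
proof -
  have NG: "n \<in> carrier G" if "n \<in> N" for n using that N subgroup_mem_carrier by blast
  have aux: "i = j" if "n \<otimes> h [^] i = m \<otimes> h [^] j" "n \<in> N" "m \<in> N" "i < p" "i \<le> j" "j < p" for n m and i j :: nat
  proof -
    have "h [^] j = h [^] (j - i) \<otimes> h [^] i" using h \<open>i \<le> j\<close> by (simp add: nat_pow_mult)
    then have "n \<otimes> h [^] i = (m \<otimes> h [^] (j - i)) \<otimes> h [^] i" using that h NG by (simp add: m_assoc)
    then have "n = m \<otimes> h [^] (j - i)" using h NG that(2,3) by (metis right_cancel m_closed nat_pow_closed)
    then have "h [^] (j - i) = inv m \<otimes> n" using NG that h by simp
    then have "h [^] (j - i) \<in> N" using N that by (metis subgroup.m_closed subgroup.m_inv_closed)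
    then have "p dvd j - i" using nat_pow_mem_prime[OF N h(1) p h(3)] h(2) by blast
    then show ?thesis using that by (metis diff_is_0_eq dual_order.strict_iff_not less_imp_diff_less nat_dvd_not_less order_antisym zero_less_diff)
  qed
  have "inj_on (\<lambda>(i, n). n \<otimes> h [^] i) ({..<p} \<times> N)"
  proof (rule inj_onI)
    fix u v assume uv: "u \<in> {..<p} \<times> N" "v \<in> {..<p} \<times> N"
      "(\<lambda>(i, n). n \<otimes> h [^] i) u = (\<lambda>(i, n). n \<otimes> h [^] i) v"
    obtain i n j m where "u = (i, n)" "v = (j, m)" by fastforce
    then have *: "i < p" "j < p" "n \<in> N" "m \<in> N" "n \<otimes> h [^] i = m \<otimes> h [^] j"
      and u: "u = (i, n)" "v = (j, m)" using uv by auto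
    then have "i = j" using aux[of n i m j] aux[of m j n i] by (cases "i \<le> j") auto
    then show "u = v" using * u NG h by (metis right_cancel nat_pow_closed)
  qed
  then show ?thesis by (simp add: card_image card_cartesian_product)
qed

end

context finite_p_group
begin

text \<open>Take \<open>W\<close> maximal above \<open>U\<close>. An element central modulo the core
  of \<open>W\<close> cannot lie in \<open>W\<close>, yet it normalises \<open>W\<close>; by
  maximality \<open>W\<close> is normal. The same maximality makes the quotient abelian of exponent
  \<open>p\<close>.\<close>

lemma maximal_subgroup:
  assumes U: "subgroup U G" and "U \<noteq> carrier G"
  obtains W where "W \<lhd> G" "U \<subseteq> W" "W \<noteq> carrier G"
    "\<And>g h. g \<in> carrier G \<Longrightarrow> h \<in> carrier G \<Longrightarrow> commute_mod G W g h"
    "\<And>g. g \<in> carrier G \<Longrightarrow> g [^] p \<in> W"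
    "order G = p * card W"
proof -
  define S where "S = {V. subgroup V G \<and> U \<subseteq> V \<and> V \<noteq> carrier G}"
  have "finite S" unfolding S_def
    by (rule finite_subset[of _ "Pow (carrier G)"]) (use finite_carrier subgroup.subset in blast)+
  moreover have "U \<in> S" unfolding S_def using assms by auto
  ultimately obtain W where W: "W \<in> S" and Wmax: "\<forall>V\<in>S. W \<subseteq> V \<longrightarrow> W = V"
    using finite_has_maximal2[of S U] by blast
  have sW: "subgroup W G" and WG: "W \<subseteq> carrier G" and UW: "U \<subseteq> W" and Wne: "W \<noteq> carrier G"
    using W subgroup.subset unfolding S_def by blast+
  have max: "V = carrier G" if "subgroup V G" "W \<subseteq> V" "w \<in> V" "w \<notin> W" for V w
    using that Wmax W unfolding S_def by auto
  \<comment> \<open>\<open>N\<close> will be the core of \<open>W\<close>: maximal among the normal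
    subgroups of \<open>G\<close> inside \<open>W\<close>.\<close>
  define T where "T = {N. N \<lhd> G \<and> N \<subseteq> W}"
  have "finite T" unfolding T_def
    by (rule finite_subset[of _ "Pow W"]) (use finite_carrier WG finite_subset in blast)+
  moreover have "{\<one>} \<in> T" unfolding T_def using one_is_normal sW subgroup.one_closed by auto
  ultimately obtain N where N: "N \<in> T" and Nmax: "\<forall>V\<in>T. N \<subseteq> V \<longrightarrow> N = V"
    using finite_has_maximal2[of T "{\<one>}"] by blast
  have NN: "N \<lhd> G" and NW: "N \<subseteq> W" and sN: "subgroup N G" using N normal_imp_subgroup unfolding T_def by auto
  have NG: "N \<subseteq> carrier G" using sN by (rule subgroup.subset)
  obtain w where w: "w \<in> carrier G" "w \<notin> N" and wc: "\<And>g. g \<in> carrier G \<Longrightarrow> commute_mod G N g w"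
    using central_mod[OF NN normal_self] NW WG Wne by blast
  \<comment> \<open>Otherwise \<open>N\<close> and the coset \<open>N #> w\<close> generate a larger
    normal subgroup inside \<open>W\<close>; their union is closed under conjugation because
    \<open>w\<close> is central modulo \<open>N\<close>.\<close>
  have "w \<notin> W"
  proof
    assume wW: "w \<in> W"
    define D where "D = N \<union> (N #> w)"
    have DG: "D \<subseteq> carrier G" unfolding D_def using NG w by (simp add: r_coset_subset_G)
    have DW: "D \<subseteq> W" unfolding D_def r_coset_def using NW wW sW by (auto intro: subgroup.m_closed)
    have "generate G D \<lhd> G"
    proof (rule normal_generateI[OF DG])
      fix h g assume h: "h \<in> D" and g: "g \<in> carrier G"
      consider "h \<in> N" | n where "n \<in> N" "h = n \<otimes> w" using h unfolding D_def r_coset_def by auto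
      then show "g \<otimes> h \<otimes> inv g \<in> D"
      proof cases
        case 1 then show ?thesis unfolding D_def using normal_conj_closed[OF NN g] by auto
      next
        case (2 n)
        have "g \<otimes> h \<otimes> inv g = ((g \<otimes> n \<otimes> inv g) \<otimes> (g \<otimes> w \<otimes> inv g \<otimes> inv w)) \<otimes> w"
          using 2 g w NG by (auto simp: m_assoc)
        moreover have "(g \<otimes> n \<otimes> inv g) \<otimes> (g \<otimes> w \<otimes> inv g \<otimes> inv w) \<in> N"
          using normal_conj_closed[OF NN g] 2 wc[OF g] sN subgroup.m_closed unfolding commute_mod_def by metis
        ultimately show ?thesis unfolding D_def r_coset_def by auto
      qed
    qed
    then have "generate G D \<in> T" unfolding T_def using generate_subgroup_incl[OF DW sW] by auto
    moreover have "N \<subseteq> generate G D" unfolding D_def by (auto intro: generate.incl)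
    ultimately have "N = generate G D" using Nmax by auto
    moreover have "w \<in> D" unfolding D_def using rcos_self[OF w(1) sN] by auto
    ultimately show False using w(2) by (auto intro: generate.incl)
  qed
  have Wn: "{g \<in> carrier G. \<forall>x\<in>W. g \<otimes> x \<otimes> inv g \<in> W \<and> inv g \<otimes> x \<otimes> g \<in> W} = carrier G"
  proof (rule max[OF subgroup_normalizer[OF sW] _ _ \<open>w \<notin> W\<close>])
    show "W \<subseteq> {g \<in> carrier G. \<forall>x\<in>W. g \<otimes> x \<otimes> inv g \<in> W \<and> inv g \<otimes> x \<otimes> g \<in> W}"
      using WG subgroup.m_closed[OF sW] subgroup.m_inv_closed[OF sW] by auto
    have "w \<otimes> x \<otimes> inv w \<in> W \<and> inv w \<otimes> x \<otimes> w \<in> W" if x: "x \<in> W" for x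
    proof -
      have xG: "x \<in> carrier G" using x WG by auto
      have 1: "x \<otimes> w \<otimes> inv x \<otimes> inv w \<in> N" using wc[OF xG] unfolding commute_mod_def .
      have "w \<otimes> x \<otimes> inv w = inv (x \<otimes> w \<otimes> inv x \<otimes> inv w) \<otimes> x"
        using xG w by (simp add: m_assoc inv_mult_group)
      then have a: "w \<otimes> x \<otimes> inv w \<in> W"
        using subgroup.m_closed[OF sW] subgroup.m_inv_closed[OF sW] 1 NW x by auto
      have "inv w \<otimes> x \<otimes> w = (inv w \<otimes> (x \<otimes> w \<otimes> inv x \<otimes> inv w) \<otimes> w) \<otimes> x"
        using xG w by (simp add: m_assoc)
      moreover have "inv w \<otimes> (x \<otimes> w \<otimes> inv x \<otimes> inv w) \<otimes> w \<in> W"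
        using normal_conj_closed(2)[OF NN w(1) 1] NW by auto
      ultimately show ?thesis using a x sW subgroup.m_closed by metis
    qed
    then show "w \<in> {g \<in> carrier G. \<forall>x\<in>W. g \<otimes> x \<otimes> inv g \<in> W \<and> inv g \<otimes> x \<otimes> g \<in> W}" using w by auto
  qed
  have "g \<otimes> x \<otimes> inv g \<in> W" if "g \<in> carrier G" "x \<in> W" for g x
    using Wn that by blast
  then have nW: "W \<lhd> G" unfolding normal_inv_iff using sW by blast
  obtain v where v: "v \<in> carrier G" "v \<notin> W" and vc: "\<And>g. g \<in> carrier G \<Longrightarrow> commute_mod G W g v"
    using central_mod[OF nW normal_self] WG Wne by blast
  have comm: "commute_mod G W g h" if g: "g \<in> carrier G" and h: "h \<in> carrier G" for g h
    using max[OF subgroup_commute_mod[OF nW g] _ _ v(2)] commute_mod_normal[OF nW g] vc[OF g] v(1) WG h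
    by blast
  \<comment> \<open>If this subgroup were proper it would equal \<open>W\<close>. Then taking
    \<open>p\<close>-th powers of \<open>v\<close> would never lead into \<open>W\<close>, although
    \<open>v\<close> has \<open>p\<close>-power order.\<close>
  define P where "P = {g \<in> carrier G. g [^] p \<in> W}"
  have sP: "subgroup P G"
  proof (rule subgroupI)
    show "P \<noteq> {}" unfolding P_def using subgroup.one_closed[OF sW] by (auto intro!: exI[of _ \<one>])
    fix a assume a: "a \<in> P"
    then show "inv a \<in> P" unfolding P_def using subgroup.m_inv_closed[OF sW] by (auto simp: nat_pow_inv)
    fix b assume b: "b \<in> P"
    have ab: "a \<in> carrier G" "b \<in> carrier G" "a [^] p \<otimes> b [^] p \<in> W"
      using a b subgroup.m_closed[OF sW] unfolding P_def by auto
    then show "a \<otimes> b \<in> P" unfolding P_def using nat_pow_mult_mem_iff[OF nW ab(1,2) comm[OF ab(1,2)]] by auto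
  qed (auto simp: P_def)
  have "P = carrier G"
  proof (rule ccontr)
    assume "P \<noteq> carrier G"
    then have PW: "x \<in> W" if "x \<in> carrier G" "x [^] p \<in> W" for x
      using max[OF sP, of x] that sW WG subgroup_nat_pow_closed unfolding P_def by blast
    have "v [^] (p ^ k) \<notin> W" for k
    proof (induction k)
      case (Suc k)
      have "v [^] (p ^ Suc k) = (v [^] (p ^ k)) [^] p" using v by (simp add: nat_pow_pow mult.commute)
      then show ?case using PW[of "v [^] (p ^ k)"] Suc v by auto
    qed (use v in auto)
    then show False using pow_p_power v(1) sW subgroup.one_closed by metis
  qed
  then have pw: "g [^] p \<in> W" if "g \<in> carrier G" for g using that P_def by blast
  have "(\<lambda>(i, n). n \<otimes> v [^] i) ` ({..<p} \<times> W) = carrier G"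
  proof -
    have sv: "subgroup (generate G {v}) G" using v by (auto intro: generate_is_subgroup)
    have "W <#> generate G {v} = carrier G"
      using set_mult_supersets[OF sW sv] v(2)
      by (intro max[OF mult_norm_subgroup[OF nW sv], of v]) (auto intro: generate.incl)
    then have *: "\<exists>i. \<exists>n\<in>W. g = n \<otimes> v [^] (i::nat)" if "g \<in> carrier G" for g
    proof -
      have "g \<in> W <#> generate G {v}" using \<open>W <#> generate G {v} = carrier G\<close> that by simp
      then obtain n t where nt: "n \<in> W" "t \<in> generate G {v}" "g = n \<otimes> t" by (rule set_mult_memE)
      then show ?thesis unfolding generate_singleton_nat[OF v(1) ord_positive[OF v(1)]] by blast
    qed
    have "\<exists>i<p. \<exists>n\<in>W. g = n \<otimes> v [^] i" if g: "g \<in> carrier G" for g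
    proof -
      obtain i n where i: "n \<in> W" "g = n \<otimes> v [^] (i::nat)" using *[OF g] by blast
      have "v [^] i = (v [^] p) [^] (i div p) \<otimes> v [^] (i mod p)"
        using v by (simp add: nat_pow_pow nat_pow_mult)
      then have "g = (n \<otimes> (v [^] p) [^] (i div p)) \<otimes> v [^] (i mod p)" using i(2) v subsetD[OF WG i(1)] by (simp add: m_assoc)
      moreover have "n \<otimes> (v [^] p) [^] (i div p) \<in> W"
        using i subgroup_nat_pow_closed[OF sW pw[OF v(1)]] subgroup.m_closed[OF sW] by auto
      ultimately show ?thesis using prime prime_gt_0_nat by (metis mod_less_divisor)
    qed
    then show ?thesis using WG v by (force simp: image_iff)
  qed
  then have "order G = p * card W"
    using card_cosets_of_prime_pow[OF sW v pw[OF v(1)] prime] WG finite_carrier finite_subset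
    unfolding order_def by metis
  then show thesis using that nW UW Wne comm pw by blast
qed

end

section \<open>Products of two cyclic \<open>p\<close>-groups\<close>

definition generated_by :: "('a, 'b) monoid_scheme \<Rightarrow> nat \<Rightarrow> 'a set \<Rightarrow> bool" where
  "generated_by G d H \<longleftrightarrow> (\<exists>S. finite S \<and> card S \<le> d \<and> S \<subseteq> carrier G \<and> H = generate G S)"

text \<open>In general only a set: that the product is a subgroup is always assumed or proved
  separately.\<close>

definition cyc_prod :: "('a, 'b) monoid_scheme \<Rightarrow> 'a \<Rightarrow> 'a \<Rightarrow> 'a set" where
  "cyc_prod G x y = generate G {x} <#>\<^bsub>G\<^esub> generate G {y}"

lemma generated_by_mono: "generated_by G d H \<Longrightarrow> d \<le> e \<Longrightarrow> generated_by G e H"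
  unfolding generated_by_def using le_trans by blast

context group
begin

lemma generated_by_1: "x \<in> carrier G \<Longrightarrow> generated_by G 1 (generate G {x})"
  unfolding generated_by_def by (intro exI[of _ "{x}"]) auto

lemma generated_by_insert:
  assumes "x \<in> carrier G" "generated_by G d K" "x \<in> H" "K \<subseteq> H" "subgroup H G"
    and "\<And>L. subgroup L G \<Longrightarrow> x \<in> L \<Longrightarrow> K \<subseteq> L \<Longrightarrow> H \<subseteq> L"
  shows "generated_by G (Suc d) H"
proof -
  obtain S where S: "finite S" "card S \<le> d" "S \<subseteq> carrier G" "K = generate G S"
    using assms(2) unfolding generated_by_def by blast
  have "H = generate G (insert x S)"
  proof (rule generateI[OF assms(5)])
    show "insert x S \<subseteq> H" using assms S by (auto intro: generate.incl)
    fix L assume "subgroup L G" "insert x S \<subseteq> L"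
    then show "H \<subseteq> L" using assms(6)[of L] generate_subgroup_incl[of S L] S by auto
  qed
  moreover have "card (insert x S) \<le> Suc d" using S by (metis card_insert_le_m1 card_insert_if le_SucI not_less_eq_eq)
  ultimately show ?thesis unfolding generated_by_def using S assms(1) by (intro exI[of _ "insert x S"]) auto
qed

lemma nat_pow_gcd:
  assumes x: "x \<in> carrier G" and m: "x [^] (m::nat) = \<one>"
  shows "\<exists>a::nat. x [^] gcd i m = (x [^] i) [^] a"
proof (cases "i = 0")
  case True then show ?thesis using m by auto
next
  case False
  then obtain a b where "i * a = m * b + gcd i m" using bezout_nat by blast
  then have "(x [^] i) [^] a = (x [^] m) [^] b \<otimes> x [^] gcd i m"
    using x by (simp add: nat_pow_pow nat_pow_mult)
  then show ?thesis using x m by (metis l_one nat_pow_closed nat_pow_one)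
qed

text \<open>\<open>z [^] i\<close> and \<open>z [^] gcd i (p ^ k)\<close> are powers of each other,
  and the gcds are powers of \<open>p\<close>, so one of the two divides the other.\<close>

lemma p_power_chain:
  fixes i j k p :: nat
  assumes z: "z \<in> carrier G" and p: "prime p" and zk: "z [^] (p ^ k) = \<one>"
  shows "(\<exists>c::nat. z [^] i = (z [^] j) [^] c) \<or> (\<exists>c::nat. z [^] j = (z [^] i) [^] c)"
proof -
  obtain s where s: "gcd i (p ^ k) = p ^ s" using divides_primepow_nat[OF p] gcd_dvd2 by blast
  obtain t where t: "gcd j (p ^ k) = p ^ t" using divides_primepow_nat[OF p] gcd_dvd2 by blast
  have *: "\<exists>c::nat. z [^] j = (z [^] i) [^] c" if "gcd i (p ^ k) dvd gcd j (p ^ k)" for i j :: nat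
  proof -
    obtain a :: nat where a: "z [^] gcd i (p ^ k) = (z [^] i) [^] a" using nat_pow_gcd[OF z zk] by blast
    have "gcd i (p ^ k) dvd j" using that by (meson dvd_trans gcd_dvd1)
    then obtain d where "j = gcd i (p ^ k) * d" by (rule dvdE)
    then have "z [^] j = ((z [^] i) [^] a) [^] d" using z a by (metis nat_pow_pow)
    then show ?thesis using z nat_pow_pow by (metis nat_pow_closed)
  qed
  show ?thesis
  proof (cases "s \<le> t")
    case True
    then have "gcd i (p ^ k) dvd gcd j (p ^ k)" using s t by (simp add: le_imp_power_dvd)
    then show ?thesis using * by blast
  next
    case False
    then have "gcd j (p ^ k) dvd gcd i (p ^ k)" using s t by (simp add: le_imp_power_dvd)
    then show ?thesis using * by blast
  qed
qed

lemma generate_nat_pow: "x \<in> carrier G \<Longrightarrow> x [^] (n::nat) \<in> generate G {x}"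
  by (rule subgroup_nat_pow_closed[OF generate_is_subgroup]) (auto intro: generate.incl)

lemma generate_singleton_subset: "subgroup H G \<Longrightarrow> x \<in> H \<Longrightarrow> generate G {x} \<subseteq> H"
  by (rule generate_subgroup_incl) auto

lemma generate_singleton_trans:
  assumes "z \<in> carrier G" "y \<in> generate G {z}"
  shows "generate G {y} \<subseteq> generate G {z}"
  using assms generate_singleton_subset[OF generate_is_subgroup] by auto

lemma finite_chain_generator:
  assumes "finite F" "F \<noteq> {}" "F \<subseteq> carrier G"
    and "\<And>u v. u \<in> F \<Longrightarrow> v \<in> F \<Longrightarrow> u \<in> generate G {v} \<or> v \<in> generate G {u}"
  shows "\<exists>z\<in>F. F \<subseteq> generate G {z}"
  using assms
proof (induction F rule: finite_ne_induct)
  case (singleton x) then show ?case by (auto intro: generate.incl)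
next
  case (insert x F)
  then obtain z where z: "z \<in> F" "F \<subseteq> generate G {z}" by auto
  have "x \<in> generate G {z} \<or> z \<in> generate G {x}" using insert z by auto
  then show ?case
  proof
    assume "x \<in> generate G {z}" then show ?thesis using z by auto
  next
    assume "z \<in> generate G {x}"
    moreover have "x \<in> carrier G" using insert.prems(1) by simp
    ultimately have "F \<subseteq> generate G {x}" using generate_singleton_trans z(2) by (meson subset_trans)
    then have "insert x F \<subseteq> generate G {x}" by (simp add: generate.incl)
    then show ?thesis by blast
  qed
qed

lemma cyc_prod_mem_iff:
  assumes "x \<in> carrier G" "y \<in> carrier G" "ord x > 0" "ord y > 0"
  shows "g \<in> cyc_prod G x y \<longleftrightarrow> (\<exists>(i::nat) (j::nat). g = x [^] i \<otimes> y [^] j)"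
  unfolding cyc_prod_def set_mult_def generate_singleton_nat[OF assms(1,3)] generate_singleton_nat[OF assms(2,4)]
  by auto

lemma cyc_prod_consistent:
  assumes "subgroup K G" "x \<in> K" "y \<in> K"
  shows "cyc_prod (G\<lparr>carrier := K\<rparr>) x y = cyc_prod G x y"
  unfolding cyc_prod_def using assms by (simp add: generate_consistent)

lemma cyc_prod_mems:
  assumes "x \<in> carrier G" "y \<in> carrier G"
  shows "x \<in> cyc_prod G x y" "y \<in> cyc_prod G x y"
  using assms unfolding cyc_prod_def set_mult_def
  by (force intro: generate.one generate.incl)+

lemma cyc_prod_subset:
  assumes "subgroup H G" "x \<in> H" "y \<in> H"
  shows "cyc_prod G x y \<subseteq> H"
  unfolding cyc_prod_def set_mult_def
  using generate_singleton_subset[OF assms(1)] assms subgroup.m_closed[OF assms(1)] by blast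

end

lemma (in finite_p_group) subgroup_of_cyclic:
  assumes z: "z \<in> carrier G" "carrier G = generate G {z}" and H: "subgroup H G"
  shows "\<exists>h\<in>H. H = generate G {h}"
proof -
  have oz: "ord z > 0" using z finite_carrier ord_ge_1 by fastforce
  obtain k where k: "z [^] (p ^ k) = \<one>" using pow_p_power z by blast
  have HG: "H \<subseteq> carrier G" using H by (rule subgroup.subset)
  have "u \<in> generate G {v} \<or> v \<in> generate G {u}" if uv: "u \<in> H" "v \<in> H" for u v
  proof -
    obtain i j :: nat where "u = z [^] i" "v = z [^] j"
      using HG uv unfolding z(2) generate_singleton_nat[OF z(1) oz] by blast
    then show ?thesis using p_power_chain[OF z(1) prime k, of i j] generate_nat_pow z(1) by (metis nat_pow_closed)
  qed
  then obtain h where h: "h \<in> H" "H \<subseteq> generate G {h}"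
    using finite_chain_generator[of H] HG finite_carrier finite_subset subgroup.one_closed[OF H] by blast
  then show ?thesis using generate_singleton_subset[OF H h(1)] by blast
qed

locale cyclic_product = finite_p_group +
  fixes x y
  assumes x: "x \<in> carrier G" and y: "y \<in> carrier G" and carrier_eq: "carrier G = cyc_prod G x y"
begin

lemma elem: "g \<in> carrier G \<Longrightarrow> \<exists>(i::nat) (j::nat). g = x [^] i \<otimes> y [^] j"
  using carrier_eq cyc_prod_mem_iff[OF x y ord_positive[OF x] ord_positive[OF y]] by blast

lemma eq_carrierI: "subgroup H G \<Longrightarrow> x \<in> H \<Longrightarrow> y \<in> H \<Longrightarrow> H = carrier G"
  using cyc_prod_subset[of H x y] carrier_eq subgroup.subset[of H G] by simp

end

text \<open>If one factor is everything, the exponents in \<open>x [^] i \<otimes> y [^] j\<close>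
  carry no information modulo \<open>p\<close> and \<open>frat_mem_iff\<close> fails. The cyclic
  case is split off here and handled by \<open>cyclic_pair_subgroup\<close>.\<close>

locale noncyclic_product = cyclic_product +
  assumes nx: "generate G {x} \<noteq> carrier G" and ny: "generate G {y} \<noteq> carrier G"
begin

text \<open>This is the Frattini subgroup: it is the intersection of a maximal subgroup containing \<open>x\<close> with one
  containing \<open>y\<close>, and it is contained in every maximal subgroup.\<close>

abbreviation frat where "frat \<equiv> cyc_prod G (x [^] p) (y [^] p)"

text \<open>For \<open>g = x [^] i \<otimes> y [^] j\<close>, membership in \<open>U\<close>
  concerns only \<open>y [^] j\<close>, and membership in \<open>V\<close> only
  \<open>x [^] i\<close>; since \<open>y\<close> is outside \<open>U\<close> and \<open>x\<close>
  outside \<open>V\<close>, both exponents are multiples of \<open>p\<close>. In particular the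
  product of the two groups of \<open>p\<close>-th powers is a subgroup, which is not clear
  beforehand.\<close>

lemma frat_eq_Int:
  "\<exists>U V. U \<lhd> G \<and> V \<lhd> G \<and> x \<in> U \<and> y \<notin> U \<and> y \<in> V \<and> x \<notin> V \<and>
    (\<forall>g\<in>carrier G. g [^] p \<in> U \<and> g [^] p \<in> V) \<and>
    (\<forall>g\<in>carrier G. \<forall>h\<in>carrier G. commute_mod G U g h \<and> commute_mod G V g h) \<and> frat = U \<inter> V"
proof -
  have sx: "subgroup (generate G {x}) G" and sy: "subgroup (generate G {y}) G"
    using x y by (auto intro: generate_is_subgroup)
  obtain U where U: "U \<lhd> G" "generate G {x} \<subseteq> U" "U \<noteq> carrier G"
    "\<And>g h. g \<in> carrier G \<Longrightarrow> h \<in> carrier G \<Longrightarrow> commute_mod G U g h"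
    "\<And>g. g \<in> carrier G \<Longrightarrow> g [^] p \<in> U"
    using maximal_subgroup[OF sx nx] by metis
  obtain V where V: "V \<lhd> G" "generate G {y} \<subseteq> V" "V \<noteq> carrier G"
    "\<And>g h. g \<in> carrier G \<Longrightarrow> h \<in> carrier G \<Longrightarrow> commute_mod G V g h"
    "\<And>g. g \<in> carrier G \<Longrightarrow> g [^] p \<in> V"
    using maximal_subgroup[OF sy ny] by metis
  have sU: "subgroup U G" and sV: "subgroup V G" using normal_imp_subgroup[OF U(1)] normal_imp_subgroup[OF V(1)] .
  have xU: "x \<in> U" and yV: "y \<in> V" using U V by (auto intro: generate.incl)
  have yU: "y \<notin> U" using eq_carrierI[OF sU xU] U by blast
  have xV: "x \<notin> V" using eq_carrierI[OF sV _ yV] V by blast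
  have "frat \<subseteq> U \<inter> V"
    using cyc_prod_subset[OF sU] cyc_prod_subset[OF sV] U V x y by (metis Int_subset_iff)
  moreover have "U \<inter> V \<subseteq> frat"
  proof
    fix g assume g: "g \<in> U \<inter> V"
    then have "g \<in> carrier G" using sU subgroup_mem_carrier by blast
    then obtain i j :: nat where ij: "g = x [^] i \<otimes> y [^] j" using elem by blast
    have "y [^] j = inv (x [^] i) \<otimes> g" using ij x y by simp
    then have "y [^] j \<in> U"
      using g subgroup.m_closed[OF sU] subgroup.m_inv_closed[OF sU] subgroup_nat_pow_closed[OF sU xU] by auto
    then have "p dvd j" using nat_pow_mem_prime[OF sU y prime U(5)[OF y]] yU by blast
    have "x [^] i = g \<otimes> inv (y [^] j)" using ij x y by (simp add: m_assoc)
    then have "x [^] i \<in> V"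
      using g subgroup.m_closed[OF sV] subgroup.m_inv_closed[OF sV] subgroup_nat_pow_closed[OF sV yV] by auto
    then have "p dvd i" using nat_pow_mem_prime[OF sV x prime V(5)[OF x]] xV by blast
    obtain i' j' where "i = p * i'" "j = p * j'" using \<open>p dvd i\<close> \<open>p dvd j\<close> by (auto elim!: dvdE)
    then have "g = (x [^] p) [^] i' \<otimes> (y [^] p) [^] j'" using ij x y by (simp add: nat_pow_pow)
    then show "g \<in> frat"
      using cyc_prod_mem_iff[of "x [^] p" "y [^] p" g] x y ord_positive by auto
  qed
  ultimately have "frat = U \<inter> V" by blast
  moreover have "\<forall>g\<in>carrier G. g [^] p \<in> U \<and> g [^] p \<in> V" using U(5) V(5) by simp
  moreover have "\<forall>g\<in>carrier G. \<forall>h\<in>carrier G. commute_mod G U g h \<and> commute_mod G V g h"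
    using U(4) V(4) by simp
  ultimately show ?thesis
    using U(1) V(1) xU yU xV yV by (intro exI[of _ U] exI[of _ V]) simp
qed

lemma frat_normal: "frat \<lhd> G"
  using frat_eq_Int normal_subgroup_intersect by metis

lemma frat_commute: "g \<in> carrier G \<Longrightarrow> h \<in> carrier G \<Longrightarrow> commute_mod G frat g h"
  using frat_eq_Int unfolding commute_mod_def by force

lemma frat_pow: "g \<in> carrier G \<Longrightarrow> g [^] p \<in> frat"
  using frat_eq_Int by force

lemma frat_subgroup: "subgroup frat G"
  using frat_normal by (rule normal_imp_subgroup)

lemma frat_mem_iff: "x [^] (i::nat) \<otimes> y [^] (j::nat) \<in> frat \<longleftrightarrow> p dvd i \<and> p dvd j"
proof
  assume g: "x [^] i \<otimes> y [^] j \<in> frat"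
  obtain U V where UV: "U \<lhd> G" "V \<lhd> G" "x \<in> U" "y \<notin> U" "y \<in> V" "x \<notin> V"
    "\<forall>g\<in>carrier G. g [^] p \<in> U \<and> g [^] p \<in> V" "frat = U \<inter> V" using frat_eq_Int by auto
  have sU: "subgroup U G" and sV: "subgroup V G" using normal_imp_subgroup[OF UV(1)] normal_imp_subgroup[OF UV(2)] .
  have "inv (x [^] i) \<otimes> (x [^] i \<otimes> y [^] j) \<in> U"
    using g UV(8) subgroup.m_closed[OF sU] subgroup.m_inv_closed[OF sU] subgroup_nat_pow_closed[OF sU UV(3)] by blast
  then have "y [^] j \<in> U" using x y by simp
  then have j: "p dvd j" using nat_pow_mem_prime[OF sU y prime] UV y by blast
  have "(x [^] i \<otimes> y [^] j) \<otimes> inv (y [^] j) \<in> V"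
    using g UV(8) subgroup.m_closed[OF sV] subgroup.m_inv_closed[OF sV] subgroup_nat_pow_closed[OF sV UV(5)] by blast
  then have "x [^] i \<in> V" using x y by (simp add: m_assoc)
  then have "p dvd i" using nat_pow_mem_prime[OF sV x prime] UV x by blast
  then show "p dvd i \<and> p dvd j" using j by blast
next
  assume "p dvd i \<and> p dvd j"
  then obtain i' j' where "i = p * i'" "j = p * j'" by (auto elim!: dvdE)
  then have "x [^] i \<otimes> y [^] j = (x [^] p) [^] i' \<otimes> (y [^] p) [^] j'" using x y by (simp add: nat_pow_pow)
  then show "x [^] i \<otimes> y [^] j \<in> frat"
    using cyc_prod_mem_iff[of "x [^] p" "y [^] p"] x y ord_positive by auto
qed

lemma notin_frat: "x \<notin> frat" "y \<notin> frat"
  using frat_mem_iff[of 1 0] frat_mem_iff[of 0 1] x y prime by (auto simp: not_prime_1)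

lemma order_le: "order G \<le> p * p * card frat"
proof -
  have p0: "p > 0" using prime prime_gt_0_nat by blast
  have "carrier G \<subseteq> (\<lambda>(i, j, n). x [^] i \<otimes> n \<otimes> y [^] j) ` ({..<p} \<times> {..<p} \<times> frat)"
  proof
    fix g assume "g \<in> carrier G"
    then obtain i j :: nat where ij: "g = x [^] i \<otimes> y [^] j" using elem by blast
    define n where "n = (x [^] p) [^] (i div p) \<otimes> (y [^] p) [^] (j div p)"
    have "n \<in> frat" unfolding n_def
      using cyc_prod_mem_iff[of "x [^] p" "y [^] p"] x y ord_positive by auto
    moreover have "x [^] (i mod p) \<otimes> (x [^] p) [^] (i div p) = x [^] i"
      "(y [^] p) [^] (j div p) \<otimes> y [^] (j mod p) = y [^] j"
      using x y by (simp_all add: nat_pow_pow nat_pow_mult)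
    then have "g = x [^] (i mod p) \<otimes> n \<otimes> y [^] (j mod p)"
      unfolding n_def ij using x y by (metis (no_types, lifting) m_assoc m_closed nat_pow_closed)
    ultimately show "g \<in> (\<lambda>(i, j, n). x [^] i \<otimes> n \<otimes> y [^] j) ` ({..<p} \<times> {..<p} \<times> frat)"
      using p0 by (intro image_eqI[of _ _ "(i mod p, j mod p, n)"]) auto
  qed
  moreover have fin: "finite frat" using frat_subgroup finite_carrier subgroup.subset finite_subset by blast
  ultimately have "card (carrier G) \<le> card ((\<lambda>(i, j, n). x [^] i \<otimes> n \<otimes> y [^] j) ` ({..<p} \<times> {..<p} \<times> frat))"
    by (intro card_mono) auto
  also have "\<dots> \<le> card ({..<p} \<times> {..<p} \<times> frat)" using fin by (intro card_image_le) auto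
  finally show ?thesis by (simp add: card_cartesian_product order_def mult.assoc)
qed

text \<open>The other two cases are \<open>H = carrier G\<close> and \<open>H\<close> inside
  \<open>frat\<close>. A proper \<open>H\<close> lies in a maximal \<open>W\<close> with at most
  \<open>p * card frat\<close> elements; the cosets of \<open>frat\<close> by powers of
  \<open>h\<close> already supply that many, so they fill \<open>W\<close>.\<close>

lemma subgroup_trichotomy:
  assumes H: "subgroup H G" and "H \<noteq> carrier G" and h: "h \<in> H" "h \<notin> frat" and g: "g \<in> H"
  shows "\<exists>i. \<exists>n\<in>H \<inter> frat. g = n \<otimes> h [^] (i::nat)"
proof -
  obtain W where W: "W \<lhd> G" "H \<subseteq> W" "W \<noteq> carrier G"
    "\<And>g. g \<in> carrier G \<Longrightarrow> g [^] p \<in> W" "order G = p * card W"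
    using maximal_subgroup[OF H \<open>H \<noteq> carrier G\<close>] by metis
  have sW: "subgroup W G" using W by (simp add: normal_imp_subgroup)
  have WG: "W \<subseteq> carrier G" using sW by (rule subgroup.subset)
  have hG: "h \<in> carrier G" using h W WG by blast
  have fin: "finite frat" using frat_subgroup finite_carrier subgroup.subset finite_subset by blast
  have fW: "frat \<subseteq> W" by (rule cyc_prod_subset[OF sW]) (use W x y in auto)
  let ?I = "(\<lambda>(i, n). n \<otimes> h [^] i) ` ({..<p} \<times> frat)"
  have "card ?I = p * card frat"
    by (rule card_cosets_of_prime_pow[OF frat_subgroup hG h(2) frat_pow[OF hG] prime])
  moreover have "card W \<le> p * card frat"
    using order_le W(5) prime prime_gt_0_nat by (simp add: mult.assoc)
  moreover have "?I \<subseteq> W"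
    using fW subsetD[OF W(2) h(1)] subgroup.m_closed[OF sW] subgroup_nat_pow_closed[OF sW] by auto
  ultimately have "?I = W" using WG finite_carrier finite_subset by (metis card_seteq)
  then have "g \<in> ?I" using g W by blast
  then obtain i n where n: "n \<in> frat" "g = n \<otimes> h [^] (i::nat)" by auto
  have "n \<in> carrier G" using n frat_subgroup subgroup_mem_carrier by blast
  then have "n = g \<otimes> inv (h [^] i)" using n hG by (simp add: m_assoc)
  then have "n \<in> H" using g h subgroup.m_closed[OF H] subgroup.m_inv_closed[OF H] subgroup_nat_pow_closed[OF H] by auto
  then show ?thesis using n by blast
qed

end

section \<open>Frattini layers inside an ambient group\<close>

context group
begin

lemma normal_of_commute_mod:
  assumes J: "subgroup J G" and "\<And>g h. g \<in> carrier G \<Longrightarrow> h \<in> J \<Longrightarrow> commute_mod G J g h"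
  shows "J \<lhd> G"
  unfolding normal_inv_iff
proof (intro conjI ballI J)
  fix g h assume g: "g \<in> carrier G" and h: "h \<in> J"
  have hG: "h \<in> carrier G" using h J subgroup_mem_carrier by blast
  have "(g \<otimes> h \<otimes> inv g \<otimes> inv h) \<otimes> h \<in> J"
    using assms(2)[OF g h] h subgroup.m_closed[OF J] unfolding commute_mod_def by blast
  then show "g \<otimes> h \<otimes> inv g \<in> J" using g hG by (simp add: m_assoc)
qed

lemma conj_nat_pow:
  assumes "g \<in> carrier G" "n \<in> carrier G"
  shows "g \<otimes> n [^] (k::nat) \<otimes> inv g = (g \<otimes> n \<otimes> inv g) [^] k"
proof (induction k)
  case (Suc k)
  have "g \<otimes> n [^] Suc k \<otimes> inv g = (g \<otimes> n [^] k \<otimes> inv g) \<otimes> (g \<otimes> n \<otimes> inv g)"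
    using assms by (simp add: m_assoc)
  then show ?case using Suc by simp
qed (use assms in simp)

lemma commute_imp_commute_mod:
  assumes "N \<lhd> G" "x \<in> carrier G" "y \<in> carrier G" "x \<otimes> y = y \<otimes> x"
  shows "commute_mod G N x y"
  unfolding commute_mod_def using assms subgroup.one_closed[OF normal_imp_subgroup[OF assms(1)]]
  by (simp add: m_assoc)

text \<open>If \<open>[x, y]\<close> commutes with \<open>y\<close> modulo \<open>L\<close>, then \<open>[x, y\<^sup>p] = [x, y]\<^sup>p\<close> modulo \<open>L\<close>.\<close>

lemma commute_mod_pow:
  fixes p :: nat
  assumes L: "L \<lhd> G" and x: "x \<in> carrier G" and y: "y \<in> carrier G"
    and cy: "commute_mod G L (x \<otimes> y \<otimes> inv x \<otimes> inv y) y"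
    and cp: "(x \<otimes> y \<otimes> inv x \<otimes> inv y) [^] p \<in> L"
  shows "commute_mod G L x (y [^] p)"
proof -
  define c where "c = x \<otimes> y \<otimes> inv x \<otimes> inv y"
  have c: "c \<in> carrier G" unfolding c_def using x y by simp
  have sL: "subgroup L G" using L by (rule normal_imp_subgroup)
  have "x \<otimes> y \<otimes> inv x = c \<otimes> y" unfolding c_def using x y by (simp add: m_assoc)
  then have e: "x \<otimes> y [^] p \<otimes> inv x = (c \<otimes> y) [^] p" using x y by (simp add: conj_nat_pow)
  have "L #> (c \<otimes> y) [^] p = L #> (c [^] p \<otimes> y [^] p)"
    using nat_pow_mult_mod[OF L c y] cy unfolding c_def .
  then have "(c \<otimes> y) [^] p \<otimes> inv (c [^] p \<otimes> y [^] p) \<in> L"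
    using rcos_eq_iff[OF sL] c y by simp
  then have "((c \<otimes> y) [^] p \<otimes> inv (c [^] p \<otimes> y [^] p)) \<otimes> c [^] p \<in> L"
    using subgroup.m_closed[OF sL] cp unfolding c_def by blast
  moreover have "((c \<otimes> y) [^] p \<otimes> inv (c [^] p \<otimes> y [^] p)) \<otimes> c [^] p = (c \<otimes> y) [^] p \<otimes> inv (y [^] p)"
    using c y by (simp add: m_assoc inv_mult_group)
  ultimately show ?thesis unfolding commute_mod_def e by simp
qed

text \<open>Collection in class two: moving \<open>y [^] n\<close> past one \<open>x\<close> costs
  \<open>c [^] n\<close>, and these exponents add up to
  \<open>0 + 1 + ... + (n - 1)\<close>.\<close>

lemma nat_pow_mult_class_2:
  assumes x: "x \<in> carrier G" and y: "y \<in> carrier G" and c: "c \<in> carrier G"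
    and yx: "y \<otimes> x = c \<otimes> x \<otimes> y" and cx: "c \<otimes> x = x \<otimes> c" and cy: "c \<otimes> y = y \<otimes> c"
  shows "(x \<otimes> y) [^] (n::nat) = c [^] (n * (n - 1) div 2) \<otimes> x [^] n \<otimes> y [^] n"
proof -
  have ynx: "y [^] n \<otimes> x = c [^] n \<otimes> x \<otimes> y [^] n" for n :: nat
  proof (induction n)
    case (Suc n)
    have "y [^] Suc n \<otimes> x = y [^] n \<otimes> (y \<otimes> x)" using x y by (simp add: m_assoc)
    also have "\<dots> = y [^] n \<otimes> c \<otimes> x \<otimes> y" using x y c yx by (simp add: m_assoc)
    also have "y [^] n \<otimes> c = c \<otimes> y [^] n" using group_commutes_pow[of y c n] cy c y by simp
    also have "c \<otimes> y [^] n \<otimes> x \<otimes> y = c \<otimes> (y [^] n \<otimes> x) \<otimes> y" using x y c by (simp add: m_assoc)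
    also have "\<dots> = (c \<otimes> c [^] n) \<otimes> x \<otimes> (y [^] n \<otimes> y)" using x y c Suc by (simp add: m_assoc)
    also have "c \<otimes> c [^] n = c [^] Suc n" using c nat_pow_Suc2 by simp
    finally show ?case using y by simp
  qed (use x in simp)
  show ?thesis
  proof (induction n)
    case (Suc n)
    have e: "Suc n * (Suc n - 1) div 2 = n * (n - 1) div 2 + n"
    proof (cases n)
      case (Suc m)
      have "Suc n * (Suc n - 1) = n * (n - 1) + 2 * n" using Suc by (simp add: algebra_simps)
      then show ?thesis by (metis div_mult_self3 mult.commute zero_neq_numeral add.commute)
    qed simp
    have cxn: "x [^] n \<otimes> c [^] n = c [^] n \<otimes> x [^] n"
      by (rule group_commutes_pow) (use group_commutes_pow[of c x n] cx c x in simp_all)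
    have "(x \<otimes> y) [^] Suc n = c [^] (n * (n - 1) div 2) \<otimes> x [^] n \<otimes> y [^] n \<otimes> (x \<otimes> y)"
      using Suc by simp
    also have "\<dots> = c [^] (n * (n - 1) div 2) \<otimes> x [^] n \<otimes> (y [^] n \<otimes> x) \<otimes> y"
      using x y c by (simp add: m_assoc)
    also have "\<dots> = c [^] (n * (n - 1) div 2) \<otimes> (x [^] n \<otimes> c [^] n) \<otimes> x \<otimes> y [^] n \<otimes> y"
      unfolding ynx using x y c by (simp add: m_assoc)
    also have "\<dots> = (c [^] (n * (n - 1) div 2) \<otimes> c [^] n) \<otimes> (x [^] n \<otimes> x) \<otimes> (y [^] n \<otimes> y)"
      unfolding cxn using x y c by (simp add: m_assoc)
    finally show ?case unfolding e using x y c by (simp add: nat_pow_mult)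
  qed simp
qed

text \<open>Only the product has to be a finite \<open>p\<close>-group, the ambient \<open>G\<close>
  may be infinite. Passing from \<open>x, y\<close> to their \<open>p\<close>-th powers can thus be
  repeated inside one \<open>G\<close>.\<close>

definition p_product :: "nat \<Rightarrow> 'a \<Rightarrow> 'a \<Rightarrow> bool" where
  "p_product p x y \<longleftrightarrow> prime p \<and> x \<in> carrier G \<and> y \<in> carrier G \<and>
     subgroup (cyc_prod G x y) G \<and> (\<exists>n. card (cyc_prod G x y) = p ^ n)"

definition noncyclic_pair :: "'a \<Rightarrow> 'a \<Rightarrow> bool" where
  "noncyclic_pair x y \<longleftrightarrow> generate G {x} \<noteq> cyc_prod G x y \<and> generate G {y} \<noteq> cyc_prod G x y"

lemma p_product_locale:
  assumes "p_product p x y"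
  shows "cyclic_product (G\<lparr>carrier := cyc_prod G x y\<rparr>) p x y"
proof -
  have s: "subgroup (cyc_prod G x y) G" and xy: "x \<in> carrier G" "y \<in> carrier G"
    using assms unfolding p_product_def by auto
  interpret K: group "G\<lparr>carrier := cyc_prod G x y\<rparr>" using s by (rule subgroup_imp_group)
  show ?thesis
    using assms cyc_prod_mems[OF xy] cyc_prod_consistent[OF s cyc_prod_mems[OF xy]]
    by unfold_locales (auto simp: p_product_def order_def)
qed

lemma p_product_noncyclic_locale:
  assumes "p_product p x y" "noncyclic_pair x y"
  shows "noncyclic_product (G\<lparr>carrier := cyc_prod G x y\<rparr>) p x y"
proof -
  have s: "subgroup (cyc_prod G x y) G" and xy: "x \<in> carrier G" "y \<in> carrier G"
    using assms unfolding p_product_def by auto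
  interpret K: cyclic_product "G\<lparr>carrier := cyc_prod G x y\<rparr>" p x y using assms(1) by (rule p_product_locale)
  show ?thesis
    using assms(2) cyc_prod_mems[OF xy] s
    by unfold_locales (auto simp: noncyclic_pair_def generate_consistent)
qed

lemma commute_mod_consistent:
  assumes "subgroup K G" "x \<in> K" "y \<in> K"
  shows "commute_mod (G\<lparr>carrier := K\<rparr>) N x y = commute_mod G N x y"
  unfolding commute_mod_def using assms by simp

text \<open>The facts of \<open>noncyclic_product\<close>, moved from the group with carrier
  \<open>cyc_prod G x y\<close> to \<open>G\<close>, so that iterated Frattini subgroups do not nest
  carriers.\<close>

lemma p_product_frat:
  assumes pp: "p_product p x y" and nc: "noncyclic_pair x y"
  shows "p_product p (x [^] p) (y [^] p)" "cyc_prod G (x [^] p) (y [^] p) \<subseteq> cyc_prod G x y"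
    "g \<in> cyc_prod G x y \<Longrightarrow> h \<in> cyc_prod G x y \<Longrightarrow> commute_mod G (cyc_prod G (x [^] p) (y [^] p)) g h"
    "g \<in> cyc_prod G x y \<Longrightarrow> g [^] p \<in> cyc_prod G (x [^] p) (y [^] p)"
    "x [^] (i::nat) \<otimes> y [^] (j::nat) \<in> cyc_prod G (x [^] p) (y [^] p) \<longleftrightarrow> p dvd i \<and> p dvd j"
    "x \<notin> cyc_prod G (x [^] p) (y [^] p)" "y \<notin> cyc_prod G (x [^] p) (y [^] p)"
    "subgroup H G \<Longrightarrow> H \<subseteq> cyc_prod G x y \<Longrightarrow> H \<noteq> cyc_prod G x y \<Longrightarrow> h \<in> H \<Longrightarrow>
       h \<notin> cyc_prod G (x [^] p) (y [^] p) \<Longrightarrow> g \<in> H \<Longrightarrow>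
       \<exists>i. \<exists>n\<in>H \<inter> cyc_prod G (x [^] p) (y [^] p). g = n \<otimes> h [^] (i::nat)"
proof -
  let ?K = "cyc_prod G x y" and ?N = "cyc_prod G (x [^] p) (y [^] p)"
  have s: "subgroup ?K G" and xy: "x \<in> carrier G" "y \<in> carrier G"
    using pp unfolding p_product_def by auto
  interpret L: noncyclic_product "G\<lparr>carrier := ?K\<rparr>" p x y
    by (rule p_product_noncyclic_locale[OF pp nc])
  have pK: "x [^] p \<in> ?K" "y [^] p \<in> ?K"
    using cyc_prod_mems[OF xy] by (auto intro: subgroup_nat_pow_closed[OF s])
  have f: "L.frat = ?N"
    using cyc_prod_consistent[OF s pK] by (simp flip: nat_pow_consistent)
  show sub: "?N \<subseteq> ?K" using L.frat_subgroup subgroup.subset f by fastforce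
  have sN: "subgroup ?N G" using L.frat_subgroup incl_subgroup[OF s] f by metis
  have "finite_p_group (G\<lparr>carrier := ?K, carrier := ?N\<rparr>) p"
    using L.finite_p_group_subgroup[OF L.frat_subgroup] f by simp
  then have "\<exists>n. card ?N = p ^ n"
    unfolding finite_p_group_def finite_p_group_axioms_def order_def by auto
  then show "p_product p (x [^] p) (y [^] p)" using pp sN unfolding p_product_def by auto
  show "g \<in> ?K \<Longrightarrow> h \<in> ?K \<Longrightarrow> commute_mod G ?N g h"
    using L.frat_commute[of g h] commute_mod_consistent[OF s] f by simp
  show "g \<in> ?K \<Longrightarrow> g [^] p \<in> ?N" using L.frat_pow[of g] f by (simp flip: nat_pow_consistent)
  show "x [^] (i::nat) \<otimes> y [^] (j::nat) \<in> ?N \<longleftrightarrow> p dvd i \<and> p dvd j"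
    using L.frat_mem_iff[of i j] f by (simp flip: nat_pow_consistent)
  show "x \<notin> ?N" "y \<notin> ?N" using L.notin_frat f by auto
  show "\<exists>i. \<exists>n\<in>H \<inter> ?N. g = n \<otimes> h [^] (i::nat)"
    if "subgroup H G" "H \<subseteq> ?K" "H \<noteq> ?K" "h \<in> H" "h \<notin> ?N" "g \<in> H"
    using L.subgroup_trichotomy[of H h g] that f subgroup_incl[OF that(1) s that(2)]
    by (simp flip: nat_pow_consistent)
qed

end

context finite_p_group
begin

text \<open>\<open>L\<close> is the Frattini subgroup of a normal subgroup. Some \<open>w\<close> in
  that subgroup is central modulo \<open>L\<close> and outside \<open>L\<close>; write it as
  \<open>a [^] i \<otimes> b [^] j\<close>. If \<open>p\<close> does not divide \<open>j\<close>,
  then \<open>x\<close> centralises \<open>a\<close> and \<open>w\<close> modulo \<open>L\<close>,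
  hence also \<open>b\<close>; if \<open>p\<close> does not divide \<open>i\<close>, the same works
  for \<open>y\<close> with \<open>a\<close> and \<open>b\<close> exchanged.\<close>

lemma frattini_layer:
  assumes xy: "x \<in> carrier G" "y \<in> carrier G" and xa: "x \<otimes> a = a \<otimes> x" and yb: "y \<otimes> b = b \<otimes> y"
    and pp: "p_product p a b" and nc: "noncyclic_pair a b" and nK: "cyc_prod G a b \<lhd> G"
  defines "L \<equiv> cyc_prod G (a [^] p) (b [^] p)"
  shows "L \<lhd> G" "(\<forall>n\<in>cyc_prod G a b. commute_mod G L x n) \<or> (\<forall>n\<in>cyc_prod G a b. commute_mod G L y n)"
proof -
  note F = p_product_frat[OF pp nc, folded L_def]
  let ?K = "cyc_prod G a b"
  have ab: "a \<in> carrier G" "b \<in> carrier G" using pp unfolding p_product_def by auto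
  have sK: "subgroup ?K G" and sL: "subgroup L G" using pp F(1) unfolding p_product_def L_def by auto
  have KG: "n \<in> carrier G" if "n \<in> ?K" for n using that sK subgroup_mem_carrier by blast
  \<comment> \<open>\<open>L\<close> is generated by the \<open>p\<close>-th powers of all elements
    of \<open>cyc_prod G a b\<close>, a set invariant under conjugation; this gives
    normality.\<close>
  define P where "P = (\<lambda>n. n [^] p) ` ?K"
  have PG: "P \<subseteq> carrier G" unfolding P_def using KG by auto
  have "L = generate G P"
  proof
    show "L \<subseteq> generate G P" unfolding L_def
      using cyc_prod_mems[OF ab] by (intro cyc_prod_subset generate_is_subgroup[OF PG]) (auto simp: P_def intro!: generate.incl)
    show "generate G P \<subseteq> L" using F(4) by (intro generate_subgroup_incl[OF _ sL]) (auto simp: P_def)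
  qed
  moreover have "generate G P \<lhd> G"
  proof (rule normal_generateI[OF PG])
    fix h g assume "h \<in> P" and g: "g \<in> carrier G"
    then obtain n where n: "n \<in> ?K" "h = n [^] p" unfolding P_def by auto
    have "g \<otimes> h \<otimes> inv g = (g \<otimes> n \<otimes> inv g) [^] p" using n g KG conj_nat_pow by simp
    then show "g \<otimes> h \<otimes> inv g \<in> P" unfolding P_def using normal_conj_closed[OF nK g n(1)] by auto
  qed
  ultimately show nL: "L \<lhd> G" by simp
  have "L \<subset> ?K" using F(2,6) cyc_prod_mems[OF ab] by auto
  then obtain w where w: "w \<in> ?K" "w \<notin> L" "\<And>g. g \<in> carrier G \<Longrightarrow> commute_mod G L g w"
    using central_mod[OF nL nK] by blast
  obtain i j :: nat where ij: "w = a [^] i \<otimes> b [^] j"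
    using w(1) cyc_prod_mem_iff[OF ab ord_positive[OF ab(1)] ord_positive[OF ab(2)]] by blast
  have apL: "a [^] p \<in> L" "b [^] p \<in> L" unfolding L_def using cyc_prod_mems ab by auto
  consider "\<not> p dvd j" | "\<not> p dvd i" using F(5)[of i j] w(2) ij by auto
  then show "(\<forall>n\<in>?K. commute_mod G L x n) \<or> (\<forall>n\<in>?K. commute_mod G L y n)"
  proof cases
    case 1
    define S where "S = {n \<in> carrier G. commute_mod G L x n}"
    have sS: "subgroup S G" unfolding S_def by (rule subgroup_commute_mod[OF nL xy(1)])
    have aS: "a \<in> S" unfolding S_def using commute_imp_commute_mod[OF nL xy(1) ab(1) xa] ab by simp
    have wS: "w \<in> S" unfolding S_def using w KG xy by simp
    have "b [^] j = inv (a [^] i) \<otimes> w" using ij ab by simp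
    then have "b [^] j \<in> S"
      using wS subgroup.m_closed[OF sS] subgroup.m_inv_closed[OF sS] subgroup_nat_pow_closed[OF sS aS] by simp
    moreover have "b [^] p \<in> S" unfolding S_def using apL(2) commute_mod_normal[OF nL xy(1)] ab by simp
    ultimately have "b \<in> S" using nat_pow_mem_prime[OF sS ab(2) prime] 1 by blast
    then have "?K \<subseteq> S" using cyc_prod_subset[OF sS aS] by simp
    then show ?thesis unfolding S_def by auto
  next
    case 2
    define S where "S = {n \<in> carrier G. commute_mod G L y n}"
    have sS: "subgroup S G" unfolding S_def by (rule subgroup_commute_mod[OF nL xy(2)])
    have bS: "b \<in> S" unfolding S_def using commute_imp_commute_mod[OF nL xy(2) ab(2) yb] ab by simp
    have wS: "w \<in> S" unfolding S_def using w KG xy by simp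
    have "a [^] i = w \<otimes> inv (b [^] j)" using ij ab by (simp add: m_assoc)
    then have "a [^] i \<in> S"
      using wS subgroup.m_closed[OF sS] subgroup.m_inv_closed[OF sS] subgroup_nat_pow_closed[OF sS bS] by simp
    moreover have "a [^] p \<in> S" unfolding S_def using apL(1) commute_mod_normal[OF nL xy(2)] ab by simp
    ultimately have "a \<in> S" using nat_pow_mem_prime[OF sS ab(1) prime] 2 by blast
    then have "?K \<subseteq> S" using cyc_prod_subset[OF sS _ bS] by simp
    then show ?thesis unfolding S_def by auto
  qed
qed

end

section \<open>Commutators and \<open>p\<close>-th powers between successive Frattini layers\<close>

context noncyclic_product
begin

lemma p_product_self: "p_product p x y" and noncyclic_pair_self: "noncyclic_pair x y"
  using x y carrier_eq nx ny prime order_power subgroup_self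
  unfolding p_product_def noncyclic_pair_def order_def by auto

lemma p_product_frat_self: "p_product p (x [^] p) (y [^] p)"
  using p_product_frat(1)[OF p_product_self noncyclic_pair_self] .

lemma pow_commute: "x \<otimes> x [^] (n::nat) = x [^] n \<otimes> x" "y \<otimes> y [^] (n::nat) = y [^] n \<otimes> y"
  using x y nat_pow_Suc2 by force+

abbreviation frat2 where "frat2 \<equiv> cyc_prod G ((x [^] p) [^] p) ((y [^] p) [^] p)"

lemma frat_mem_carrier: "n \<in> frat \<Longrightarrow> n \<in> carrier G"
  using frat_subgroup subgroup_mem_carrier by blast

lemma pow_p_frat: "x [^] p \<in> frat" "y [^] p \<in> frat"
  using cyc_prod_mems x y by auto

text \<open>By \<open>frattini_layer\<close> one generator, say \<open>x\<close>, centralises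
  \<open>frat\<close> modulo \<open>frat2\<close>. Then \<open>[y, x]\<close> commutes with
  \<open>x\<close> modulo \<open>frat2\<close> and has its \<open>p\<close>-th power there, so
  \<open>y\<close> commutes with \<open>x [^] p\<close>, and trivially with \<open>y [^] p\<close>.
  It follows that \<open>G Mod frat2\<close> has class at most two.\<close>

lemma frat_central:
  assumes nc: "noncyclic_pair (x [^] p) (y [^] p)"
  shows "frat2 \<lhd> G" "g \<in> carrier G \<Longrightarrow> n \<in> frat \<Longrightarrow> commute_mod G frat2 n g"
proof -
  note L = frattini_layer[OF x y pow_commute p_product_frat_self nc frat_normal]
  note F = p_product_frat[OF p_product_frat_self nc]
  show nL: "frat2 \<lhd> G" by (rule L(1))
  have gen: "frat \<subseteq> {n \<in> carrier G. commute_mod G frat2 z n}"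
    if "z \<in> carrier G" "commute_mod G frat2 z (x [^] p)" "commute_mod G frat2 z (y [^] p)" for z
    using that x y by (intro cyc_prod_subset[OF subgroup_commute_mod[OF nL]]) auto
  have self: "commute_mod G frat2 x (x [^] p)" "commute_mod G frat2 y (y [^] p)"
    using commute_imp_commute_mod[OF nL] pow_commute x y by auto
  have xy: "(\<forall>n\<in>frat. commute_mod G frat2 x n) \<and> (\<forall>n\<in>frat. commute_mod G frat2 y n)"
    using L(2)
  proof
    assume A: "\<forall>n\<in>frat. commute_mod G frat2 x n"
    have c: "y \<otimes> x \<otimes> inv y \<otimes> inv x \<in> frat" using frat_commute[OF y x] unfolding commute_mod_def .
    have "commute_mod G frat2 y (x [^] p)"
      using commute_mod_pow[OF nL y x] commute_mod_sym[OF nL x] A c F(4)[OF c] frat_mem_carrier by blast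
    then show ?thesis using A gen[OF y _ self(2)] by blast
  next
    assume A: "\<forall>n\<in>frat. commute_mod G frat2 y n"
    have c: "x \<otimes> y \<otimes> inv x \<otimes> inv y \<in> frat" using frat_commute[OF x y] unfolding commute_mod_def .
    have "commute_mod G frat2 x (y [^] p)"
      using commute_mod_pow[OF nL x y] commute_mod_sym[OF nL y] A c F(4)[OF c] frat_mem_carrier by blast
    then show ?thesis using A gen[OF x self(1)] by blast
  qed
  show "commute_mod G frat2 n g" if g: "g \<in> carrier G" and n: "n \<in> frat"
  proof -
    have nG: "n \<in> carrier G" using n frat_mem_carrier by blast
    have "{g \<in> carrier G. commute_mod G frat2 n g} = carrier G"
      using xy n x y nG by (intro eq_carrierI subgroup_commute_mod[OF nL]) (auto intro: commute_mod_sym[OF nL])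
    then show ?thesis using g by blast
  qed
qed

text \<open>Since \<open>frat\<close> is central modulo \<open>frat2\<close>, the commutators of
  \<open>x\<close> with \<open>y [^] p\<close> and of \<open>y\<close> with \<open>x [^] p\<close>
  lie in \<open>frat2\<close>, on which \<open>x\<close> or \<open>y\<close> acts trivially modulo
  \<open>M\<close>; one more \<open>p\<close>-th power then kills the commutator. \<open>M\<close>
  is the second Frattini layer of \<open>frat\<close>, so for \<open>p = 2\<close> this says that
  \<open>frat\<close> is powerful.\<close>

lemma frat_abelian_mod:
  assumes nc: "noncyclic_pair (x [^] p) (y [^] p)"
    and nc2: "noncyclic_pair ((x [^] p) [^] p) ((y [^] p) [^] p)"
  defines "M \<equiv> cyc_prod G (((x [^] p) [^] p) [^] p) (((y [^] p) [^] p) [^] p)"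
  shows "M \<lhd> G" "m \<in> frat \<Longrightarrow> n \<in> frat \<Longrightarrow> commute_mod G M m n"
proof -
  note C = frat_central[OF nc]
  have pp2: "p_product p ((x [^] p) [^] p) ((y [^] p) [^] p)"
    by (rule p_product_frat(1)[OF p_product_frat_self nc])
  have xx: "x \<otimes> (x [^] p) [^] p = (x [^] p) [^] p \<otimes> x" "y \<otimes> (y [^] p) [^] p = (y [^] p) [^] p \<otimes> y"
    using pow_commute x y by (simp_all add: nat_pow_pow)
  note L = frattini_layer[OF x y xx pp2 nc2 C(1), folded M_def]
  note F = p_product_frat[OF pp2 nc2, folded M_def]
  show nM: "M \<lhd> G" by (rule L(1))
  have G2: "t \<in> carrier G" if "t \<in> frat2" for t
    using that C(1) normal_imp_subgroup subgroup_mem_carrier by blast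
  have xpc: "x [^] p \<in> carrier G" "y [^] p \<in> carrier G" using x y by auto
  have "commute_mod G M (x [^] p) (y [^] p)"
    using L(2)
  proof
    assume A: "\<forall>n\<in>frat2. commute_mod G M x n"
    have c: "y [^] p \<otimes> x \<otimes> inv (y [^] p) \<otimes> inv x \<in> frat2"
      using C(2)[OF x pow_p_frat(2)] unfolding commute_mod_def .
    have "commute_mod G M (y [^] p) (x [^] p)"
      using commute_mod_pow[OF nM xpc(2) x] commute_mod_sym[OF nM x] A c F(4)[OF c] G2 by blast
    then show ?thesis using commute_mod_sym[OF nM xpc(2,1)] by blast
  next
    assume A: "\<forall>n\<in>frat2. commute_mod G M y n"
    have c: "x [^] p \<otimes> y \<otimes> inv (x [^] p) \<otimes> inv y \<in> frat2"
      using C(2)[OF y pow_p_frat(1)] unfolding commute_mod_def .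
    show ?thesis
      using commute_mod_pow[OF nM xpc(1) y] commute_mod_sym[OF nM y] A c F(4)[OF c] G2 by blast
  qed
  note ab = this commute_mod_sym[OF nM xpc this]
  have self: "commute_mod G M z z" if "z \<in> carrier G" for z
    using commute_imp_commute_mod[OF nM that that] by simp
  have gen: "frat \<subseteq> {n \<in> carrier G. commute_mod G M z n}"
    if "z \<in> carrier G" "commute_mod G M z (x [^] p)" "commute_mod G M z (y [^] p)" for z
    using that x y by (intro cyc_prod_subset[OF subgroup_commute_mod[OF nM]]) auto
  have 1: "commute_mod G M (x [^] p) n" "commute_mod G M (y [^] p) n" if "n \<in> frat" for n
    using that gen[OF xpc(1) self ab(1)] gen[OF xpc(2) ab(2) self] xpc by auto
  show "commute_mod G M m n" if "m \<in> frat" "n \<in> frat"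
  proof -
    have mG: "m \<in> carrier G" using that frat_mem_carrier by blast
    show ?thesis
      using gen[OF mG] 1[OF that(1)] commute_mod_sym[OF nM _ mG] xpc that(2) by blast
  qed
qed

text \<open>Write \<open>h\<close> as \<open>x [^] i \<otimes> y [^] j\<close>. If
  \<open>p\<close>-th powers are multiplicative modulo \<open>frat2\<close> in the sense of
  \<open>pow\<close>, then \<open>h [^] p\<close> has the same exponents \<open>i\<close> and
  \<open>j\<close> one layer below, and the divisibility criterion applies in both layers. How
  \<open>pow\<close> is obtained depends on the prime.\<close>

lemma nat_pow_notin_frat2:
  assumes nc: "noncyclic_pair (x [^] p) (y [^] p)" and h: "h \<in> carrier G" "h \<notin> frat"
    and pow: "\<And>(i::nat) (j::nat). (x [^] i \<otimes> y [^] j) [^] p \<in> frat2 \<Longrightarrow> (x [^] i) [^] p \<otimes> (y [^] j) [^] p \<in> frat2"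
  shows "h [^] p \<notin> frat2"
proof
  assume hp: "h [^] p \<in> frat2"
  obtain i j :: nat where ij: "h = x [^] i \<otimes> y [^] j" using elem[OF h(1)] by blast
  have "(x [^] p) [^] i \<otimes> (y [^] p) [^] j \<in> frat2"
    using pow[of i j] hp ij x y by (simp add: nat_pow_pow mult.commute)
  then have "p dvd i \<and> p dvd j" using p_product_frat(5)[OF p_product_frat_self nc] by blast
  then show False using frat_mem_iff ij h(2) by blast
qed

lemma nat_pow_notin_frat2_abelian:
  assumes nc: "noncyclic_pair (x [^] p) (y [^] p)" and h: "h \<in> carrier G" "h \<notin> frat"
    and comm: "\<And>g h. g \<in> carrier G \<Longrightarrow> h \<in> carrier G \<Longrightarrow> commute_mod G frat2 g h"
  shows "h [^] p \<notin> frat2"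
  using nat_pow_mult_mem_iff[OF frat_central(1)[OF nc]] comm x y
  by (intro nat_pow_notin_frat2[OF nc h]) simp

text \<open>The commutator \<open>c\<close> is central modulo \<open>frat2\<close>, so
  \<open>(u \<otimes> v) [^] p\<close> differs from the product of the powers by \<open>c\<close> to
  the exponent \<open>p (p - 1) div 2\<close>. For odd \<open>p\<close> this is a multiple of
  \<open>p\<close>, and \<open>c [^] p\<close> is in \<open>frat2\<close>; for \<open>p = 2\<close>
  it is 1 and the argument breaks down.\<close>

lemma nat_pow_notin_frat2_odd:
  assumes nc: "noncyclic_pair (x [^] p) (y [^] p)" and h: "h \<in> carrier G" "h \<notin> frat" and "p \<noteq> 2"
  shows "h [^] p \<notin> frat2"
proof (rule nat_pow_notin_frat2[OF nc h])
  fix i j :: nat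
  note C = frat_central[OF nc]
  note F = p_product_frat[OF p_product_frat_self nc]
  interpret N: normal frat2 G by (rule C(1))
  interpret Q: group "G Mod frat2" by (rule N.factorgroup_is_group)
  define u v where "u = x [^] i" and "v = y [^] j"
  have uv: "u \<in> carrier G" "v \<in> carrier G" unfolding u_def v_def using x y by auto
  define c where "c = v \<otimes> u \<otimes> inv v \<otimes> inv u"
  have c: "c \<in> frat" using frat_commute[OF uv(2,1)] unfolding commute_mod_def c_def .
  have cG: "c \<in> carrier G" using c frat_mem_carrier by blast
  have "v \<otimes> u = c \<otimes> u \<otimes> v" unfolding c_def using uv by (simp add: m_assoc)
  then have "(frat2 #> v) \<otimes>\<^bsub>G Mod frat2\<^esub> (frat2 #> u)
      = (frat2 #> c) \<otimes>\<^bsub>G Mod frat2\<^esub> (frat2 #> u) \<otimes>\<^bsub>G Mod frat2\<^esub> (frat2 #> v)"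
    using uv cG by (simp add: N.rcos_sum)
  moreover have "(frat2 #> c) \<otimes>\<^bsub>G Mod frat2\<^esub> (frat2 #> u) = (frat2 #> u) \<otimes>\<^bsub>G Mod frat2\<^esub> (frat2 #> c)"
    "(frat2 #> c) \<otimes>\<^bsub>G Mod frat2\<^esub> (frat2 #> v) = (frat2 #> v) \<otimes>\<^bsub>G Mod frat2\<^esub> (frat2 #> c)"
    using C(2)[OF uv(1) c] C(2)[OF uv(2) c] commute_mod_iff_rcos[OF C(1) cG] uv by blast+
  ultimately have "((frat2 #> u) \<otimes>\<^bsub>G Mod frat2\<^esub> (frat2 #> v)) [^]\<^bsub>G Mod frat2\<^esub> p =
    (frat2 #> c) [^]\<^bsub>G Mod frat2\<^esub> (p * (p - 1) div 2) \<otimes>\<^bsub>G Mod frat2\<^esub>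
    (frat2 #> u) [^]\<^bsub>G Mod frat2\<^esub> p \<otimes>\<^bsub>G Mod frat2\<^esub> (frat2 #> v) [^]\<^bsub>G Mod frat2\<^esub> p"
    using uv cG by (intro Q.nat_pow_mult_class_2) (auto simp: rcos_in_FactGroup)
  moreover have "(frat2 #> c) [^]\<^bsub>G Mod frat2\<^esub> (p * (p - 1) div 2) = frat2"
  proof -
    have "odd p" using prime \<open>p \<noteq> 2\<close> prime_odd_nat[OF prime] prime_ge_2_nat[OF prime] by simp
    then have e: "p * (p - 1) div 2 = p * ((p - 1) div 2)" by (intro div_mult_swap[symmetric]) simp
    have "c [^] (p * (p - 1) div 2) = (c [^] p) [^] ((p - 1) div 2)"
      unfolding e nat_pow_pow[OF cG] ..
    then have "c [^] (p * (p - 1) div 2) \<in> frat2"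
      using subgroup_nat_pow_closed[OF N.subgroup_axioms F(4)[OF c], of "(p - 1) div 2"] by metis
    then show ?thesis using cG by (simp add: N.FactGroup_pow rcos_eq_self_iff[OF N.subgroup_axioms])
  qed
  moreover have "((frat2 #> u) \<otimes>\<^bsub>G Mod frat2\<^esub> (frat2 #> v)) [^]\<^bsub>G Mod frat2\<^esub> p = frat2 #> (u \<otimes> v) [^] p"
    unfolding mult_FactGroup N.rcos_sum[OF uv] by (rule N.FactGroup_pow) (use uv in simp)
  moreover have "frat2 \<otimes>\<^bsub>G Mod frat2\<^esub> (frat2 #> u [^] p) = frat2 #> u [^] p"
    using Q.l_one[OF rcos_in_FactGroup, of "u [^] p"] uv by simp
  moreover have "(frat2 #> u [^] p) \<otimes>\<^bsub>G Mod frat2\<^esub> (frat2 #> v [^] p) = frat2 #> (u [^] p \<otimes> v [^] p)"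
    unfolding mult_FactGroup by (rule N.rcos_sum) (use uv in simp_all)
  ultimately have "frat2 #> (u \<otimes> v) [^] p = frat2 #> (u [^] p \<otimes> v [^] p)"
    unfolding N.FactGroup_pow[OF uv(1)] N.FactGroup_pow[OF uv(2)] by metis
  then show "(x [^] i) [^] p \<otimes> (y [^] j) [^] p \<in> frat2" if "(x [^] i \<otimes> y [^] j) [^] p \<in> frat2"
    using that uv rcos_eq_self_iff[OF N.subgroup_axioms] unfolding u_def v_def
    by (metis m_closed nat_pow_closed)
qed

end

lemma (in comm_group) generate_pair:
  assumes "u \<in> carrier G" "v \<in> carrier G"
  shows "generate G {u, v} = cyc_prod G u v"
proof
  have "subgroup (cyc_prod G u v) G"
    unfolding cyc_prod_def using assms by (intro mult_subgroups generate_is_subgroup) auto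
  then show "generate G {u, v} \<subseteq> cyc_prod G u v"
    using cyc_prod_mems[OF assms] by (intro generate_subgroup_incl) auto
  show "cyc_prod G u v \<subseteq> generate G {u, v}"
    using assms by (intro cyc_prod_subset generate_is_subgroup) (auto intro: generate.incl)
qed

section \<open>Bounding the generators of subgroups of a product\<close>

context finite_p_group
begin

text \<open>Steinitz exchange modulo the Frattini subgroup. If neither replacement works,
  \<open>w\<close> and \<open>v\<close> lie in a maximal \<open>V\<close>, \<open>w\<close> and
  \<open>u\<close> in a maximal \<open>U\<close>. In the abelian quotient by \<open>J\<close> one
  has \<open>w = u^i v^j\<close>; read in \<open>V\<close> and in \<open>U\<close> this makes
  \<open>i\<close> and \<open>j\<close> multiples of \<open>p\<close>, so \<open>w\<close> falls
  into \<open>L\<close>.\<close>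

lemma generator_exchange:
  assumes L: "subgroup L G" and comm: "\<And>g h. g \<in> carrier G \<Longrightarrow> h \<in> carrier G \<Longrightarrow> commute_mod G L g h"
    and pw: "\<And>g. g \<in> carrier G \<Longrightarrow> g [^] p \<in> L"
    and w: "w \<in> carrier G" "w \<notin> L" and u: "u \<in> carrier G" and v: "v \<in> carrier G"
    and gen: "carrier G = generate G {u, v}"
  shows "carrier G = generate G {w, u} \<or> carrier G = generate G {w, v}"
proof (rule ccontr)
  assume neg: "\<not> ?thesis"
  have s: "subgroup (generate G {w, v}) G" "subgroup (generate G {w, u}) G"
    using u v w by (auto intro!: generate_is_subgroup)
  obtain V where V: "V \<lhd> G" "generate G {w, v} \<subseteq> V" "V \<noteq> carrier G"
    "\<And>g h. g \<in> carrier G \<Longrightarrow> h \<in> carrier G \<Longrightarrow> commute_mod G V g h" "\<And>g. g \<in> carrier G \<Longrightarrow> g [^] p \<in> V"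
    using maximal_subgroup[OF s(1)] neg by metis
  obtain U where U: "U \<lhd> G" "generate G {w, u} \<subseteq> U" "U \<noteq> carrier G"
    "\<And>g h. g \<in> carrier G \<Longrightarrow> h \<in> carrier G \<Longrightarrow> commute_mod G U g h" "\<And>g. g \<in> carrier G \<Longrightarrow> g [^] p \<in> U"
    using maximal_subgroup[OF s(2)] neg by metis
  have sU: "subgroup U G" and sV: "subgroup V G"
    using normal_imp_subgroup[OF U(1)] normal_imp_subgroup[OF V(1)] .
  have mem: "w \<in> U" "u \<in> U" "w \<in> V" "v \<in> V" using U(2) V(2) by (auto intro: generate.incl)
  have vU: "v \<notin> U" using generate_subgroup_incl[of "{u, v}" U] sU mem gen U(3) subgroup.subset[OF sU] by blast
  have uV: "u \<notin> V" using generate_subgroup_incl[of "{u, v}" V] sV mem gen V(3) subgroup.subset[OF sV] by blast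
  define J where "J = L \<inter> (U \<inter> V)"
  have sJ: "subgroup J G" unfolding J_def using L sU sV subgroups_Inter_pair by blast
  have cJ: "commute_mod G J g h" if "g \<in> carrier G" "h \<in> carrier G" for g h
    using comm[OF that] U(4)[OF that] V(4)[OF that] unfolding J_def commute_mod_def by simp
  have nJ: "J \<lhd> G" using normal_of_commute_mod[OF sJ] cJ subgroup.subset[OF sJ] by blast
  interpret J: normal J G by (rule nJ)
  interpret Q: group "G Mod J" by (rule J.factorgroup_is_group)
  interpret h: group_hom G "G Mod J" "\<lambda>a. J #> a" by unfold_locales (rule J.r_coset_hom_Mod)
  interpret Q: comm_group "G Mod J"
    by (rule Q.group_comm_groupI) (use cJ commute_mod_iff_rcos[OF nJ] in \<open>auto simp: carrier_FactGroup\<close>)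
  interpret Q: finite_p_group "G Mod J" p by (rule finite_p_group_FactGroup[OF nJ])
  have "(\<lambda>a. J #> a) ` generate G {u, v} = generate (G Mod J) ((\<lambda>a. J #> a) ` {u, v})"
    by (rule h.generate_img[symmetric]) (use u v in auto)
  then have "carrier (G Mod J) = generate (G Mod J) {J #> u, J #> v}"
    using gen carrier_FactGroup[of G J] by simp
  then have "J #> w \<in> cyc_prod (G Mod J) (J #> u) (J #> v)"
    using Q.generate_pair u v w rcos_in_FactGroup by metis
  then obtain i j :: nat where "J #> w = (J #> u) [^]\<^bsub>G Mod J\<^esub> i \<otimes>\<^bsub>G Mod J\<^esub> (J #> v) [^]\<^bsub>G Mod J\<^esub> j"
    using Q.cyc_prod_mem_iff[OF rcos_in_FactGroup[OF u] rcos_in_FactGroup[OF v]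
        Q.ord_positive[OF rcos_in_FactGroup[OF u]] Q.ord_positive[OF rcos_in_FactGroup[OF v]]] by blast
  then have "J #> w = (J #> u [^] i) <#> (J #> v [^] j)"
    unfolding J.FactGroup_pow[OF u] J.FactGroup_pow[OF v] mult_FactGroup .
  then have "J #> w = J #> (u [^] i \<otimes> v [^] j)"
    unfolding J.rcos_sum[OF nat_pow_closed[OF u] nat_pow_closed[OF v]] .
  then have c: "w \<otimes> inv (u [^] i \<otimes> v [^] j) \<in> J"
    unfolding rcos_eq_iff[OF sJ w(1) m_closed[OF nat_pow_closed[OF u] nat_pow_closed[OF v]]] .
  define c where "c = w \<otimes> inv (u [^] i \<otimes> v [^] j)"
  have cG: "c \<in> carrier G" unfolding c_def using w u v by simp
  have we: "w = c \<otimes> u [^] i \<otimes> v [^] j" unfolding c_def using w u v by (simp add: m_assoc inv_mult_group)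
  have cJ: "c \<in> L" "c \<in> U" "c \<in> V" using c unfolding c_def J_def by auto
  have "u [^] i = inv c \<otimes> w \<otimes> inv (v [^] j)" using we cG u v by (simp add: m_assoc)
  then have "u [^] i \<in> V"
    using cJ mem subgroup.m_closed[OF sV] subgroup.m_inv_closed[OF sV] subgroup_nat_pow_closed[OF sV] by simp
  then have "p dvd i" using nat_pow_mem_prime[OF sV u prime V(5)[OF u]] uV by blast
  have "v [^] j = inv (c \<otimes> u [^] i) \<otimes> w" using we cG u v by (simp add: m_assoc inv_mult_group)
  then have "v [^] j \<in> U"
    using cJ mem subgroup.m_closed[OF sU] subgroup.m_inv_closed[OF sU] subgroup_nat_pow_closed[OF sU] by simp
  then have "p dvd j" using nat_pow_mem_prime[OF sU v prime U(5)[OF v]] vU by blast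
  obtain i' j' where "i = p * i'" "j = p * j'" using \<open>p dvd i\<close> \<open>p dvd j\<close> by (auto elim!: dvdE)
  then have "w = c \<otimes> (u [^] p) [^] i' \<otimes> (v [^] p) [^] j'" using we u v by (simp add: nat_pow_pow)
  then have "w \<in> L"
    using cJ(1) pw[OF u] pw[OF v] subgroup.m_closed[OF L] subgroup_nat_pow_closed[OF L] by simp
  then show False using w by blast
qed

end

context group
begin

lemma generated_by_2E:
  assumes "generated_by G 2 H"
  obtains u v where "u \<in> carrier G" "v \<in> carrier G" "H = generate G {u, v}"
proof -
  obtain S where S: "finite S" "card S \<le> 2" "S \<subseteq> carrier G" "H = generate G S"
    using assms unfolding generated_by_def by blast
  consider "S = {}" | u where "S = {u}" | u v where "S = {u, v}"
    using S(1,2) by (metis One_nat_def card_0_eq card_1_singletonE card_2_iff le_SucE le_zero_eq numeral_2_eq_2)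
  then show thesis
  proof cases
    case 1
    have "generate G {} = generate G {\<one>, \<one>}"
    proof
      show "generate G {\<one>, \<one>} \<subseteq> generate G {}"
        by (intro generate_subgroup_incl generate_is_subgroup) (auto intro: generate.one)
    qed (simp add: mono_generate)
    then show ?thesis using that[of \<one> \<one>] S 1 by simp
  next
    case 2 then show ?thesis using that[of u u] S by simp
  next
    case 3 then show ?thesis using that[of u v] S by simp
  qed
qed

lemma generated_by_pair:
  assumes "u \<in> carrier G" "v \<in> carrier G"
  shows "generated_by G 2 (generate G {u, v})"
  unfolding generated_by_def using assms card_length[of "[u, v]"] by (intro exI[of _ "{u, v}"]) auto

lemma cyclic_pair_subgroup:
  assumes pp: "p_product p x y" and "\<not> noncyclic_pair x y"
    and H: "subgroup H G" "H \<subseteq> cyc_prod G x y"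
  shows "generated_by G 1 H"
proof -
  have s: "subgroup (cyc_prod G x y) G" and xy: "x \<in> carrier G" "y \<in> carrier G"
    using pp unfolding p_product_def by auto
  interpret K: cyclic_product "G\<lparr>carrier := cyc_prod G x y\<rparr>" p x y using pp by (rule p_product_locale)
  have sH: "subgroup H (G\<lparr>carrier := cyc_prod G x y\<rparr>)" by (rule subgroup_incl[OF H(1) s H(2)])
  obtain z where z: "z \<in> cyc_prod G x y" "generate G {z} = cyc_prod G x y"
    using assms(2) cyc_prod_mems[OF xy] unfolding noncyclic_pair_def by auto
  then obtain h where h: "h \<in> H" "H = generate (G\<lparr>carrier := cyc_prod G x y\<rparr>) {h}"
    using K.subgroup_of_cyclic[of z H] sH s by (auto simp: generate_consistent)
  then have "H = generate G {h}" using generate_consistent[of "{h}" "cyc_prod G x y"] s H by auto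
  then show ?thesis using generated_by_1[of h] h H subgroup_mem_carrier by metis
qed

lemma subgroup_insert_of_trichotomy:
  assumes pp: "p_product p x y" and nc: "noncyclic_pair x y"
    and H: "subgroup H G" "H \<subseteq> cyc_prod G x y" "H \<noteq> cyc_prod G x y"
    and h: "h \<in> H" "h \<notin> cyc_prod G (x [^] p) (y [^] p)"
    and M: "subgroup M G" "h \<in> M" "H \<inter> cyc_prod G (x [^] p) (y [^] p) \<subseteq> M"
  shows "H \<subseteq> M"
proof
  fix g assume "g \<in> H"
  then obtain i :: nat and n where "n \<in> H \<inter> cyc_prod G (x [^] p) (y [^] p)" "g = n \<otimes> h [^] i"
    using p_product_frat(8)[OF pp nc H h] by blast
  then show "g \<in> M" using M(3) subgroup.m_closed[OF M(1)] subgroup_nat_pow_closed[OF M(1,2)] by auto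
qed

text \<open>The generation argument for powerful \<open>p\<close>-groups: a \<open>p\<close>-th power of an element outside the
  Frattini subgroup stays outside the next layer and can therefore replace one generator there.\<close>

lemma two_generated_induct:
  assumes R1: "\<And>x y. R x y \<Longrightarrow> p_product p x y"
    and R2: "\<And>x y. R x y \<Longrightarrow> noncyclic_pair x y \<Longrightarrow> R (x [^] p) (y [^] p)"
    and R3: "\<And>x y h. R x y \<Longrightarrow> noncyclic_pair x y \<Longrightarrow> noncyclic_pair (x [^] p) (y [^] p) \<Longrightarrow>
      h \<in> cyc_prod G x y \<Longrightarrow> h \<notin> cyc_prod G (x [^] p) (y [^] p) \<Longrightarrow>
      h [^] p \<notin> cyc_prod G ((x [^] p) [^] p) ((y [^] p) [^] p)"
  shows "R x y \<Longrightarrow> subgroup H G \<Longrightarrow> H \<subseteq> cyc_prod G x y \<Longrightarrow> generated_by G 2 H"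
proof (induction "card (cyc_prod G x y)" arbitrary: x y H rule: less_induct)
  case less
  let ?K = "cyc_prod G x y" and ?N = "cyc_prod G (x [^] p) (y [^] p)"
  note H = less.prems(2,3)
  have pp: "p_product p x y" by (rule R1[OF less.prems(1)])
  have sK: "subgroup ?K G" and xy: "x \<in> carrier G" "y \<in> carrier G" and prime: "prime p"
    using pp unfolding p_product_def by auto
  interpret K: cyclic_product "G\<lparr>carrier := ?K\<rparr>" p x y using pp by (rule p_product_locale)
  have finK: "finite ?K" using K.finite_carrier by simp
  show ?case
  proof (cases "noncyclic_pair x y")
    case False
    then show ?thesis using cyclic_pair_subgroup[OF pp False H] generated_by_mono by fastforce
  next
    case nc: True
    note F = p_product_frat[OF pp nc]
    have "?N \<subset> ?K" using F(2,6) cyc_prod_mems[OF xy] by auto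
    then have IH: "generated_by G 2 D" if "subgroup D G" "D \<subseteq> ?N" for D
      using less.hyps[of "x [^] p" "y [^] p" D] R2[OF less.prems(1) nc] that psubset_card_mono[OF finK] by blast
    show ?thesis
    proof (cases "H = ?K \<or> H \<subseteq> ?N")
      case True
      then show ?thesis
      proof
        assume "H = ?K"
        have "?K = generate G {x, y}"
        proof
          show "?K \<subseteq> generate G {x, y}"
            using xy by (intro cyc_prod_subset generate_is_subgroup) (auto intro: generate.incl)
          show "generate G {x, y} \<subseteq> ?K" using cyc_prod_mems[OF xy] sK by (intro generate_subgroup_incl) auto
        qed
        then show ?thesis using generated_by_pair[OF xy] \<open>H = ?K\<close> by simp
      qed (rule IH[OF H(1)])
    next
      case False
      then obtain h where h: "h \<in> H" "h \<notin> ?N" and HK: "H \<noteq> ?K" by blast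
      have hG: "h \<in> carrier G" using h(1) H(1) subgroup_mem_carrier by blast
      define D where "D = H \<inter> ?N"
      have pN: "p_product p (x [^] p) (y [^] p)" by (rule F(1))
      have sN: "subgroup ?N G" using pN unfolding p_product_def by simp
      have sD: "subgroup D G" unfolding D_def using H(1) sN subgroups_Inter_pair by blast
      have DH: "D \<subseteq> H" "D \<subseteq> ?N" unfolding D_def by auto
      have HM: "H \<subseteq> M" if "subgroup M G" "h \<in> M" "D \<subseteq> M" for M
        using subgroup_insert_of_trichotomy[OF pp nc H HK h] that unfolding D_def by blast
      have hp: "h [^] p \<in> D"
        unfolding D_def using subgroup_nat_pow_closed[OF H(1) h(1)] F(4) h(1) H(2) by blast
      show ?thesis
      proof (cases "noncyclic_pair (x [^] p) (y [^] p)")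
        case False
        then have "generated_by G 1 D" using cyclic_pair_subgroup[OF pN False sD DH(2)] by simp
        then have "generated_by G (Suc 1) H"
          using generated_by_insert[OF hG _ h(1) DH(1) H(1) HM] by blast
        then show ?thesis by (simp add: numeral_2_eq_2)
      next
        case nc2: True
        define L where "L = cyc_prod G ((x [^] p) [^] p) ((y [^] p) [^] p)"
        note F2 = p_product_frat[OF pN nc2, folded L_def]
        have sL: "subgroup L G" using F2(1) unfolding p_product_def L_def by simp
        have hpL: "h [^] p \<notin> L" unfolding L_def using R3[OF less.prems(1) nc nc2 _ h(2)] h(1) H(2) by blast
        obtain u v where uv: "u \<in> carrier G" "v \<in> carrier G" "D = generate G {u, v}"
          using IH[OF sD DH(2)] generated_by_2E by blast
        have uvD: "u \<in> D" "v \<in> D" using uv by (auto intro: generate.incl)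
        have DK: "D \<subseteq> ?K" using DH H by blast
        interpret D: finite_p_group "G\<lparr>carrier := D\<rparr>" p
          using K.finite_p_group_subgroup[OF subgroup_incl[OF sD sK DK]] by simp
        have sLD: "subgroup (L \<inter> D) (G\<lparr>carrier := D\<rparr>)"
          using sL sD subgroups_Inter_pair by (intro subgroup_incl) auto
        have cD: "commute_mod (G\<lparr>carrier := D\<rparr>) (L \<inter> D) a b" if "a \<in> D" "b \<in> D" for a b
        proof -
          have "commute_mod G L a b" using F2(3) that DH by blast
          moreover have "a \<otimes> b \<otimes> inv a \<otimes> inv b \<in> D"
            using that subgroup.m_closed[OF sD] subgroup.m_inv_closed[OF sD] by blast
          ultimately show ?thesis
            using commute_mod_consistent[OF sD that] unfolding commute_mod_def by simp
        qed
        have pD: "a [^] p \<in> L \<inter> D" if "a \<in> D" for a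
          using F2(4) that DH subgroup_nat_pow_closed[OF sD] by blast
        have "D = generate G {h [^] p, u} \<or> D = generate G {h [^] p, v}"
        proof -
          have gc: "generate (G\<lparr>carrier := D\<rparr>) {a, b} = generate G {a, b}" if "a \<in> D" "b \<in> D" for a b
            using that by (intro generate_consistent[OF _ sD]) auto
          have "D = generate (G\<lparr>carrier := D\<rparr>) {u, v}" using gc[OF uvD] uv(3) by simp
          then have "D = generate (G\<lparr>carrier := D\<rparr>) {h [^] p, u} \<or> D = generate (G\<lparr>carrier := D\<rparr>) {h [^] p, v}"
            using D.generator_exchange[OF sLD, of "h [^] p" u v] cD pD hp hpL uvD
            by (simp flip: nat_pow_consistent)
          then show ?thesis using gc hp uvD by simp
        qed
        \<comment> \<open>In \<open>H\<close> the generator \<open>h [^] p\<close> of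
          \<open>D\<close> is redundant, being a power of \<open>h\<close>; so \<open>H\<close>
          needs \<open>h\<close> and \<open>z\<close> and not a third element.\<close>
        then obtain z where z: "z \<in> D" "D = generate G {h [^] p, z}" using uvD by blast
        have zG: "z \<in> carrier G" using z(1) sD subgroup_mem_carrier by blast
        have "H = generate G {h, z}"
        proof
          show "generate G {h, z} \<subseteq> H" using h(1) z(1) DH H(1) by (intro generate_subgroup_incl) auto
          have s: "subgroup (generate G {h, z}) G" using hG zG by (intro generate_is_subgroup) auto
          have "h \<in> generate G {h, z}" "z \<in> generate G {h, z}" by (auto intro: generate.incl)
          then have "generate G {h [^] p, z} \<subseteq> generate G {h, z}"
            using subgroup_nat_pow_closed[OF s] by (intro generate_subgroup_incl[OF _ s]) auto
          then show "H \<subseteq> generate G {h, z}" using HM[OF s] \<open>h \<in> generate G {h, z}\<close> z(2) by blast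
        qed
        then show ?thesis using generated_by_pair[OF hG zG] by simp
      qed
    qed
  qed
qed

lemma p_product_transfer:
  assumes pp: "p_product p x y"
  defines "K \<equiv> cyc_prod G x y"
  shows "cyc_prod (G\<lparr>carrier := K\<rparr>) (x [^] p) (y [^] p) = cyc_prod G (x [^] p) (y [^] p)"
    "group.noncyclic_pair (G\<lparr>carrier := K\<rparr>) (x [^] p) (y [^] p) = noncyclic_pair (x [^] p) (y [^] p)"
    "group.noncyclic_pair (G\<lparr>carrier := K\<rparr>) ((x [^] p) [^] p) ((y [^] p) [^] p)
       = noncyclic_pair ((x [^] p) [^] p) ((y [^] p) [^] p)"
    "cyc_prod (G\<lparr>carrier := K\<rparr>) ((x [^] p) [^] p) ((y [^] p) [^] p) = cyc_prod G ((x [^] p) [^] p) ((y [^] p) [^] p)"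
    "cyc_prod (G\<lparr>carrier := K\<rparr>) (((x [^] p) [^] p) [^] p) (((y [^] p) [^] p) [^] p)
       = cyc_prod G (((x [^] p) [^] p) [^] p) (((y [^] p) [^] p) [^] p)"
proof -
  have sK: "subgroup K G" and xy: "x \<in> carrier G" "y \<in> carrier G"
    using pp unfolding p_product_def K_def by auto
  interpret K: group "G\<lparr>carrier := K\<rparr>" using sK by (rule subgroup_imp_group)
  have mem: "x \<in> K" "y \<in> K" unfolding K_def using cyc_prod_mems[OF xy] by auto
  note pw = subgroup_nat_pow_closed[OF sK]
  have c: "cyc_prod (G\<lparr>carrier := K\<rparr>) a b = cyc_prod G a b" "K.noncyclic_pair a b = noncyclic_pair a b"
    if ab: "a \<in> K" "b \<in> K" for a b
    using cyc_prod_consistent[OF sK ab] generate_consistent[of "{a}" K] generate_consistent[of "{b}" K] sK ab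
    unfolding K.noncyclic_pair_def noncyclic_pair_def by auto
  show "cyc_prod (G\<lparr>carrier := K\<rparr>) (x [^] p) (y [^] p) = cyc_prod G (x [^] p) (y [^] p)"
    "K.noncyclic_pair (x [^] p) (y [^] p) = noncyclic_pair (x [^] p) (y [^] p)"
    "K.noncyclic_pair ((x [^] p) [^] p) ((y [^] p) [^] p)
       = noncyclic_pair ((x [^] p) [^] p) ((y [^] p) [^] p)"
    "cyc_prod (G\<lparr>carrier := K\<rparr>) ((x [^] p) [^] p) ((y [^] p) [^] p) = cyc_prod G ((x [^] p) [^] p) ((y [^] p) [^] p)"
    "cyc_prod (G\<lparr>carrier := K\<rparr>) (((x [^] p) [^] p) [^] p) (((y [^] p) [^] p) [^] p)
       = cyc_prod G (((x [^] p) [^] p) [^] p) (((y [^] p) [^] p) [^] p)"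
    by (intro c pw mem)+
qed

lemma p_product_pow_notin_odd:
  assumes pp: "p_product p x y" and nc: "noncyclic_pair x y" and nc2: "noncyclic_pair (x [^] p) (y [^] p)"
    and "p \<noteq> 2" and h: "h \<in> cyc_prod G x y" "h \<notin> cyc_prod G (x [^] p) (y [^] p)"
  shows "h [^] p \<notin> cyc_prod G ((x [^] p) [^] p) ((y [^] p) [^] p)"
proof -
  interpret K: noncyclic_product "G\<lparr>carrier := cyc_prod G x y\<rparr>" p x y
    by (rule p_product_noncyclic_locale[OF pp nc])
  note T = p_product_transfer[OF pp]
  show ?thesis
    using K.nat_pow_notin_frat2_odd[of h] T nc2 h \<open>p \<noteq> 2\<close> by (simp flip: nat_pow_consistent)
qed

lemma p_product_pow_notin_layer:
  assumes pp: "p_product p x y" and nc: "noncyclic_pair x y" and nc2: "noncyclic_pair (x [^] p) (y [^] p)"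
    and nc3: "noncyclic_pair ((x [^] p) [^] p) ((y [^] p) [^] p)"
    and h: "h \<in> cyc_prod G (x [^] p) (y [^] p)" "h \<notin> cyc_prod G ((x [^] p) [^] p) ((y [^] p) [^] p)"
  shows "h [^] p \<notin> cyc_prod G (((x [^] p) [^] p) [^] p) (((y [^] p) [^] p) [^] p)"
proof -
  let ?N = "cyc_prod G (x [^] p) (y [^] p)" and ?M = "cyc_prod G (((x [^] p) [^] p) [^] p) (((y [^] p) [^] p) [^] p)"
  note F = p_product_frat[OF pp nc]
  interpret K: noncyclic_product "G\<lparr>carrier := cyc_prod G x y\<rparr>" p x y
    by (rule p_product_noncyclic_locale[OF pp nc])
  interpret N: noncyclic_product "G\<lparr>carrier := ?N\<rparr>" p "x [^] p" "y [^] p"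
    by (rule p_product_noncyclic_locale[OF F(1) nc2])
  note T = p_product_transfer[OF pp]
  note TN = p_product_transfer[OF F(1)]
  have sN: "subgroup ?N G" and sK: "subgroup (cyc_prod G x y) G"
    using pp F(1) unfolding p_product_def by simp_all
  have K3: "K.noncyclic_pair ((x [^] p) [^] p) ((y [^] p) [^] p)"
    using T(3) nc3 by simp
  have "commute_mod G ?M a b" if ab: "a \<in> ?N" "b \<in> ?N" for a b
    using K.frat_abelian_mod(2)[of a b] T nc2 K3 ab F(2) commute_mod_consistent[OF sK, of a b ?M]
    by (simp add: subset_eq flip: nat_pow_consistent)
  then have "commute_mod (G\<lparr>carrier := ?N\<rparr>) ?M a b" if "a \<in> ?N" "b \<in> ?N" for a b
    using commute_mod_consistent[OF sN] that by simp
  then show ?thesis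
    using N.nat_pow_notin_frat2_abelian[of h] TN nc3 h by (simp flip: nat_pow_consistent)
qed

text \<open>For \<open>p = 2\<close> the step on \<open>p\<close>-th powers is available only from
  the Frattini subgroup on, where two generators suffice as for odd \<open>p\<close>. A subgroup not
  inside it is recovered from its intersection with it by one further element, which accounts for
  3.\<close>

theorem p_product_subgroup_generated:
  assumes pp: "p_product p x y" and H: "subgroup H G" "H \<subseteq> cyc_prod G x y"
  shows "generated_by G (if p = 2 then 3 else 2) H"
proof (cases "noncyclic_pair x y")
  case False
  then show ?thesis using cyclic_pair_subgroup[OF pp False H] generated_by_mono by fastforce
next
  case nc: True
  note F = p_product_frat[OF pp nc]
  show ?thesis
  proof (cases "p = 2")
    case False
    have "generated_by G 2 H"
      by (rule two_generated_induct[where R = "p_product p", OF _ _ _ pp H])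
        (use p_product_frat(1) p_product_pow_notin_odd[OF _ _ _ False] in blast)+
    then show ?thesis using False by simp
  next
    case True
    \<comment> \<open>\<open>R\<close> singles out pairs whose product is already the Frattini
      subgroup of a noncyclic product; the relation passes to the next layer by itself.\<close>
    define R where "R = (\<lambda>a b. \<exists>u v. p_product p u v \<and> noncyclic_pair u v \<and> a = u [^] p \<and> b = v [^] p)"
    have two: "generated_by G 2 D" if D: "subgroup D G" "D \<subseteq> cyc_prod G (x [^] p) (y [^] p)" for D
    proof (rule two_generated_induct[where R = R, OF _ _ _ _ D])
      show "R (x [^] p) (y [^] p)" unfolding R_def using pp nc by blast
      fix a b assume ab: "R a b"
      then show "p_product p a b" unfolding R_def using p_product_frat(1) by blast
      then show "noncyclic_pair a b \<Longrightarrow> R (a [^] p) (b [^] p)" unfolding R_def by blast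
      fix h
      show "h [^] p \<notin> cyc_prod G ((a [^] p) [^] p) ((b [^] p) [^] p)"
        if "noncyclic_pair a b" "noncyclic_pair (a [^] p) (b [^] p)"
          "h \<in> cyc_prod G a b" "h \<notin> cyc_prod G (a [^] p) (b [^] p)"
        using ab that p_product_pow_notin_layer unfolding R_def by blast
    qed
    show ?thesis
    proof (cases "H = cyc_prod G x y \<or> H \<subseteq> cyc_prod G (x [^] p) (y [^] p)")
      case True
      then show ?thesis
      proof
        assume HK: "H = cyc_prod G x y"
        have xy: "x \<in> carrier G" "y \<in> carrier G" using pp unfolding p_product_def by auto
        have "generated_by G (Suc 1) H"
        proof (rule generated_by_insert[OF xy(1) generated_by_1[OF xy(2)] _ _ H(1)])
          show "x \<in> H" using HK cyc_prod_mems[OF xy] by simp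
          show "generate G {y} \<subseteq> H" using generate_singleton_subset[OF H(1)] HK cyc_prod_mems[OF xy] by simp
          show "H \<subseteq> L" if "subgroup L G" "x \<in> L" "generate G {y} \<subseteq> L" for L
            using cyc_prod_subset[OF that(1,2)] that(3) HK generate.incl[of y "{y}" G] by blast
        qed
        then show ?thesis using generated_by_mono by fastforce
      qed (use two[OF H(1)] generated_by_mono in fastforce)
    next
      case False
      then obtain h where h: "h \<in> H" "h \<notin> cyc_prod G (x [^] p) (y [^] p)" and HK: "H \<noteq> cyc_prod G x y" by blast
      have sN: "subgroup (cyc_prod G (x [^] p) (y [^] p)) G" using F(1) unfolding p_product_def by simp
      have "generated_by G 2 (H \<inter> cyc_prod G (x [^] p) (y [^] p))"
        by (rule two) (use H(1) sN subgroups_Inter_pair in auto)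
      then have "generated_by G (Suc 2) H"
        using H(1) h subgroup_mem_carrier subgroup_insert_of_trichotomy[OF pp nc H HK h]
        by (intro generated_by_insert[of h 2 "H \<inter> cyc_prod G (x [^] p) (y [^] p)"]) auto
      then show ?thesis using \<open>p = 2\<close> by (simp add: numeral_3_eq_3 numeral_2_eq_2)
    qed
  qed
qed

section \<open>Lifting generators through abelian chief factors\<close>

lemma card_set_mult:
  assumes H: "subgroup H G" and K: "subgroup K G"
  shows "card (H <#> K) * card (H \<inter> K) = card H * card K"
proof -
  have HG: "h \<in> carrier G" if "h \<in> H" for h using that H subgroup_mem_carrier by blast
  have KG: "k \<in> carrier G" if "k \<in> K" for k using that K subgroup_mem_carrier by blast
  have "\<forall>g\<in>H <#> K. \<exists>h. \<exists>k. h \<in> H \<and> k \<in> K \<and> g = h \<otimes> k" unfolding set_mult_def by auto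
  then obtain r s where rs: "\<And>g. g \<in> H <#> K \<Longrightarrow> r g \<in> H \<and> s g \<in> K \<and> g = r g \<otimes> s g" by metis
  \<comment> \<open>Each \<open>g\<close> has the chosen factorisation
    \<open>r g \<otimes> s g\<close>; every other one arises by shifting some \<open>t\<close> in
    \<open>H \<inter> K\<close> from the second factor to the first.\<close>
  have "bij_betw (\<lambda>(g, t). (r g \<otimes> t, inv t \<otimes> s g)) ((H <#> K) \<times> (H \<inter> K)) (H \<times> K)"
  proof (rule bij_betw_imageI)
    show "inj_on (\<lambda>(g, t). (r g \<otimes> t, inv t \<otimes> s g)) ((H <#> K) \<times> (H \<inter> K))"
    proof (rule inj_onI, clarsimp)
      fix g t g' t' assume g: "g \<in> H <#> K" "g' \<in> H <#> K" "t \<in> H" "t \<in> K" "t' \<in> H" "t' \<in> K"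
        and e: "r g \<otimes> t = r g' \<otimes> t'" "inv t \<otimes> s g = inv t' \<otimes> s g'"
      have "(r g \<otimes> t) \<otimes> (inv t \<otimes> s g) = g" "(r g' \<otimes> t') \<otimes> (inv t' \<otimes> s g') = g'"
        using rs[OF g(1)] rs[OF g(2)] g HG KG by (simp_all add: m_assoc)
      then have "g = g'" using e by simp
      then show "g = g' \<and> t = t'" using e(1) rs[OF g(1)] g HG
        by (metis Units_eq Units_l_cancel)
    qed
    show "(\<lambda>(g, t). (r g \<otimes> t, inv t \<otimes> s g)) ` ((H <#> K) \<times> (H \<inter> K)) = H \<times> K"
    proof (intro equalityI subsetI)
      fix z assume "z \<in> (\<lambda>(g, t). (r g \<otimes> t, inv t \<otimes> s g)) ` ((H <#> K) \<times> (H \<inter> K))"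
      then show "z \<in> H \<times> K"
        using rs subgroup.m_closed[OF H] subgroup.m_closed[OF K] subgroup.m_inv_closed[OF K] by auto
    next
      fix z assume "z \<in> H \<times> K"
      then obtain h k where z: "z = (h, k)" "h \<in> H" "k \<in> K" by auto
      define g where "g = h \<otimes> k"
      define t where "t = inv (r g) \<otimes> h"
      have g: "g \<in> H <#> K" unfolding g_def using z set_mult_memI by blast
      have rg: "r g \<in> H" "s g \<in> K" "g = r g \<otimes> s g" using rs[OF g] by auto
      have "t = s g \<otimes> inv k"
      proof -
        have "h \<otimes> k = r g \<otimes> s g" using rg(3) g_def by simp
        then have "h = r g \<otimes> s g \<otimes> inv k"
          using inv_solve_right[of h "r g \<otimes> s g" k] HG[OF z(2)] KG[OF z(3)] HG[OF rg(1)] KG[OF rg(2)] by simp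
        then have "t = inv (r g) \<otimes> (r g \<otimes> s g \<otimes> inv k)" unfolding t_def by (rule arg_cong)
        then show ?thesis using KG[OF z(3)] HG[OF rg(1)] KG[OF rg(2)] by (simp add: m_assoc)
      qed
      then have "t \<in> K" using rg z subgroup.m_closed[OF K] subgroup.m_inv_closed[OF K] by simp
      moreover have "t \<in> H" unfolding t_def using rg z subgroup.m_closed[OF H] subgroup.m_inv_closed[OF H] by simp
      moreover have "r g \<otimes> t = h" unfolding t_def using rg z HG by simp
      moreover have "inv t \<otimes> s g = k"
        unfolding \<open>t = s g \<otimes> inv k\<close> using rg z KG by (simp add: inv_mult_group m_assoc)
      ultimately show "z \<in> (\<lambda>(g, t). (r g \<otimes> t, inv t \<otimes> s g)) ` ((H <#> K) \<times> (H \<inter> K))"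
        using g z(1) by (intro image_eqI[of _ _ "(g, t)"]) auto
    qed
  qed
  then have "card ((H <#> K) \<times> (H \<inter> K)) = card (H \<times> K)" by (rule bij_betw_same_card)
  then show ?thesis by (simp add: card_cartesian_product)
qed

lemma card_subgroup_dvd:
  assumes "subgroup S G" "subgroup T G" "S \<subseteq> T"
  shows "card S dvd card T"
proof -
  have "card (rcosets\<^bsub>G\<lparr>carrier := T\<rparr>\<^esub> S) * card S = order (G\<lparr>carrier := T\<rparr>)"
    by (rule group.lagrange[OF subgroup_imp_group[OF assms(2)] subgroup_incl[OF assms]])
  then have "card T = card (rcosets\<^bsub>G\<lparr>carrier := T\<rparr>\<^esub> S) * card S" unfolding order_def by simp
  then show ?thesis by (rule dvdI[OF trans]) (rule mult.commute)
qed

lemma commute_mod_derived: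
  assumes "g \<in> carrier G" "h \<in> carrier G"
  shows "commute_mod G (derived G (carrier G)) g h"
  unfolding commute_mod_def derived_def using assms by (auto intro!: generate.incl)

lemma derived_subset:
  assumes "subgroup L G" "\<And>g h. g \<in> carrier G \<Longrightarrow> h \<in> carrier G \<Longrightarrow> commute_mod G L g h"
  shows "derived G (carrier G) \<subseteq> L"
  unfolding derived_def using assms by (intro generate_subgroup_incl) (auto simp: commute_mod_def)

lemma coprime_nat_pow_mem:
  assumes T: "subgroup T G" and s: "s \<in> carrier G" and "coprime m (n::nat)" "s [^] m \<in> T" "s [^] n \<in> T"
  shows "s \<in> T"
proof (cases "m = 0")
  case True then show ?thesis using assms by simp
next
  case False
  then obtain a b where ab: "m * a = n * b + 1"
    using bezout_nat[of m n] \<open>coprime m n\<close> by (auto simp: coprime_iff_gcd_eq_1)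
  have "(s [^] m) [^] a = (s [^] n) [^] b \<otimes> s" using s ab by (simp add: nat_pow_pow)
  then have "s = inv ((s [^] n) [^] b) \<otimes> (s [^] m) [^] a" using s by simp
  then show ?thesis
    using subgroup_nat_pow_closed[OF T] assms(4,5) subgroup.m_closed[OF T] subgroup.m_inv_closed[OF T] by metis
qed

lemma card_generate_elementary:
  assumes "finite X" "X \<subseteq> carrier G" and D: "subgroup D G" and fin: "finite (carrier G)" and p: "prime (p::nat)"
    and comm: "\<And>g h. g \<in> carrier G \<Longrightarrow> h \<in> carrier G \<Longrightarrow> commute_mod G D g h"
    and pw: "\<And>g. g \<in> carrier G \<Longrightarrow> g [^] p \<in> D"
  shows "card (generate G (X \<union> D)) \<le> p ^ card X * card D"
  using assms(1,2)
proof (induction X rule: finite_induct)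
  case empty
  have "generate G D \<subseteq> D" using D by (intro generate_subgroup_incl) auto
  then show ?case using fin D subgroup.subset[OF D] by (simp add: card_mono finite_subset)
next
  case (insert x X)
  have DG: "D \<subseteq> carrier G" using D by (rule subgroup.subset)
  define T where "T = generate G (X \<union> D)"
  have sT: "subgroup T G" unfolding T_def using insert DG by (intro generate_is_subgroup) auto
  have DT: "D \<subseteq> T" unfolding T_def by (auto intro: generate.incl)
  have nT: "T \<lhd> G"
    using normal_of_commute_mod[OF sT] comm subgroup.subset[OF sT] DT unfolding commute_mod_def by blast
  have xG: "x \<in> carrier G" using insert by auto
  have TG: "t \<in> carrier G" if "t \<in> T" for t using that sT subgroup_mem_carrier by blast
  define Y where "Y = T <#> generate G {x}"
  have sx: "subgroup (generate G {x}) G" using xG by (auto intro: generate_is_subgroup)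
  have sY: "subgroup Y G" unfolding Y_def using mult_norm_subgroup[OF nT sx] .
  have sub: "T \<subseteq> Y" "x \<in> Y" unfolding Y_def using set_mult_supersets[OF sT sx] by (auto intro: generate.incl)
  have "generate G (insert x X \<union> D) \<subseteq> Y"
    by (rule generate_subgroup_incl[OF _ sY]) (use sub T_def in \<open>auto intro: generate.incl\<close>)
  moreover have "Y \<subseteq> (\<lambda>(i, t). t \<otimes> x [^] i) ` ({..<p} \<times> T)"
  proof
    fix g assume "g \<in> Y"
    then obtain t z where tz: "t \<in> T" "z \<in> generate G {x}" "g = t \<otimes> z" unfolding Y_def by (rule set_mult_memE)
    have "ord x > 0" using fin xG ord_ge_1 by fastforce
    then obtain i :: nat where i: "z = x [^] i" using tz(2) generate_singleton_nat[OF xG] by blast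
    have "x [^] i = (x [^] p) [^] (i div p) \<otimes> x [^] (i mod p)"
      using xG by (simp add: nat_pow_pow nat_pow_mult)
    then have "g = (t \<otimes> (x [^] p) [^] (i div p)) \<otimes> x [^] (i mod p)"
      using tz i xG TG by (simp add: m_assoc)
    moreover have "t \<otimes> (x [^] p) [^] (i div p) \<in> T"
      using tz subgroup.m_closed[OF sT] subgroup_nat_pow_closed[OF sT] pw[OF xG] DT by blast
    moreover have "i mod p < p" using p prime_gt_0_nat by simp
    ultimately show "g \<in> (\<lambda>(i, t). t \<otimes> x [^] i) ` ({..<p} \<times> T)" by force
  qed
  moreover have finT: "finite T" using fin sT subgroup.subset finite_subset by blast
  ultimately have "card (generate G (insert x X \<union> D)) \<le> card ((\<lambda>(i, t). t \<otimes> x [^] i) ` ({..<p} \<times> T))"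
    by (intro card_mono) auto
  also have "\<dots> \<le> card ({..<p} \<times> T)" using finT by (intro card_image_le) auto
  also have "\<dots> \<le> p * (p ^ card X * card D)"
    using insert T_def by (simp add: card_cartesian_product)
  finally show ?case using insert by (simp add: mult.assoc)
qed

text \<open>The quotient by \<open>D\<close> is an elementary abelian \<open>p\<close>-group, so a
  Sylow \<open>p\<close>-subgroup covers it, and the \<open>d\<close> generators of the latter
  generate it.\<close>

lemma generated_by_index_bound:
  assumes fin: "finite (carrier G)" and p: "prime (p::nat)" and D: "subgroup D G"
    and comm: "\<And>g h. g \<in> carrier G \<Longrightarrow> h \<in> carrier G \<Longrightarrow> commute_mod G D g h"
    and pw: "\<And>g. g \<in> carrier G \<Longrightarrow> g [^] p \<in> D"
    and gen: "\<And>S n. subgroup S G \<Longrightarrow> card S = p ^ n \<Longrightarrow> generated_by G d S"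
  shows "order G \<le> p ^ d * card D"
proof -
  have nD: "D \<lhd> G" using normal_of_commute_mod[OF D] comm subgroup.subset[OF D] by blast
  have o0: "order G \<noteq> 0" using fin order_gt_0_iff_finite by simp
  define k where "k = multiplicity p (order G)"
  obtain r where r: "order G = p ^ k * r" "\<not> p dvd r"
    unfolding k_def using o0 p by (metis multiplicity_decompose' not_prime_unit)
  obtain S where S: "subgroup S G" "card S = p ^ k"
    using sylow_thm[OF p group_axioms r(1) fin] by blast
  define T where "T = S <#> D"
  have sT: "subgroup T G" unfolding T_def by (rule set_mult_normal_subgroup[OF S(1) nD])
  have ST: "S \<subseteq> T" "D \<subseteq> T" unfolding T_def using set_mult_supersets[OF S(1) D] by auto
  have nT: "T \<lhd> G"
    using normal_of_commute_mod[OF sT] comm subgroup.subset[OF sT] ST unfolding commute_mod_def by blast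
  interpret T: normal T G by (rule nT)
  interpret Q: group "G Mod T" by (rule T.factorgroup_is_group)
  have "p ^ k dvd card T"
    using card_subgroup_dvd[OF S(1) sT ST(1)] S(2) by simp
  moreover have "order (G Mod T) * card T = order G"
    using lagrange[OF sT] by (simp add: order_def FactGroup_def)
  ultimately have np: "\<not> p dvd order (G Mod T)"
  proof -
    assume a: "p ^ k dvd card T" and b: "order (G Mod T) * card T = order G"
    obtain e where "card T = p ^ k * e" using a by (rule dvdE)
    then have "p ^ k * (order (G Mod T) * e) = p ^ k * r" using b r by (simp add: mult.assoc mult.left_commute)
    then have "order (G Mod T) * e = r" using p by simp
    then show ?thesis using r(2) dvd_mult2 by blast
  qed
  have CT: "carrier G \<subseteq> T"
  proof
    fix c assume c: "c \<in> carrier G"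
    have "c [^] p \<in> T" using pw[OF c] ST by blast
    moreover have "c [^] order (G Mod T) \<in> T"
    proof -
      have "(T #> c) [^]\<^bsub>G Mod T\<^esub> order (G Mod T) = \<one>\<^bsub>G Mod T\<^esub>"
        using Q.pow_order_eq_1 rcos_in_FactGroup[OF c] by blast
      then show ?thesis using c by (simp add: T.FactGroup_pow rcos_eq_self_iff[OF sT])
    qed
    moreover have "coprime p (order (G Mod T))" using prime_imp_coprime[OF p np] .
    ultimately show "c \<in> T" using coprime_nat_pow_mem[OF sT c] by blast
  qed
  obtain X where X: "finite X" "card X \<le> d" "X \<subseteq> carrier G" "S = generate G X"
    using gen[OF S] unfolding generated_by_def by blast
  have sg: "subgroup (generate G (X \<union> D)) G"
    using X subgroup.subset[OF D] by (intro generate_is_subgroup) auto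
  have "S \<subseteq> generate G (X \<union> D)" unfolding X(4) by (intro mono_generate) auto
  moreover have "D \<subseteq> generate G (X \<union> D)" by (auto intro: generate.incl)
  ultimately have "T \<subseteq> generate G (X \<union> D)"
    unfolding T_def set_mult_def using subgroup.m_closed[OF sg] by blast
  then have "order G \<le> card (generate G (X \<union> D))"
    unfolding order_def using CT fin subgroup.subset[OF sg] by (intro card_mono) (auto intro: finite_subset)
  also have "\<dots> \<le> p ^ card X * card D"
    by (rule card_generate_elementary[OF X(1,3) D fin p comm pw])
  also have "\<dots> \<le> p ^ d * card D"
    using X(2) prime_ge_1_nat[OF p] by (intro mult_right_mono power_increasing) auto
  finally show ?thesis .
qed

end

section \<open>Complements of a chief factor below an abelian derived subgroup\<close>

locale abelian_chief_factor = group G for G (structure) +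
  fixes N0 N
  assumes fin: "finite (carrier G)"
    and derived_comm: "\<And>a b. a \<in> derived G (carrier G) \<Longrightarrow> b \<in> derived G (carrier G) \<Longrightarrow> a \<otimes> b = b \<otimes> a"
    and N0_normal: "N0 \<lhd> G" and N_normal: "N \<lhd> G" and N0_N: "N0 \<subset> N" and N_derived: "N \<subseteq> derived G (carrier G)"
    and chief: "\<And>V. V \<lhd> G \<Longrightarrow> N0 \<subseteq> V \<Longrightarrow> V \<subseteq> N \<Longrightarrow> V = N0 \<or> V = N"
begin

abbreviation M where "M \<equiv> derived G (carrier G)"

lemma M_normal: "M \<lhd> G"
  by (rule derived_is_normal[OF normal_self])

lemma subgroups: "subgroup M G" "subgroup N G" "subgroup N0 G"
  using normal_imp_subgroup[OF M_normal] normal_imp_subgroup[OF N_normal] normal_imp_subgroup[OF N0_normal] .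

lemma mem_carrier: "g \<in> M \<Longrightarrow> g \<in> carrier G" "g \<in> N \<Longrightarrow> g \<in> carrier G" "g \<in> N0 \<Longrightarrow> g \<in> carrier G"
  using subgroup_mem_carrier subgroups by blast+

lemma N_M: "n \<in> N \<Longrightarrow> n \<in> M" "n \<in> N0 \<Longrightarrow> n \<in> N"
  using N_derived N0_N by auto

lemma conj_N:
  assumes "m \<in> M" "n \<in> M"
  shows "m \<otimes> n \<otimes> inv m = n"
  using derived_comm[OF assms] assms mem_carrier(1) by (simp add: m_assoc)

text \<open>The centraliser of the chief factor \<open>N/N0\<close>. It contains the abelian group
  \<open>M\<close>, so \<open>G/C\<close> is abelian.\<close>

definition C where "C = {g \<in> carrier G. \<forall>n\<in>N. commute_mod G N0 g n}"

lemma C_subgroup: "subgroup C G"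
proof -
  have "C = carrier G \<inter> (\<Inter>n\<in>N. {g \<in> carrier G. commute_mod G N0 n g})"
    unfolding C_def using commute_mod_sym[OF N0_normal] mem_carrier(2) by auto
  also have "\<dots> = \<Inter> (insert (carrier G) ((\<lambda>n. {g \<in> carrier G. commute_mod G N0 n g}) ` N))" by simp
  finally have e: "C = \<Inter> (insert (carrier G) ((\<lambda>n. {g \<in> carrier G. commute_mod G N0 n g}) ` N))" .
  show ?thesis unfolding e
    by (rule subgroups_Inter) (use subgroup_self subgroup_commute_mod[OF N0_normal] mem_carrier(2) in auto)
qed

lemma M_C: "M \<subseteq> C"
  unfolding C_def using N_M(1) mem_carrier derived_comm
  by (auto intro: commute_imp_commute_mod[OF N0_normal])

lemma C_normal: "C \<lhd> G"
  using normal_of_commute_mod[OF C_subgroup] commute_mod_derived M_C subgroup_mem_carrier[OF C_subgroup]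
  unfolding commute_mod_def by blast

lemma C_carrier: "c \<in> C \<Longrightarrow> c \<in> carrier G"
  unfolding C_def by simp

text \<open>The preimage in \<open>G\<close> of a complement of \<open>N/N0\<close> in
  \<open>G/N0\<close>.\<close>

definition supplement where
  "supplement K \<longleftrightarrow> subgroup K G \<and> N0 \<subseteq> K \<and> K \<inter> N = N0 \<and> (\<forall>g\<in>carrier G. \<exists>k\<in>K. \<exists>m\<in>N. g = k \<otimes> m)"

text \<open>A \<open>G\<close>-invariant complement of \<open>N/N0\<close> inside the centraliser
  \<open>C\<close>. Then \<open>C/L\<close> is isomorphic to \<open>N/N0\<close>, and
  \<open>C\<close> modulo an intersection of several such \<open>L\<close> is elementary
  abelian.\<close>

definition C_complement where
  "C_complement L \<longleftrightarrow> L \<lhd> G \<and> N0 \<subseteq> L \<and> L \<subseteq> C \<and> L \<inter> N = N0 \<and> (\<forall>c\<in>C. \<exists>l\<in>L. \<exists>m\<in>N. c = l \<otimes> m)"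

text \<open>The intersection of \<open>K\<close> with \<open>N\<close> is normalised by
  \<open>K\<close> and, \<open>N\<close> being abelian, by \<open>N\<close>, so it is normal in
  \<open>G = K N\<close>. As the factor is chief, \<open>K\<close> either contains \<open>N\<close>,
  and then is everything, or meets it in \<open>N0\<close>.\<close>

lemma supplement_generate:
  assumes X: "X \<subseteq> carrier G" and full: "generate G (X \<union> N) = carrier G" and ne: "generate G (X \<union> N0) \<noteq> carrier G"
  shows "supplement (generate G (X \<union> N0))"
proof -
  define K where "K = generate G (X \<union> N0)"
  have sK: "subgroup K G" unfolding K_def using X mem_carrier by (intro generate_is_subgroup) auto
  have XK: "X \<subseteq> K" "N0 \<subseteq> K" unfolding K_def by (auto intro: generate.incl)
  have KG: "k \<in> carrier G" if "k \<in> K" for k using that sK subgroup_mem_carrier by blast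
  have sKN: "subgroup (K <#> N) G" by (rule set_mult_normal_subgroup[OF sK N_normal])
  have "generate G (X \<union> N) \<subseteq> K <#> N"
    using set_mult_supersets[OF sK subgroups(2)] XK by (intro generate_subgroup_incl[OF _ sKN]) auto
  then have KN: "\<exists>k\<in>K. \<exists>m\<in>N. g = k \<otimes> m" if "g \<in> carrier G" for g
    using that full set_mult_memE by (metis subsetD)
  have sI: "subgroup (K \<inter> N) G" using subgroups_Inter_pair[OF sK subgroups(2)] .
  have "K \<inter> N \<lhd> G" unfolding normal_inv_iff
  proof (intro conjI ballI sI)
    fix g n assume g: "g \<in> carrier G" and n: "n \<in> K \<inter> N"
    obtain k m where km: "k \<in> K" "m \<in> N" "g = k \<otimes> m" using KN[OF g] by auto
    have G: "k \<in> carrier G" "m \<in> carrier G" "n \<in> carrier G" using km n KG mem_carrier by auto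
    have "g \<otimes> n \<otimes> inv g = k \<otimes> (m \<otimes> n \<otimes> inv m) \<otimes> inv k"
      using km(3) G by (simp add: m_assoc inv_mult_group)
    then have e: "g \<otimes> n \<otimes> inv g = k \<otimes> n \<otimes> inv k" using conj_N km(2) n N_M(1) by simp
    show "g \<otimes> n \<otimes> inv g \<in> K \<inter> N"
    proof
      show "g \<otimes> n \<otimes> inv g \<in> N" using normal_conj_closed(1)[OF N_normal g] n by simp
      show "g \<otimes> n \<otimes> inv g \<in> K"
        unfolding e using km(1) n subgroup.m_closed[OF sK] subgroup.m_inv_closed[OF sK] by simp
    qed
  qed
  moreover have "N0 \<subseteq> K \<inter> N" using XK N0_N by auto
  moreover have "K \<inter> N \<noteq> N"
  proof
    assume "K \<inter> N = N"
    then have "generate G (X \<union> N) \<subseteq> K" using XK by (intro generate_subgroup_incl[OF _ sK]) auto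
    then show False using full ne subgroup.subset[OF sK] K_def by blast
  qed
  ultimately have "K \<inter> N = N0" using chief by blast
  then show ?thesis unfolding supplement_def K_def[symmetric] using sK XK KN by blast
qed

text \<open>\<open>K \<inter> C\<close> is normalised by \<open>K\<close>, and also by
  \<open>N\<close>, which commutes with \<open>C\<close> modulo \<open>N0\<close>.\<close>

lemma C_complement_of_supplement:
  assumes "supplement K"
  shows "C_complement (K \<inter> C)"
proof -
  have sK: "subgroup K G" and N0K: "N0 \<subseteq> K" and KN: "K \<inter> N = N0"
    and ex: "\<And>g. g \<in> carrier G \<Longrightarrow> \<exists>k\<in>K. \<exists>m\<in>N. g = k \<otimes> m"
    using assms unfolding supplement_def by auto
  have KG: "k \<in> carrier G" if "k \<in> K" for k using that sK subgroup_mem_carrier by blast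
  have sL: "subgroup (K \<inter> C) G" using subgroups_Inter_pair[OF sK C_subgroup] .
  have NC: "n \<in> N \<Longrightarrow> n \<in> C" for n using N_M M_C by auto
  have "K \<inter> C \<lhd> G" unfolding normal_inv_iff
  proof (intro conjI ballI sL)
    fix g l assume g: "g \<in> carrier G" and l: "l \<in> K \<inter> C"
    obtain k m where km: "k \<in> K" "m \<in> N" "g = k \<otimes> m" using ex[OF g] by auto
    have G: "k \<in> carrier G" "m \<in> carrier G" "l \<in> carrier G" using km l KG mem_carrier by auto
    have "commute_mod G N0 m l"
      using l km(2) G commute_mod_sym[OF N0_normal] unfolding C_def by auto
    then have "m \<otimes> l \<otimes> inv m \<otimes> inv l \<in> K" unfolding commute_mod_def using N0K by auto
    then have "(m \<otimes> l \<otimes> inv m \<otimes> inv l) \<otimes> l \<in> K" using l subgroup.m_closed[OF sK] by auto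
    then have "m \<otimes> l \<otimes> inv m \<in> K" using G by (simp add: m_assoc)
    then have "k \<otimes> (m \<otimes> l \<otimes> inv m) \<otimes> inv k \<in> K"
      using km(1) subgroup.m_closed[OF sK] subgroup.m_inv_closed[OF sK] by simp
    moreover have "g \<otimes> l \<otimes> inv g = k \<otimes> (m \<otimes> l \<otimes> inv m) \<otimes> inv k"
      using km(3) G by (simp add: m_assoc inv_mult_group)
    ultimately show "g \<otimes> l \<otimes> inv g \<in> K \<inter> C"
      using l normal_conj_closed(1)[OF C_normal g, of l] by simp
  qed
  moreover have "\<exists>l\<in>K \<inter> C. \<exists>m\<in>N. c = l \<otimes> m" if c: "c \<in> C" for c
  proof -
    obtain k m where km: "k \<in> K" "m \<in> N" "c = k \<otimes> m" using ex[OF C_carrier[OF c]] by auto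
    have "k = c \<otimes> inv m" using km KG mem_carrier by (simp add: m_assoc)
    then have "k \<in> C" using c NC[OF km(2)] subgroup.m_closed[OF C_subgroup] subgroup.m_inv_closed[OF C_subgroup] by simp
    then show ?thesis using km by blast
  qed
  moreover have "N0 \<subseteq> K \<inter> C" "(K \<inter> C) \<inter> N = N0" using N0K KN NC N_M by auto
  ultimately show ?thesis unfolding C_complement_def by blast
qed

context
  fixes L assumes L: "C_complement L"
begin

lemma C_complementD:
  shows "L \<lhd> G" "subgroup L G" "N0 \<subseteq> L" "L \<subseteq> C" "L \<inter> N = N0" "c \<in> C \<Longrightarrow> \<exists>l\<in>L. \<exists>m\<in>N. c = l \<otimes> m"
  using L normal_imp_subgroup unfolding C_complement_def by auto

lemma C_complement_coset:
  assumes "c \<in> C" shows "\<exists>m\<in>N. L #> c = L #> m"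
proof -
  obtain l m where lm: "l \<in> L" "m \<in> N" "c = l \<otimes> m" using C_complementD(6)[OF assms] by auto
  have "c \<otimes> inv m = l"
    using lm subgroup_mem_carrier[OF C_complementD(2)] mem_carrier by (simp add: m_assoc)
  then have "L #> c = L #> m"
    using rcos_eq_iff[OF C_complementD(2) C_carrier[OF assms] mem_carrier(2)[OF lm(2)]] lm by simp
  then show ?thesis using lm by blast
qed

lemma C_complement_commute:
  assumes "c \<in> C" "d \<in> C" shows "commute_mod G L c d"
proof -
  interpret L: normal L G by (rule C_complementD(1))
  obtain m n where mn: "m \<in> N" "n \<in> N" "L #> c = L #> m" "L #> d = L #> n"
    using C_complement_coset[OF assms(1)] C_complement_coset[OF assms(2)] by auto
  have mnG: "m \<in> carrier G" "n \<in> carrier G" using mn mem_carrier by auto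
  have "commute_mod G L m n"
    using commute_imp_commute_mod[OF C_complementD(1) mnG] derived_comm mn N_M by blast
  then show ?thesis
    using commute_mod_iff_rcos[OF C_complementD(1) mnG]
      commute_mod_iff_rcos[OF C_complementD(1) C_carrier[OF assms(1)] C_carrier[OF assms(2)]] mn(3,4) by simp
qed

lemma C_complement_pow:
  fixes p :: nat
  assumes "\<And>n. n \<in> N \<Longrightarrow> n [^] p \<in> N0" "c \<in> C" shows "c [^] p \<in> L"
proof -
  interpret L: normal L G by (rule C_complementD(1))
  obtain m where m: "m \<in> N" "L #> c = L #> m" using C_complement_coset[OF assms(2)] by auto
  have G: "m \<in> carrier G" "c \<in> carrier G" using m mem_carrier C_carrier assms by auto
  have "L #> c [^] p = L #> m [^] p" using L.FactGroup_pow[OF G(1), of p] L.FactGroup_pow[OF G(2), of p] m by simp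
  moreover have "m [^] p \<in> L" using assms(1)[OF m(1)] C_complementD(3) by auto
  ultimately show ?thesis
    using rcos_eq_self_iff[OF C_complementD(2)] G by (metis nat_pow_closed)
qed

lemma C_complement_card: "card C * card N0 = card L * card N"
proof -
  have "L <#> N = C"
  proof
    show "L <#> N \<subseteq> C"
    proof
      fix g assume "g \<in> L <#> N"
      then obtain l n where "l \<in> L" "n \<in> N" "g = l \<otimes> n" by (rule set_mult_memE)
      then show "g \<in> C" using C_complementD(4) N_M(1) M_C subgroup.m_closed[OF C_subgroup] by blast
    qed
    show "C \<subseteq> L <#> N" using C_complementD(6) set_mult_memI by blast
  qed
  then show ?thesis using card_set_mult[OF C_complementD(2) subgroups(2)] C_complementD(5) by simp
qed

text \<open>\<open>C/L\<close> is isomorphic to the irreducible \<open>N/N0\<close> compatibly with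
  conjugation by \<open>G\<close>; whether \<open>T \<inter> N\<close> is \<open>N0\<close> or
  \<open>N\<close> decides between the two cases.\<close>

lemma C_complement_irreducible:
  assumes T: "T \<lhd> G" and LT: "L \<subseteq> T" and TC: "T \<subseteq> C"
  shows "T = L \<or> T = C"
proof -
  have sT: "subgroup T G" using T by (rule normal_imp_subgroup)
  have "T \<inter> N \<lhd> G" using normal_subgroup_intersect[OF T N_normal] .
  then have "T \<inter> N = N0 \<or> T \<inter> N = N" using chief C_complementD(3) LT N0_N by auto
  then show ?thesis
  proof
    assume TN: "T \<inter> N = N0"
    have "t \<in> L" if t: "t \<in> T" for t
    proof -
      obtain l m where lm: "l \<in> L" "m \<in> N" "t = l \<otimes> m" using C_complementD(6) t TC by blast
      have "m = inv l \<otimes> t" using lm subgroup_mem_carrier[OF C_complementD(2)] mem_carrier by simp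
      then have "m \<in> T" using lm(1) t LT subgroup.m_closed[OF sT] subgroup.m_inv_closed[OF sT] by auto
      then show ?thesis using lm TN C_complementD(3) subgroup.m_closed[OF C_complementD(2)] by blast
    qed
    then show ?thesis using LT by blast
  next
    assume "T \<inter> N = N"
    then have "C \<subseteq> T" using C_complementD(6) LT subgroup.m_closed[OF sT] by blast
    then show ?thesis using TC by blast
  qed
qed

text \<open>By irreducibility \<open>T <#> L = C\<close>, since \<open>T\<close> is not inside
  \<open>L\<close>. Applied repeatedly, this gives the index of the intersection of complements in
  general position.\<close>

lemma C_complement_card_Int:
  assumes T: "T \<lhd> G" and TC: "T \<subseteq> C" and "\<not> T \<subseteq> L"
  shows "card C * card (T \<inter> L) = card T * card L"
proof -
  have sT: "subgroup T G" using T by (rule normal_imp_subgroup)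
  have nTL: "T <#> L \<lhd> G"
  proof -
    have "subgroup (T <#> L) G" by (rule set_mult_normal_subgroup[OF sT C_complementD(1)])
    moreover have "g \<otimes> h \<otimes> inv g \<in> T <#> L" if g: "g \<in> carrier G" and h: "h \<in> T <#> L" for g h
    proof -
      obtain t l where tl: "t \<in> T" "l \<in> L" "h = t \<otimes> l" using h by (rule set_mult_memE)
      have "g \<otimes> h \<otimes> inv g = (g \<otimes> t \<otimes> inv g) \<otimes> (g \<otimes> l \<otimes> inv g)"
        using g tl subgroup_mem_carrier[OF sT] subgroup_mem_carrier[OF C_complementD(2)] by (simp add: m_assoc)
      then show ?thesis
        using normal_conj_closed(1)[OF T g tl(1)] normal_conj_closed(1)[OF C_complementD(1) g tl(2)]
        by (simp add: set_mult_memI)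
    qed
    ultimately show ?thesis unfolding normal_inv_iff by blast
  qed
  have "T <#> L \<subseteq> C"
    unfolding set_mult_def using TC C_complementD(4) subgroup.m_closed[OF C_subgroup] by auto
  moreover have "T <#> L \<noteq> L" using set_mult_supersets(1)[OF sT C_complementD(2)] assms(3) by auto
  ultimately have "T <#> L = C"
    using C_complement_irreducible[OF nTL set_mult_supersets(2)[OF sT C_complementD(2)]] by blast
  then show ?thesis using card_set_mult[OF sT C_complementD(2)] by simp
qed

end

text \<open>A supplement \<open>A\<close> containing \<open>x\<close> can be recovered from
  \<open>A \<inter> C\<close> as the centraliser of \<open>x\<close> modulo
  \<open>A \<inter> C\<close>. As \<open>x\<close> is not in \<open>C\<close>, it fixes only the
  trivial element of \<open>N/N0\<close>, which keeps elements outside \<open>A\<close> from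
  qualifying.\<close>

lemma supplement_eqI:
  assumes K: "supplement K" and K': "supplement K'" and x: "x \<in> K" "x \<in> K'" "x \<notin> C" and eq: "K \<inter> C = K' \<inter> C"
  shows "K = K'"
proof -
  have xG: "x \<in> carrier G" using K x(1) subgroup_mem_carrier unfolding supplement_def by blast
  have char: "A = {g \<in> carrier G. commute_mod G (A \<inter> C) g x}" if A: "supplement A" and xA: "x \<in> A" for A
  proof (intro equalityI subsetI)
    have sA: "subgroup A G" and N0A: "N0 \<subseteq> A" and AN: "A \<inter> N = N0"
      and ex: "\<And>g. g \<in> carrier G \<Longrightarrow> \<exists>k\<in>A. \<exists>m\<in>N. g = k \<otimes> m"
      using A unfolding supplement_def by auto
    note AG = subgroup_mem_carrier[OF sA]
    have nL: "A \<inter> C \<lhd> G" and sL: "subgroup (A \<inter> C) G"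
      using C_complementD(1,2)[OF C_complement_of_supplement[OF A]] .
    fix g
    {
      assume g: "g \<in> A"
      have "g \<otimes> x \<otimes> inv g \<otimes> inv x \<in> A"
        using g xA subgroup.m_closed[OF sA] subgroup.m_inv_closed[OF sA] by simp
      moreover have "g \<otimes> x \<otimes> inv g \<otimes> inv x \<in> C"
        using commute_mod_derived[OF AG[OF g] xG] M_C unfolding commute_mod_def by auto
      ultimately show "g \<in> {g \<in> carrier G. commute_mod G (A \<inter> C) g x}"
        unfolding commute_mod_def using AG[OF g] by simp
    }
    assume "g \<in> {g \<in> carrier G. commute_mod G (A \<inter> C) g x}"
    then have g: "g \<in> carrier G" and gx: "g \<otimes> x \<otimes> inv g \<otimes> inv x \<in> A \<inter> C" unfolding commute_mod_def by auto
    obtain k m where km: "k \<in> A" "m \<in> N" "g = k \<otimes> m" using ex[OF g] by auto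
    have G: "k \<in> carrier G" "m \<in> carrier G" using km AG mem_carrier by auto
    have kx: "k \<otimes> x \<otimes> inv k \<otimes> inv x \<in> A \<inter> C"
      using km(1) xA subgroup.m_closed[OF sA] subgroup.m_inv_closed[OF sA]
        commute_mod_derived[OF G(1) xG] M_C unfolding commute_mod_def by auto
    define t where "t = m \<otimes> x \<otimes> inv m \<otimes> inv x"
    have "inv k \<otimes> ((g \<otimes> x \<otimes> inv g \<otimes> inv x) \<otimes> inv (k \<otimes> x \<otimes> inv k \<otimes> inv x)) \<otimes> k = t"
      unfolding t_def km(3) using G xG by (simp add: m_assoc inv_mult_group)
    moreover have "inv k \<otimes> ((g \<otimes> x \<otimes> inv g \<otimes> inv x) \<otimes> inv (k \<otimes> x \<otimes> inv k \<otimes> inv x)) \<otimes> k \<in> A \<inter> C"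
      using normal_conj_closed(2)[OF nL G(1)] subgroup.m_closed[OF sL gx] subgroup.m_inv_closed[OF sL kx] by blast
    ultimately have "t \<in> A \<inter> C" by simp
    moreover have "t = m \<otimes> (x \<otimes> inv m \<otimes> inv x)" unfolding t_def using G xG by (simp add: m_assoc)
    then have "t \<in> N"
      using normal_conj_closed(1)[OF N_normal xG] km(2) subgroup.m_inv_closed[OF subgroups(2)] subgroup.m_closed[OF subgroups(2)] by simp
    ultimately have t0: "t \<in> N0" using AN by blast
    \<comment> \<open>The fixed points of \<open>x\<close> on \<open>N/N0\<close>. They are
      invariant under \<open>G\<close> because \<open>[a, x]\<close> lies in the abelian group
      \<open>M\<close> and acts trivially on \<open>N\<close>.\<close>
    define T where "T = N \<inter> {m \<in> carrier G. commute_mod G N0 x m}"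
    have sT: "subgroup T G" unfolding T_def
      using subgroups_Inter_pair[OF subgroups(2) subgroup_commute_mod[OF N0_normal xG]] .
    have "T \<lhd> G" unfolding normal_inv_iff
    proof (intro conjI ballI sT)
      fix a n assume a: "a \<in> carrier G" and n: "n \<in> T"
      have nN: "n \<in> N" and nx: "x \<otimes> n \<otimes> inv x \<otimes> inv n \<in> N0" using n unfolding T_def commute_mod_def by auto
      define n' where "n' = a \<otimes> n \<otimes> inv a"
      have n'N: "n' \<in> N" unfolding n'_def by (rule normal_conj_closed(1)[OF N_normal a nN])
      define c where "c = a \<otimes> x \<otimes> inv a \<otimes> inv x"
      have cM: "c \<in> M" unfolding c_def using commute_mod_derived[OF a xG] unfolding commute_mod_def .
      have G': "n \<in> carrier G" "n' \<in> carrier G" "c \<in> carrier G" using nN n'N cM mem_carrier by auto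
      have "a \<otimes> (x \<otimes> n \<otimes> inv x \<otimes> inv n) \<otimes> inv a = (c \<otimes> (x \<otimes> n' \<otimes> inv x) \<otimes> inv c) \<otimes> inv n'"
        unfolding c_def n'_def using a xG G'(1) by (simp add: m_assoc inv_mult_group)
      moreover have "c \<otimes> (x \<otimes> n' \<otimes> inv x) \<otimes> inv c = x \<otimes> n' \<otimes> inv x"
        using conj_N[OF cM] normal_conj_closed(1)[OF N_normal xG n'N] N_M by blast
      ultimately have "x \<otimes> n' \<otimes> inv x \<otimes> inv n' = a \<otimes> (x \<otimes> n \<otimes> inv x \<otimes> inv n) \<otimes> inv a" by simp
      then have "commute_mod G N0 x n'"
        unfolding commute_mod_def using normal_conj_closed(1)[OF N0_normal a nx] by simp
      then show "a \<otimes> n \<otimes> inv a \<in> T" unfolding T_def n'_def[symmetric] using n'N G' by simp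
    qed
    moreover have "N0 \<subseteq> T" unfolding T_def using commute_mod_normal[OF N0_normal xG] N_M mem_carrier by auto
    moreover have "T \<subseteq> N" unfolding T_def by auto
    moreover have "T \<noteq> N"
    proof
      assume "T = N"
      then have "x \<in> C" unfolding C_def using xG unfolding T_def by auto
      then show False using x(3) by blast
    qed
    ultimately have "T = N0" using chief by blast
    moreover have "m \<in> T" unfolding T_def
      using km(2) G commute_mod_sym[OF N0_normal G(2) xG] t0 unfolding t_def commute_mod_def by auto
    ultimately have "m \<in> A" using N0A by blast
    then show "g \<in> A" using km subgroup.m_closed[OF sA] by simp
  qed
  show ?thesis using char[OF K x(1)] char[OF K' x(2)] eq by simp
qed

end

context group
begin

lemma generated_by_subgroup:
  assumes K: "subgroup K G" and "H \<subseteq> K" "generated_by G d H"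
  shows "generated_by (G\<lparr>carrier := K\<rparr>) d H"
proof -
  obtain S where S: "finite S" "card S \<le> d" "S \<subseteq> carrier G" "H = generate G S"
    using assms(3) unfolding generated_by_def by blast
  have "S \<subseteq> K" using S(4) \<open>H \<subseteq> K\<close> by (auto intro: generate.incl)
  then show ?thesis
    unfolding generated_by_def using S generate_consistent[OF _ K] by (intro exI[of _ S]) auto
qed

lemma generated_by_enum:
  assumes "generated_by G d H"
  shows "\<exists>s::nat \<Rightarrow> 'a. s ` {..<d} \<subseteq> carrier G \<and> H = generate G (s ` {..<d})"
proof -
  obtain S where S: "finite S" "card S \<le> d" "S \<subseteq> carrier G" "H = generate G S"
    using assms unfolding generated_by_def by blast
  obtain h where h: "bij_betw h {0..<card S} S" using ex_bij_betw_nat_finite[OF S(1)] by blast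
  define s where "s = (\<lambda>i. if i < card S then h i else \<one>)"
  have hS: "h ` {0..<card S} = S" using h by (simp add: bij_betw_def)
  have 1: "S \<subseteq> s ` {..<d}"
  proof
    fix x assume "x \<in> S"
    then obtain i where "i < card S" "x = h i" using hS by force
    then show "x \<in> s ` {..<d}" unfolding s_def using S(2) by (intro image_eqI[of _ _ i]) auto
  qed
  have 2: "s ` {..<d} \<subseteq> insert \<one> S"
  proof
    fix x assume "x \<in> s ` {..<d}"
    then obtain i where i: "x = s i" by blast
    show "x \<in> insert \<one> S" unfolding i s_def using hS by force
  qed
  have "generate G (s ` {..<d}) \<subseteq> generate G S"
  proof (rule generate_subgroup_incl[OF _ generate_is_subgroup[OF S(3)]])
    have "insert \<one> S \<subseteq> generate G S" by (auto intro: generate.incl generate.one)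
    then show "s ` {..<d} \<subseteq> generate G S" using 2 by blast
  qed
  then have "generate G (s ` {..<d}) = generate G S" using mono_generate[OF 1] by blast
  then show ?thesis using 2 S by (intro exI[of _ s]) auto
qed

text \<open>The \<open>i\<close>-th generators of Sylow subgroups for the different primes are
  multiplied together. Modulo \<open>D\<close> their orders are coprime, so each factor can be
  recovered from the product, and the result covers every Sylow subgroup.\<close>

lemma generators_mod_abelian:
  assumes fin: "finite (carrier G)" and D: "D \<lhd> G"
    and comm: "\<And>g h. g \<in> carrier G \<Longrightarrow> h \<in> carrier G \<Longrightarrow> commute_mod G D g h"
    and gen: "\<And>p n S. prime (p::nat) \<Longrightarrow> subgroup S G \<Longrightarrow> card S = p ^ n \<Longrightarrow> generated_by G d S"
  shows "\<exists>g::nat \<Rightarrow> 'a. g ` {..<d} \<subseteq> carrier G \<and> generate G (g ` {..<d} \<union> D) = carrier G"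
proof -
  define a where "a = (\<lambda>p. multiplicity p (order G))"
  have o0: "order G \<noteq> 0" using fin order_gt_0_iff_finite by simp
  have sD: "subgroup D G" using D by (rule normal_imp_subgroup)
  have DG: "D \<subseteq> carrier G" using sD by (rule subgroup.subset)
  have "\<exists>S s. subgroup S G \<and> card S = p ^ a p \<and> s ` {..<d} \<subseteq> carrier G \<and> S = generate G (s ` {..<d::nat})"
    if p: "prime p" for p
  proof -
    obtain r where r: "order G = p ^ a p * r"
      unfolding a_def using multiplicity_dvd by blast
    obtain S where S: "subgroup S G" "card S = p ^ a p" using sylow_thm[OF p group_axioms r fin] by blast
    then show ?thesis using generated_by_enum[OF gen[OF p S]] by metis
  qed
  then obtain S s where Ss: "\<And>p. prime p \<Longrightarrow> subgroup (S p) G" "\<And>p. prime p \<Longrightarrow> card (S p) = p ^ a p"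
    "\<And>p. prime p \<Longrightarrow> s p ` {..<d} \<subseteq> carrier G" "\<And>p. prime p \<Longrightarrow> S p = generate G (s p ` {..<d})"
    by metis
  \<comment> \<open>The invariant keeps the power of \<open>g i\<close> by the order parts treated
    so far in \<open>D\<close>. This exponent is coprime to the next prime, which separates
    \<open>g i\<close> from the new factor.\<close>
  have ind: "\<exists>g. (\<forall>i<d. g i \<in> carrier G \<and> g i [^] (\<Prod>p\<in>P. p ^ a p) \<in> D) \<and>
      (\<forall>p\<in>P. S p \<subseteq> generate G (g ` {..<d} \<union> D))" if "finite P" "\<forall>p\<in>P. prime p" for P
    using that
  proof (induction P rule: finite_induct)
    case empty
    then show ?case using sD by (intro exI[of _ "\<lambda>_. \<one>"]) (simp add: subgroup.one_closed)
  next
    case (insert q P)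
    have q: "prime q" using insert by simp
    define e where "e = (\<Prod>p\<in>P. p ^ a p)"
    have "\<exists>g. (\<forall>i<d. g i \<in> carrier G \<and> g i [^] e \<in> D) \<and> (\<forall>p\<in>P. S p \<subseteq> generate G (g ` {..<d} \<union> D))"
      using insert.IH insert.prems unfolding e_def by simp
    then obtain g where g': "\<forall>i<d. g i \<in> carrier G \<and> g i [^] e \<in> D" "\<forall>p\<in>P. S p \<subseteq> generate G (g ` {..<d} \<union> D)"
      by blast
    then have g: "\<And>i. i < d \<Longrightarrow> g i \<in> carrier G" "\<And>i. i < d \<Longrightarrow> g i [^] e \<in> D"
      "\<And>p. p \<in> P \<Longrightarrow> S p \<subseteq> generate G (g ` {..<d} \<union> D)" by blast+
    have s: "s q i \<in> carrier G" if "i < d" for i using Ss(3)[OF q] that by auto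
    have sq: "s q i [^] (q ^ a q) = \<one>" if "i < d" for i
    proof -
      have m: "s q i \<in> S q" using Ss(4)[OF q] that by (auto intro: generate.incl)
      interpret Sq: group "G\<lparr>carrier := S q\<rparr>" using Ss(1)[OF q] by (rule subgroup_imp_group)
      have "s q i [^]\<^bsub>G\<lparr>carrier := S q\<rparr>\<^esub> order (G\<lparr>carrier := S q\<rparr>) = \<one>\<^bsub>G\<lparr>carrier := S q\<rparr>\<^esub>"
        by (rule Sq.pow_order_eq_1) (use m in simp)
      then show ?thesis using Ss(2)[OF q] by (simp add: order_def flip: nat_pow_consistent)
    qed
    have cop: "coprime e (q ^ a q)"
      unfolding e_def
    proof (rule prod_coprime_left)
      fix p assume "p \<in> P"
      then have "p \<noteq> q" "prime p" using insert by auto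
      then show "coprime (p ^ a p) (q ^ a q)" using q by (simp add: primes_coprime)
    qed
    define g' where "g' = (\<lambda>i. g i \<otimes> s q i)"
    define T where "T = generate G (g' ` {..<d} \<union> D)"
    have g'G: "g' i \<in> carrier G" if "i < d" for i using g s that unfolding g'_def by simp
    have sT: "subgroup T G" unfolding T_def using g'G DG by (intro generate_is_subgroup) auto
    have g'T: "g' i \<in> T" if "i < d" for i unfolding T_def using that by (auto intro!: generate.incl)
    have DT: "D \<subseteq> T" unfolding T_def by (auto intro: generate.incl)
    have pw: "g' i [^] n \<otimes> inv (g i [^] n \<otimes> s q i [^] n) \<in> D" if "i < d" for i and n :: nat
      using nat_pow_mult_mod[OF D g(1)[OF that] s[OF that] comm[OF g(1)[OF that] s[OF that]], of n]
        rcos_eq_iff[OF sD, of "g' i [^] n" "g i [^] n \<otimes> s q i [^] n"] g(1)[OF that] s[OF that]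
      unfolding g'_def by simp
    have sT': "s q i \<in> T" if i: "i < d" for i
    proof (rule coprime_nat_pow_mem[OF sT s[OF i] cop])
      have "inv (g i [^] e) \<otimes> (inv (g' i [^] e \<otimes> inv (g i [^] e \<otimes> s q i [^] e)) \<otimes> g' i [^] e) = s q i [^] e"
        using g(1)[OF i] s[OF i] g'G[OF i] by (simp add: m_assoc inv_mult_group)
      moreover have "inv (g i [^] e) \<otimes> (inv (g' i [^] e \<otimes> inv (g i [^] e \<otimes> s q i [^] e)) \<otimes> g' i [^] e) \<in> T"
        using subgroup.m_closed[OF sT] subgroup.m_inv_closed[OF sT] subsetD[OF DT pw[OF i]] subsetD[OF DT g(2)[OF i]]
          subgroup_nat_pow_closed[OF sT g'T[OF i]] by simp
      ultimately show "s q i [^] e \<in> T" by simp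
      show "s q i [^] (q ^ a q) \<in> T" using sq[OF i] subgroup.one_closed[OF sT] by simp
    qed
    have "S q \<subseteq> T" unfolding Ss(4)[OF q] by (rule generate_subgroup_incl[OF _ sT]) (use sT' in auto)
    moreover have "g i \<in> T" if i: "i < d" for i
    proof -
      have "g i = g' i \<otimes> inv (s q i)" unfolding g'_def using g(1)[OF i] s[OF i] by (simp add: m_assoc)
      then show ?thesis using g'T[OF i] sT'[OF i] subgroup.m_closed[OF sT] subgroup.m_inv_closed[OF sT] by simp
    qed
    then have "generate G (g ` {..<d} \<union> D) \<subseteq> T" using DT by (intro generate_subgroup_incl[OF _ sT]) auto
    moreover have "g' i [^] (\<Prod>p\<in>insert q P. p ^ a p) \<in> D" if i: "i < d" for i
    proof -
      have ee: "(\<Prod>p\<in>insert q P. p ^ a p) = e * q ^ a q" unfolding e_def using insert by simp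
      have "s q i [^] (e * q ^ a q) = \<one>" using s[OF i] sq[OF i] by (simp add: mult.commute[of e] flip: nat_pow_pow)
      moreover have "g i [^] (e * q ^ a q) = (g i [^] e) [^] (q ^ a q)" using g(1)[OF i] by (simp add: nat_pow_pow)
      then have "g i [^] (e * q ^ a q) \<in> D" using subgroup_nat_pow_closed[OF sD g(2)[OF i]] by simp
      moreover have "g' i [^] (e * q ^ a q) = (g' i [^] (e * q ^ a q) \<otimes>
          inv (g i [^] (e * q ^ a q) \<otimes> s q i [^] (e * q ^ a q))) \<otimes> (g i [^] (e * q ^ a q) \<otimes> s q i [^] (e * q ^ a q))"
        using g(1)[OF i] s[OF i] g'G[OF i] by (simp add: m_assoc)
      ultimately show ?thesis
        unfolding ee using pw[OF i, of "e * q ^ a q"] subgroup.m_closed[OF sD] g(1)[OF i] by (metis nat_pow_closed r_one)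
    qed
    ultimately show ?case using g'G g(3) unfolding T_def by (intro exI[of _ g']) blast
  qed
  have "\<exists>g. (\<forall>i<d. g i \<in> carrier G \<and> g i [^] (\<Prod>p\<in>prime_factors (order G). p ^ a p) \<in> D) \<and>
      (\<forall>p\<in>prime_factors (order G). S p \<subseteq> generate G (g ` {..<d} \<union> D))"
    by (rule ind) (auto intro: in_prime_factors_imp_prime)
  then obtain g where
    g: "\<And>i. i < d \<Longrightarrow> g i \<in> carrier G" "\<And>p. p \<in> prime_factors (order G) \<Longrightarrow> S p \<subseteq> generate G (g ` {..<d} \<union> D)"
    by blast
  define T where "T = generate G (g ` {..<d} \<union> D)"
  have sT: "subgroup T G" unfolding T_def using g DG by (intro generate_is_subgroup) auto
  have TG: "T \<subseteq> carrier G" using sT by (rule subgroup.subset)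
  have "finite T" by (rule finite_subset[OF TG fin])
  then have cT: "card T \<noteq> 0" using subgroup.one_closed[OF sT] by auto
  have "order G dvd card T"
  proof (rule multiplicity_le_imp_dvd[OF o0])
    fix p :: nat assume p: "prime p"
    show "multiplicity p (order G) \<le> multiplicity p (card T)"
    proof (cases "p \<in> prime_factors (order G)")
      case True
      have "p ^ a p dvd card T"
        using card_subgroup_dvd[OF Ss(1)[OF p] sT] g(2)[OF True] Ss(2)[OF p] T_def by simp
      then show ?thesis unfolding a_def using p cT multiplicity_geI by (metis not_prime_unit)
    next
      case False
      then have "\<not> p dvd order G" using p o0 by (simp add: prime_factors_dvd)
      then show ?thesis by (simp add: not_dvd_imp_multiplicity_0)
    qed
  qed
  then have "order G \<le> card T" using cT by (simp add: dvd_imp_le)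
  then have "T = carrier G" using TG fin unfolding order_def by (simp add: card_seteq)
  then show ?thesis using g unfolding T_def by (intro exI[of _ g]) auto
qed

end

section \<open>Counting complements of the chief factor\<close>

context abelian_chief_factor
begin

definition q where "q = card ((\<lambda>m. N0 #> m) ` N)"

lemma finite_N: "finite N"
  by (rule finite_subset[OF _ fin]) (use mem_carrier(2) in blast)

lemma card_N: "card N = q * card N0"
proof -
  have "card (rcosets\<^bsub>G\<lparr>carrier := N\<rparr>\<^esub> N0) * card N0 = order (G\<lparr>carrier := N\<rparr>)"
    using N0_N by (intro group.lagrange subgroup_imp_group subgroup_incl subgroups) auto
  moreover have "rcosets\<^bsub>G\<lparr>carrier := N\<rparr>\<^esub> N0 = (\<lambda>m. N0 #> m) ` N" unfolding RCOSETS_def by auto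
  ultimately show ?thesis unfolding q_def order_def by simp
qed

lemma card_N0_pos: "card N0 > 0"
  using finite_N N0_N subgroup.one_closed[OF subgroups(3)] finite_subset by (metis card_gt_0_iff empty_iff psubsetE)

lemma q_gt_1: "q > 1"
proof -
  have "card N0 < card N" using N0_N finite_N by (rule psubset_card_mono[rotated])
  then show ?thesis using card_N card_N0_pos by (metis One_nat_def less_one linorder_neqE_nat mult_0 mult_1 not_less_iff_gr_or_eq)
qed

text \<open>The elements of \<open>N\<close> with \<open>p\<close>-th power in \<open>N0\<close>
  form a normal subgroup, so they are all of \<open>N\<close> once some \<open>m\<close> outside
  \<open>N0\<close> is among them. The \<open>p\<close> cosets of \<open>N0\<close> by powers of
  \<open>m\<close> give \<open>p \<le> q\<close>.\<close>

lemma prime_exponent: "\<exists>p. prime p \<and> p \<le> q \<and> (\<forall>n\<in>N. n [^] p \<in> N0)"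
proof -
  obtain n where n: "n \<in> N" "n \<notin> N0" using N0_N by blast
  have nG: "n \<in> carrier G" using n mem_carrier by blast
  have "n [^] ord n \<in> N0" using nG subgroup.one_closed[OF subgroups(3)] by simp
  moreover have "ord n > 0" using ord_ge_1[OF fin nG] by simp
  ultimately have ex: "\<exists>k>0. n [^] (k::nat) \<in> N0" by blast
  define k where "k = (LEAST k::nat. k > 0 \<and> n [^] k \<in> N0)"
  have k: "k > 0" "n [^] k \<in> N0" using LeastI_ex[OF ex] unfolding k_def by auto
  have "k \<noteq> 1" using k n nG by auto
  then obtain p where p: "prime p" "p dvd k" using prime_factor_nat by blast
  then obtain r where r: "k = p * r" by (rule_tac dvdE)
  have r0: "r > 0" "r < k" using k r p prime_gt_1_nat by auto
  define m where "m = n [^] r"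
  have m: "m \<in> N" "m \<in> carrier G" unfolding m_def using n nG subgroup_nat_pow_closed[OF subgroups(2)] by auto
  have mN0: "m \<notin> N0"
    using not_less_Least[of r "\<lambda>k. k > 0 \<and> n [^] k \<in> N0"] r0 unfolding m_def k_def[symmetric] by blast
  have mp: "m [^] p \<in> N0" unfolding m_def using k(2) r nG by (simp add: nat_pow_pow mult.commute)
  define T where "T = {n \<in> N. n [^] p \<in> N0}"
  have cN: "u \<otimes> v = v \<otimes> u" if "u \<in> N" "v \<in> N" for u v using derived_comm that N_M by blast
  have sT: "subgroup T G"
  proof (rule subgroupI)
    show "T \<subseteq> carrier G" unfolding T_def using mem_carrier by auto
    show "T \<noteq> {}" unfolding T_def using m mp by blast
    fix u assume u: "u \<in> T"
    then show "inv u \<in> T" unfolding T_def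
      using mem_carrier(2) subgroup.m_inv_closed[OF subgroups(2)] subgroup.m_inv_closed[OF subgroups(3)]
      by (simp add: nat_pow_inv)
    fix v assume v: "v \<in> T"
    then show "u \<otimes> v \<in> T"
      using u pow_mult_distrib[OF cN[of u v]] mem_carrier(2) subgroup.m_closed[OF subgroups(2)] subgroup.m_closed[OF subgroups(3)]
      unfolding T_def by simp
  qed
  have "T \<lhd> G" unfolding normal_inv_iff
  proof (intro conjI ballI sT)
    fix g u assume g: "g \<in> carrier G" and u: "u \<in> T"
    then have "(g \<otimes> u \<otimes> inv g) [^] p = g \<otimes> u [^] p \<otimes> inv g"
      using conj_nat_pow mem_carrier(2) unfolding T_def by simp
    then show "g \<otimes> u \<otimes> inv g \<in> T"
      using u normal_conj_closed(1)[OF N_normal g] normal_conj_closed(1)[OF N0_normal g] unfolding T_def by simp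
  qed
  moreover have "N0 \<subseteq> T" unfolding T_def using N_M(2) subgroup_nat_pow_closed[OF subgroups(3)] by auto
  moreover have "T \<subseteq> N" "T \<noteq> N0" unfolding T_def using m mp mN0 by auto
  ultimately have "T = N" using chief by blast
  then have pw: "\<forall>n\<in>N. n [^] p \<in> N0" unfolding T_def by blast
  have "card ((\<lambda>(i, n). n \<otimes> m [^] i) ` ({..<p} \<times> N0)) = p * card N0"
    by (rule card_cosets_of_prime_pow[OF subgroups(3) m(2) mN0 mp p(1)])
  moreover have "(\<lambda>(i, n). n \<otimes> m [^] i) ` ({..<p} \<times> N0) \<subseteq> N"
    using m(1) N_M(2) subgroup.m_closed[OF subgroups(2)] subgroup_nat_pow_closed[OF subgroups(2)] by auto
  ultimately have "p * card N0 \<le> q * card N0" using card_mono[OF finite_N] card_N by metis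
  then have "p \<le> q" using card_N0_pos by simp
  then show ?thesis using p pw by blast
qed

text \<open>\<open>N/N0\<close> then has a single nontrivial element, which every conjugation
  fixes.\<close>

lemma C_eq_carrier_of_q_eq_2:
  assumes "q = 2" shows "C = carrier G"
proof -
  have "commute_mod G N0 x m" if x: "x \<in> carrier G" and m: "m \<in> N" for x m
  proof (cases "m \<in> N0")
    case True then show ?thesis using commute_mod_normal[OF N0_normal x] by blast
  next
    case False
    define m' where "m' = x \<otimes> m \<otimes> inv x"
    have m': "m' \<in> N" unfolding m'_def by (rule normal_conj_closed(1)[OF N_normal x m])
    have mG: "m \<in> carrier G" using m mem_carrier by blast
    have "m = inv x \<otimes> m' \<otimes> x" unfolding m'_def using x mG by (simp add: m_assoc)
    then have "m' \<notin> N0" using normal_conj_closed(2)[OF N0_normal x, of m'] False by auto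
    let ?X = "(\<lambda>m. N0 #> m) ` N"
    have X: "N0 #> \<one> \<in> ?X" "N0 #> m \<in> ?X" "N0 #> m' \<in> ?X"
      using m m' subgroup.one_closed[OF subgroups(2)] by auto
    obtain A B where AB: "?X = {A, B}" using \<open>q = 2\<close> unfolding q_def by (meson card_2_iff)
    have one: "N0 #> \<one> = N0" using subgroup.subset[OF subgroups(3)] by simp
    have "N0 #> m \<noteq> N0" "N0 #> m' \<noteq> N0"
      using False \<open>m' \<notin> N0\<close> rcos_eq_self_iff[OF subgroups(3)] m m' mem_carrier(2) by blast+
    then have "N0 #> m' = N0 #> m" using X AB one by auto
    then have "m' \<otimes> inv m \<in> N0" using rcos_eq_iff[OF subgroups(3)] m m' mem_carrier(2) by blast
    then show ?thesis unfolding commute_mod_def m'_def .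
  qed
  then show ?thesis unfolding C_def using mem_carrier(2) by auto
qed

text \<open>If \<open>G\<close> centralises the factor, a complement \<open>L\<close> has abelian
  quotient \<open>G/L\<close>, so it contains the derived subgroup and with it
  \<open>N\<close>.\<close>

lemma C_complement_ne_all:
  assumes "C = carrier G" shows "\<not> C_complement L"
proof
  assume L: "C_complement L"
  have "derived G (carrier G) \<subseteq> L"
    using C_complement_commute[OF L] assms by (intro derived_subset C_complementD(2)[OF L]) auto
  then have "N \<subseteq> L" using N_derived by blast
  then show False using C_complementD(5)[OF L] N0_N by blast
qed

lemma C_complement_card': "C_complement L \<Longrightarrow> card C = q * card L"
  using C_complement_card[of L] card_N card_N0_pos by (simp add: mult.assoc mult.left_commute mult.commute)

text \<open>Every lift of \<open>y\<close> and \<open>z\<close> by elements of \<open>N\<close>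
  gives a supplement, and \<open>x\<close> is kept fixed so that \<open>supplement_eqI\<close>
  yields \<open>q ^ 2\<close> distinct complements \<open>L a b\<close> in \<open>C\<close>. At most
  \<open>q\<close> complements can contain \<open>L1 \<inter> L2\<close>, so some third one does
  not.\<close>

lemma three_complements:
  assumes x: "x \<in> carrier G" "x \<notin> C" and y: "y \<in> carrier G" and z: "z \<in> carrier G"
    and full: "generate G ({x, y, z} \<union> N) = carrier G"
    and ne: "\<And>a b. a \<in> N \<Longrightarrow> b \<in> N \<Longrightarrow> generate G ({x, y \<otimes> a, z \<otimes> b} \<union> N0) \<noteq> carrier G"
  shows "\<exists>L1 L2 L3. C_complement L1 \<and> C_complement L2 \<and> C_complement L3 \<and> card C = q ^ 3 * card (L1 \<inter> L2 \<inter> L3)"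
proof -
  define K where "K = (\<lambda>a b. generate G ({x, y \<otimes> a, z \<otimes> b} \<union> N0))"
  define L where "L = (\<lambda>a b. K a b \<inter> C)"
  have sub: "{x, y \<otimes> a, z \<otimes> b} \<subseteq> carrier G" if "a \<in> N" "b \<in> N" for a b
    using that x y z mem_carrier by auto
  have K: "supplement (K a b)" if ab: "a \<in> N" "b \<in> N" for a b
    unfolding K_def
  proof (rule supplement_generate[OF sub[OF ab] _ ne[OF ab]])
    define T where "T = generate G ({x, y \<otimes> a, z \<otimes> b} \<union> N)"
    have sT: "subgroup T G" unfolding T_def using sub[OF ab] mem_carrier by (intro generate_is_subgroup) auto
    have T: "x \<in> T" "y \<otimes> a \<in> T" "z \<otimes> b \<in> T" "N \<subseteq> T" unfolding T_def by (auto intro: generate.incl)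
    have "y = (y \<otimes> a) \<otimes> inv a" "z = (z \<otimes> b) \<otimes> inv b" using y z ab mem_carrier by (simp_all add: m_assoc)
    then have "y \<in> T" "z \<in> T"
      using T ab subgroup.m_closed[OF sT] subgroup.m_inv_closed[OF sT] by (metis subsetD)+
    then have "generate G ({x, y, z} \<union> N) \<subseteq> T" using T by (intro generate_subgroup_incl[OF _ sT]) auto
    then show "generate G ({x, y \<otimes> a, z \<otimes> b} \<union> N) = carrier G"
      using full subgroup.subset[OF sT] T_def by blast
  qed
  have Lc: "C_complement (L a b)" if "a \<in> N" "b \<in> N" for a b
    unfolding L_def by (rule C_complement_of_supplement[OF K[OF that]])
  have Kmem: "x \<in> K a b" "y \<otimes> a \<in> K a b" "z \<otimes> b \<in> K a b" for a b
    unfolding K_def by (auto intro: generate.incl)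
  \<comment> \<open>Equal complements force equal supplements. Such a supplement contains both lifts
    of \<open>y\<close>, hence their quotient, which lies in \<open>N\<close> and so in
    \<open>N0\<close>; the same holds for \<open>z\<close>.\<close>
  have inj: "N0 #> a = N0 #> a' \<and> N0 #> b = N0 #> b'"
    if ab: "a \<in> N" "b \<in> N" "a' \<in> N" "b' \<in> N" and eq: "L a b = L a' b'" for a b a' b'
  proof -
    have KK: "K a b = K a' b'"
      using supplement_eqI[OF K[OF ab(1,2)] K[OF ab(3,4)] Kmem(1) Kmem(1) x(2)] eq unfolding L_def by blast
    have sK: "subgroup (K a b) G" and KN: "K a b \<inter> N = N0" using K[OF ab(1,2)] unfolding supplement_def by auto
    have aux: "N0 #> c = N0 #> c'" if c: "c \<in> N" "c' \<in> N" "t \<in> carrier G" "t \<otimes> c \<in> K a b" "t \<otimes> c' \<in> K a b" for c c' t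
    proof -
      have cG: "c \<in> carrier G" "c' \<in> carrier G" using c mem_carrier by auto
      have "inv c' \<otimes> c = inv (t \<otimes> c') \<otimes> (t \<otimes> c)" using c cG by (simp add: m_assoc inv_mult_group)
      then have "inv c' \<otimes> c \<in> K a b" using c subgroup.m_closed[OF sK] subgroup.m_inv_closed[OF sK] by simp
      moreover have "inv c' \<otimes> c = c \<otimes> inv c'"
        using derived_comm c(1,2) N_M(1) subgroup.m_inv_closed[OF subgroups(1)] by blast
      moreover have "c \<otimes> inv c' \<in> N"
        using c subgroup.m_closed[OF subgroups(2)] subgroup.m_inv_closed[OF subgroups(2)] by blast
      ultimately have "c \<otimes> inv c' \<in> N0" using KN by auto
      then show ?thesis using rcos_eq_iff[OF subgroups(3) cG] by simp
    qed
    show ?thesis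
      using aux[OF ab(1,3) y Kmem(2)] aux[OF ab(2,4) z Kmem(3)] Kmem(2)[of a' b'] Kmem(3)[of b' a'] KK by simp
  qed
  have oneN: "\<one> \<in> N" by (rule subgroup.one_closed[OF subgroups(2)])
  obtain n where n: "n \<in> N" "n \<notin> N0" using N0_N by blast
  define L1 where "L1 = L \<one> \<one>"
  define L2 where "L2 = L n \<one>"
  have L12: "C_complement L1" "C_complement L2" unfolding L1_def L2_def using Lc oneN n by auto
  have "N0 #> n \<noteq> N0 #> \<one>"
    using rcos_eq_self_iff[OF subgroups(3) mem_carrier(2)[OF n(1)]] n(2) subgroup.subset[OF subgroups(3)] by simp
  have ne12: "L1 \<noteq> L2"
  proof
    assume "L1 = L2"
    then have "N0 #> \<one> = N0 #> n" using inj[OF oneN oneN n(1) oneN] unfolding L1_def L2_def by blast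
    then show False using \<open>N0 #> n \<noteq> N0 #> \<one>\<close> by simp
  qed
  have finC: "finite C" by (rule finite_subset[OF _ fin]) (use C_carrier in blast)
  have finL: "finite A" if "C_complement A" for A
    using C_complementD(4)[OF that] finC finite_subset by blast
  have same_card: "card A = card B" if "C_complement A" "C_complement B" for A B
    using C_complement_card'[OF that(1)] C_complement_card'[OF that(2)] q_gt_1 by simp
  have not_sub: "\<not> A \<subseteq> B" if "C_complement A" "C_complement B" "A \<noteq> B" for A B
    using card_subset_eq[OF finL[OF that(2)], of A] same_card that by blast
  have Int_card: "card C * card (A \<inter> B) = card A * card B" if "C_complement A" "C_complement B" "A \<noteq> B" for A B
    using C_complement_card_Int[OF that(2) C_complementD(1)[OF that(1)] C_complementD(4)[OF that(1)]] not_sub[OF that] .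
  have cardC: "card C > 0" using finC C_subgroup subgroup.one_closed card_gt_0_iff by blast
  define D where "D = L1 \<inter> L2"
  have nD: "D \<lhd> G" unfolding D_def
    by (rule normal_subgroup_intersect[OF C_complementD(1)[OF L12(1)] C_complementD(1)[OF L12(2)]])
  have "\<exists>a\<in>N. \<exists>b\<in>N. \<not> D \<subseteq> L a b"
  proof (rule ccontr)
    assume "\<not> ?thesis"
    then have DL: "D \<subseteq> L a b" if "a \<in> N" "b \<in> N" for a b using that by blast
    obtain c where c: "c \<in> L1" "c \<notin> L2" using not_sub[OF L12 ne12] by blast
    have cC: "c \<in> C" using c C_complementD(4)[OF L12(1)] by blast
    have cG: "c \<in> carrier G" using cC C_carrier by blast
    have "\<exists>m\<in>N. c \<otimes> inv m \<in> L a b" if ab: "a \<in> N" "b \<in> N" for a b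
    proof -
      obtain l m where lm: "l \<in> L a b" "m \<in> N" "c = l \<otimes> m" using C_complementD(6)[OF Lc[OF ab] cC] by auto
      have "c \<otimes> inv m = l"
        using lm subgroup_mem_carrier[OF C_complementD(2)[OF Lc[OF ab]]] mem_carrier by (simp add: m_assoc)
      then show ?thesis using lm by blast
    qed
    then obtain f where f: "\<And>a b. a \<in> N \<Longrightarrow> b \<in> N \<Longrightarrow> f a b \<in> N \<and> c \<otimes> inv (f a b) \<in> L a b" by metis
    \<comment> \<open>\<open>c\<close> is in \<open>L1\<close> but not in \<open>L2\<close>, and
      \<open>f a b\<close> is its \<open>N\<close>-part relative to \<open>L a b\<close>. Distinct
      complements above \<open>D\<close> meet exactly in \<open>D\<close>, so a common element
      \<open>c \<otimes> inv m\<close> lies in \<open>L1\<close> and \<open>L2\<close>; this puts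
      \<open>m\<close> into \<open>N0\<close> and then \<open>c\<close> into
      \<open>L2\<close>.\<close>
    have f_inj: "L a b = L a' b'"
      if ab: "a \<in> N" "b \<in> N" "a' \<in> N" "b' \<in> N" and eq: "N0 #> f a b = N0 #> f a' b'" for a b a' b'
    proof (rule ccontr)
      assume neq: "L a b \<noteq> L a' b'"
      define m m' where "m = f a b" and "m' = f a' b'"
      have m: "m \<in> N" "m' \<in> N" "c \<otimes> inv m \<in> L a b" "c \<otimes> inv m' \<in> L a' b'"
        unfolding m_def m'_def using f ab by auto
      have mG: "m \<in> carrier G" "m' \<in> carrier G" using m mem_carrier by auto
      have N0': "m' \<otimes> inv m \<in> N0" using eq rcos_eq_iff[OF subgroups(3) mG(2,1)] unfolding m_def m'_def by simp
      have sL': "subgroup (L a' b') G" "N0 \<subseteq> L a' b'"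
        using C_complementD(2,3)[OF Lc[OF ab(3,4)]] .
      have "c \<otimes> inv m = (c \<otimes> inv m') \<otimes> (m' \<otimes> inv m)" using cG mG by (simp add: m_assoc)
      then have mL': "c \<otimes> inv m \<in> L a' b'" using m(4) N0' sL' subgroup.m_closed[OF sL'(1)] by auto
      have "card C * card (L a b \<inter> L a' b') = card C * card D"
        using Int_card[OF Lc[OF ab(1,2)] Lc[OF ab(3,4)] neq] Int_card[OF L12 ne12] same_card Lc ab L12
        unfolding D_def by metis
      then have "card (L a b \<inter> L a' b') = card D" using cardC by simp
      moreover have "D \<subseteq> L a b \<inter> L a' b'" using DL ab by blast
      moreover have "finite (L a b \<inter> L a' b')" using finL[OF Lc[OF ab(1,2)]] by simp
      ultimately have "D = L a b \<inter> L a' b'" using card_subset_eq by metis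
      then have cm: "c \<otimes> inv m \<in> L1" "c \<otimes> inv m \<in> L2" using m(3) mL' unfolding D_def by auto
      have s1: "subgroup L1 G" and s2: "subgroup L2 G" using C_complementD(2) L12 by auto
      have "m = inv (c \<otimes> inv m) \<otimes> c" using cG mG by (simp add: inv_mult_group m_assoc)
      then have "m \<in> L1" using cm(1) c(1) subgroup.m_closed[OF s1] subgroup.m_inv_closed[OF s1] by metis
      then have "m \<in> N0" using C_complementD(5)[OF L12(1)] m(1) by blast
      then have "m \<in> L2" using C_complementD(3)[OF L12(2)] by blast
      moreover have "c = (c \<otimes> inv m) \<otimes> m" using cG mG by (simp add: m_assoc)
      ultimately have "c \<in> L2" using cm(2) subgroup.m_closed[OF s2] by metis
      then show False using c(2) by blast
    qed
    let ?X = "(\<lambda>m. N0 #> m) ` N"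
    define r where "r = (\<lambda>u. SOME m. m \<in> N \<and> N0 #> m = u)"
    have r: "r u \<in> N \<and> N0 #> r u = u" if "u \<in> ?X" for u
      unfolding r_def by (rule someI_ex) (use that in blast)
    have "inj_on (\<lambda>(u, v). N0 #> f (r u) (r v)) (?X \<times> ?X)"
    proof (rule inj_onI)
      fix s t assume st: "s \<in> ?X \<times> ?X" "t \<in> ?X \<times> ?X"
        and e: "(\<lambda>(u, v). N0 #> f (r u) (r v)) s = (\<lambda>(u, v). N0 #> f (r u) (r v)) t"
      obtain u v u' v' where uv: "s = (u, v)" "t = (u', v')" by fastforce
      have m: "u \<in> ?X" "v \<in> ?X" "u' \<in> ?X" "v' \<in> ?X" using st uv by auto
      have "L (r u) (r v) = L (r u') (r v')"
        by (rule f_inj) (use r m e uv in auto)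
      then have "N0 #> r u = N0 #> r u' \<and> N0 #> r v = N0 #> r v'"
        by (rule inj[rotated 4]) (use r m in auto)
      then show "s = t" using r m uv by metis
    qed
    moreover have "(\<lambda>(u, v). N0 #> f (r u) (r v)) ` (?X \<times> ?X) \<subseteq> ?X"
    proof
      fix w assume "w \<in> (\<lambda>(u, v). N0 #> f (r u) (r v)) ` (?X \<times> ?X)"
      then obtain u v where uv: "u \<in> ?X" "v \<in> ?X" "w = N0 #> f (r u) (r v)" by auto
      then show "w \<in> ?X" using f[of "r u" "r v"] r by blast
    qed
    \<comment> \<open>The \<open>q ^ 2\<close> distinct complements would be told apart by only
      \<open>q\<close> cosets.\<close>
    ultimately have "card (?X \<times> ?X) \<le> card ?X" using finite_N by (intro card_inj_on_le) auto
    then have "q * q \<le> q" unfolding q_def by (simp add: card_cartesian_product)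
    then show False using q_gt_1 by simp
  qed
  then obtain a b where ab: "a \<in> N" "b \<in> N" "\<not> D \<subseteq> L a b" by blast
  have L3: "C_complement (L a b)" by (rule Lc[OF ab(1,2)])
  have DC: "D \<subseteq> C" unfolding D_def using C_complementD(4)[OF L12(1)] by blast
  have e3: "card C * card (D \<inter> L a b) = card D * card (L a b)"
    by (rule C_complement_card_Int[OF L3 nD DC ab(3)])
  have e2: "card C * card D = card L1 * card L2" unfolding D_def by (rule Int_card[OF L12 ne12])
  have q1: "card C = q * card L1" "card C = q * card L2" "card C = q * card (L a b)"
    using C_complement_card'[OF L12(1)] C_complement_card'[OF L12(2)] C_complement_card'[OF L3] .
  have "card C * (q * q * card D) = q * q * (card C * card D)" by (simp only: ac_simps)
  also have "\<dots> = (q * card L1) * (q * card L2)" unfolding e2 by (simp only: ac_simps)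
  also have "\<dots> = card C * card C" unfolding q1(1)[symmetric] unfolding q1(2)[symmetric] ..
  finally have qD: "q * q * card D = card C" using cardC by simp
  have "card C * (q ^ 3 * card (D \<inter> L a b)) = q ^ 3 * (card C * card (D \<inter> L a b))" by (simp only: ac_simps)
  also have "\<dots> = (q * q * card D) * (q * card (L a b))"
    unfolding e3 power3_eq_cube by (simp only: ac_simps)
  also have "\<dots> = card C * card C" unfolding qD unfolding q1(3)[symmetric] ..
  finally have "q ^ 3 * card (D \<inter> L a b) = card C" using cardC by simp
  then show ?thesis using L12 L3 unfolding D_def by metis
qed

text \<open>\<open>C\<close> modulo the three complements is elementary abelian of order
  \<open>q ^ 3\<close>, so the bound on \<open>p\<close>-subgroups gives
  \<open>q ^ 3 \<le> p ^ d\<close>. For odd \<open>p\<close> this contradicts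
  \<open>p \<le> q\<close>; for \<open>p = 2\<close> it leaves \<open>q = 2\<close>, where
  \<open>C\<close> is all of \<open>G\<close> although \<open>x\<close> is not in it.\<close>

lemma no_chief_step_noncentral:
  assumes psub: "\<And>p n S. prime p \<Longrightarrow> subgroup S G \<Longrightarrow> card S = p ^ n \<Longrightarrow> generated_by G (if p = 2 then 3 else 2) S"
    and x: "x \<in> carrier G" "x \<notin> C" and y: "y \<in> carrier G" and z: "z \<in> carrier G"
    and full: "generate G ({x, y, z} \<union> N) = carrier G"
    and ne: "\<And>a b. a \<in> N \<Longrightarrow> b \<in> N \<Longrightarrow> generate G ({x, y \<otimes> a, z \<otimes> b} \<union> N0) \<noteq> carrier G"
  shows False
proof -
  obtain L1 L2 L3 where L: "C_complement L1" "C_complement L2" "C_complement L3"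
    and card: "card C = q ^ 3 * card (L1 \<inter> L2 \<inter> L3)"
    using three_complements[OF x y z full ne] by blast
  obtain p where p: "prime p" "p \<le> q" "\<And>n. n \<in> N \<Longrightarrow> n [^] p \<in> N0"
    using prime_exponent by blast
  define D where "D = L1 \<inter> L2 \<inter> L3"
  define d :: nat where "d = (if p = 2 then 3 else 2)"
  have sD: "subgroup D G" unfolding D_def
    by (intro subgroups_Inter_pair C_complementD(2) L)
  have DC: "D \<subseteq> C" unfolding D_def using C_complementD(4)[OF L(1)] by blast
  interpret GC: group "G\<lparr>carrier := C\<rparr>" using C_subgroup by (rule subgroup_imp_group)
  have "order (G\<lparr>carrier := C\<rparr>) \<le> p ^ d * card D"
  proof (rule GC.generated_by_index_bound[OF _ p(1)])
    show "finite (carrier (G\<lparr>carrier := C\<rparr>))"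
      using finite_subset[OF _ fin, of C] C_carrier by auto
    show "subgroup D (G\<lparr>carrier := C\<rparr>)" by (rule subgroup_incl[OF sD C_subgroup DC])
    show "commute_mod (G\<lparr>carrier := C\<rparr>) D g h"
      if "g \<in> carrier (G\<lparr>carrier := C\<rparr>)" "h \<in> carrier (G\<lparr>carrier := C\<rparr>)" for g h
      using that C_complement_commute[OF L(1), of g h] C_complement_commute[OF L(2), of g h]
        C_complement_commute[OF L(3), of g h] commute_mod_consistent[OF C_subgroup, of g h D]
      unfolding D_def commute_mod_def by simp
    show "g [^]\<^bsub>G\<lparr>carrier := C\<rparr>\<^esub> p \<in> D" if "g \<in> carrier (G\<lparr>carrier := C\<rparr>)" for g
      using that C_complement_pow[OF L(1) p(3), of g] C_complement_pow[OF L(2) p(3), of g]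
        C_complement_pow[OF L(3) p(3), of g] unfolding D_def by (simp flip: nat_pow_consistent)
    show "generated_by (G\<lparr>carrier := C\<rparr>) d S" if "subgroup S (G\<lparr>carrier := C\<rparr>)" "card S = p ^ n" for S n
      unfolding d_def
      by (rule generated_by_subgroup[OF C_subgroup _ psub[OF p(1) incl_subgroup[OF C_subgroup that(1)] that(2)]])
        (use subgroup.subset[OF that(1)] in simp)
  qed
  then have "q ^ 3 * card D \<le> p ^ d * card D" using card unfolding order_def D_def by simp
  moreover have "card D > 0"
    using card card_gt_0_iff[of C] subgroup.one_closed[OF C_subgroup] finite_subset[OF _ fin, of C] C_carrier
    unfolding D_def by (metis empty_iff gr0I mult_0_right subsetI)
  ultimately have le: "q ^ 3 \<le> p ^ d" by simp
  have p2: "p \<ge> 2" using p(1) by (rule prime_ge_2_nat)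
  show False
  proof (cases "p = 2")
    case True
    then have "q ^ 3 \<le> 2 ^ 3" using le d_def by simp
    then have "q \<le> 2" using power_mono_iff[of q 2 3] by simp
    then have "q = 2" using q_gt_1 by simp
    then show False using C_eq_carrier_of_q_eq_2 x by blast
  next
    case False
    then have "p ^ 3 \<le> p ^ 2" using le_trans[OF power_mono[OF p(2), of 3]] le d_def by simp
    then show False using p2 by (simp add: power_le_imp_le_exp)
  qed
qed

text \<open>A generator outside \<open>C\<close> is put in the place of \<open>x\<close>. If all
  three lie in \<open>C\<close>, then \<open>C\<close>, which contains \<open>N\<close>, is the
  whole group, and \<open>C_complement_ne_all\<close> applies.\<close>

lemma no_chief_step:
  assumes psub: "\<And>p n S. prime p \<Longrightarrow> subgroup S G \<Longrightarrow> card S = p ^ n \<Longrightarrow> generated_by G (if p = 2 then 3 else 2) S"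
    and x: "x \<in> carrier G" and y: "y \<in> carrier G" and z: "z \<in> carrier G"
    and full: "generate G ({x, y, z} \<union> N) = carrier G"
    and ne: "\<And>a b c. a \<in> N \<Longrightarrow> b \<in> N \<Longrightarrow> c \<in> N \<Longrightarrow> generate G ({x \<otimes> a, y \<otimes> b, z \<otimes> c} \<union> N0) \<noteq> carrier G"
  shows False
proof -
  have one: "\<one> \<in> N" by (rule subgroup.one_closed[OF subgroups(2)])
  consider "x \<notin> C" | "y \<notin> C" | "z \<notin> C" | "{x, y, z} \<subseteq> C" by blast
  then show False
  proof cases
    case 1
    have "\<And>a b. {x, y \<otimes> a, z \<otimes> b} = {x \<otimes> \<one>, y \<otimes> a, z \<otimes> b}" using x by auto
    then have ne': "generate G ({x, y \<otimes> a, z \<otimes> b} \<union> N0) \<noteq> carrier G" if "a \<in> N" "b \<in> N" for a b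
      using ne[OF one that] by metis
    show False
    proof (rule no_chief_step_noncentral[OF _ x 1 y z full])
      show "generated_by G (if p = 2 then 3 else 2) S" if "prime p" "subgroup S G" "card S = p ^ n" for p n S
        by (rule psub[OF that])
    qed fact+
  next
    case 2
    have "{y, x, z} = {x, y, z}" "\<And>a b. {y, x \<otimes> a, z \<otimes> b} = {x \<otimes> a, y \<otimes> \<one>, z \<otimes> b}" using y by auto
    then have ne': "generate G ({y, x \<otimes> a, z \<otimes> b} \<union> N0) \<noteq> carrier G" if "a \<in> N" "b \<in> N" for a b
      using ne[OF that(1) one that(2)] by metis
    have "generate G ({y, x, z} \<union> N) = carrier G" using full \<open>{y, x, z} = {x, y, z}\<close> by metis
    show False
    proof (rule no_chief_step_noncentral[OF _ y 2 x z])
      show "generated_by G (if p = 2 then 3 else 2) S" if "prime p" "subgroup S G" "card S = p ^ n" for p n S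
        by (rule psub[OF that])
    qed fact+
  next
    case 3
    have "{z, x, y} = {x, y, z}" "\<And>a b. {z, x \<otimes> a, y \<otimes> b} = {x \<otimes> a, y \<otimes> b, z \<otimes> \<one>}" using z by auto
    then have ne': "generate G ({z, x \<otimes> a, y \<otimes> b} \<union> N0) \<noteq> carrier G" if "a \<in> N" "b \<in> N" for a b
      using ne[OF that one] by metis
    have "generate G ({z, x, y} \<union> N) = carrier G" using full \<open>{z, x, y} = {x, y, z}\<close> by metis
    show False
    proof (rule no_chief_step_noncentral[OF _ z 3 x y])
      show "generated_by G (if p = 2 then 3 else 2) S" if "prime p" "subgroup S G" "card S = p ^ n" for p n S
        by (rule psub[OF that])
    qed fact+
  next
    case 4
    have "generate G ({x, y, z} \<union> N) \<subseteq> C"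
      using 4 N_M(1) M_C by (intro generate_subgroup_incl[OF _ C_subgroup]) auto
    then have CG: "C = carrier G" using full C_carrier by blast
    have "supplement (generate G ({x, y, z} \<union> N0))"
      using ne[OF one one one] x y z full by (intro supplement_generate) auto
    then show False using C_complement_of_supplement C_complement_ne_all[OF CG] by blast
  qed
qed

end

context group
begin

text \<open>The three generators are lifted down a chief series of the derived subgroup \<open>M\<close>. If a chief factor
  \<open>N/N\<^sub>0\<close> below \<open>M\<close> obstructs the lifting, every lift generates a complement of it, and the many
  complements force an elementary abelian section of order \<open>|N/N\<^sub>0|\<^sup>3\<close>.\<close>

theorem generated_by_3_of_p_subgroups:
  assumes fin: "finite (carrier G)"
    and ab: "\<And>a b. a \<in> derived G (carrier G) \<Longrightarrow> b \<in> derived G (carrier G) \<Longrightarrow> a \<otimes> b = b \<otimes> a"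
    and psub: "\<And>p n S. prime p \<Longrightarrow> subgroup S G \<Longrightarrow> card S = p ^ n \<Longrightarrow> generated_by G (if p = 2 then 3 else 2) S"
  shows "generated_by G 3 (carrier G)"
proof -
  let ?M = "derived G (carrier G)"
  define P where "P = (\<lambda>N. N \<lhd> G \<and> N \<subseteq> ?M \<and> (\<exists>x\<in>carrier G. \<exists>y\<in>carrier G. \<exists>z\<in>carrier G.
     generate G ({x, y, z} \<union> N) = carrier G))"
  have M: "?M \<lhd> G" by (rule derived_is_normal[OF normal_self])
  have "\<exists>g::nat \<Rightarrow> 'a. g ` {..<3} \<subseteq> carrier G \<and> generate G (g ` {..<3} \<union> ?M) = carrier G"
  proof (rule generators_mod_abelian[OF fin M commute_mod_derived])
    show "generated_by G 3 S" if "prime p" "subgroup S G" "card S = p ^ n" for p n S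
      using psub[OF that] generated_by_mono[of G 2 S 3] by (auto split: if_splits)
  qed
  then obtain g :: "nat \<Rightarrow> 'a" where g: "g ` {..<3} \<subseteq> carrier G" "generate G (g ` {..<3} \<union> ?M) = carrier G" by blast
  have "g ` {..<3} = {g 0, g 1, g 2}" by (auto simp: lessThan_Suc numeral_3_eq_3 numeral_2_eq_2)
  then have "P ?M" unfolding P_def using M g by force
  \<comment> \<open>\<open>N\<close> is a smallest normal subgroup below the derived subgroup modulo
    which three generators suffice; the aim is to see that it is trivial.\<close>
  then obtain N where N: "P N" and min: "\<And>N'. P N' \<Longrightarrow> card N \<le> card N'"
    using ex_has_least_nat[of P ?M card] by blast
  obtain x y z where nN: "N \<lhd> G" and NM: "N \<subseteq> ?M" and xyz: "x \<in> carrier G" "y \<in> carrier G" "z \<in> carrier G"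
    "generate G ({x, y, z} \<union> N) = carrier G" using N unfolding P_def by auto
  have sN: "subgroup N G" using nN by (rule normal_imp_subgroup)
  have finN: "finite N" by (rule finite_subset[OF subgroup.subset[OF sN] fin])
  show ?thesis
  proof (cases "N = {\<one>}")
    case True
    have s: "subgroup (generate G {x, y, z}) G" using xyz by (intro generate_is_subgroup) auto
    have "generate G ({x, y, z} \<union> N) \<subseteq> generate G {x, y, z}"
      using True by (intro generate_subgroup_incl[OF _ s]) (auto intro: generate.incl generate.one)
    then have "carrier G = generate G {x, y, z}" using xyz(4) subgroup.subset[OF s] by blast
    moreover have "card {x, y, z} \<le> 3" using card_length[of "[x, y, z]"] by simp
    ultimately show ?thesis unfolding generated_by_def using xyz by (intro exI[of _ "{x, y, z}"]) auto
  next
    case False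
    \<comment> \<open>A maximal element \<open>N0\<close> of this set makes \<open>N/N0\<close> a
      chief factor.\<close>
    define T where "T = {V. V \<lhd> G \<and> V \<subset> N}"
    have "finite T" unfolding T_def by (rule finite_subset[of _ "Pow N"]) (use finN in auto)
    moreover have "{\<one>} \<in> T" unfolding T_def using one_is_normal subgroup.one_closed[OF sN] False by auto
    ultimately obtain N0 where N0: "N0 \<in> T" and max: "\<forall>V\<in>T. N0 \<subseteq> V \<longrightarrow> N0 = V"
      using finite_has_maximal2[of T "{\<one>}"] by blast
    have nN0: "N0 \<lhd> G" "N0 \<subset> N" using N0 unfolding T_def by auto
    interpret abelian_chief_factor G N0 N
    proof (rule abelian_chief_factor.intro[OF group_axioms abelian_chief_factor_axioms.intro])
      show "V = N0 \<or> V = N" if "V \<lhd> G" "N0 \<subseteq> V" "V \<subseteq> N" for V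
        using that max unfolding T_def by blast
      show "a \<otimes> b = b \<otimes> a" if "a \<in> ?M" "b \<in> ?M" for a b
        using that by (rule ab)
    qed fact+
    have "generate G ({x \<otimes> a, y \<otimes> b, z \<otimes> c} \<union> N0) \<noteq> carrier G" if "a \<in> N" "b \<in> N" "c \<in> N" for a b c
    proof
      assume "generate G ({x \<otimes> a, y \<otimes> b, z \<otimes> c} \<union> N0) = carrier G"
      moreover have "x \<otimes> a \<in> carrier G" "y \<otimes> b \<in> carrier G" "z \<otimes> c \<in> carrier G"
        using xyz that subgroup_mem_carrier[OF sN] by auto
      ultimately have "P N0" unfolding P_def using nN0 NM by blast
      then show False using min psubset_card_mono[OF finN nN0(2)] by force
    qed
    have False
    proof (rule no_chief_step[OF _ xyz])
      show "generated_by G (if p = 2 then 3 else 2) S" if "prime p" "subgroup S G" "card S = p ^ n" for p n S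
        by (rule psub[OF that])
    qed fact+
    then show ?thesis ..
  qed
qed

section \<open>Ito's theorem and local finiteness\<close>

lemma commute_mod_one_iff:
  assumes "x \<in> carrier G" "y \<in> carrier G"
  shows "commute_mod G {\<one>} x y \<longleftrightarrow> x \<otimes> y = y \<otimes> x"
proof
  assume "commute_mod G {\<one>} x y"
  then have "x \<otimes> y \<otimes> inv x \<otimes> inv y = \<one>" unfolding commute_mod_def by simp
  then have "(x \<otimes> y \<otimes> inv x \<otimes> inv y) \<otimes> (y \<otimes> x) = y \<otimes> x" using assms by simp
  then show "x \<otimes> y = y \<otimes> x" using assms by (simp add: m_assoc)
qed (use assms commute_imp_commute_mod[OF one_is_normal] in blast)

lemma subgroup_centralizer:
  assumes "x \<in> carrier G" shows "subgroup {y \<in> carrier G. x \<otimes> y = y \<otimes> x} G"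
proof -
  have "{y \<in> carrier G. x \<otimes> y = y \<otimes> x} = {y \<in> carrier G. commute_mod G {\<one>} x y}"
    using commute_mod_one_iff[OF assms] by blast
  then show ?thesis using subgroup_commute_mod[OF one_is_normal assms] by simp
qed

lemma generate_commute:
  assumes S: "S \<subseteq> carrier G" and c: "\<And>s t. s \<in> S \<Longrightarrow> t \<in> S \<Longrightarrow> s \<otimes> t = t \<otimes> s"
    and u: "u \<in> generate G S" and v: "v \<in> generate G S"
  shows "u \<otimes> v = v \<otimes> u"
proof -
  have 1: "s \<otimes> t = t \<otimes> s" if "s \<in> S" "t \<in> generate G S" for s t
    using generate_subgroup_incl[OF _ subgroup_centralizer[of s], of S] that S c by blast
  have uG: "u \<in> carrier G" using u generate_in_carrier[OF S] by blast
  have "generate G S \<subseteq> {y \<in> carrier G. u \<otimes> y = y \<otimes> u}"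
    using 1[OF _ u] S by (intro generate_subgroup_incl[OF _ subgroup_centralizer[OF uG]]) auto
  then show ?thesis using v by blast
qed

lemma set_mult_swap:
  assumes A: "subgroup A G" and B: "subgroup B G" and "carrier G = A <#> B"
  shows "carrier G = B <#> A"
proof
  show "carrier G \<subseteq> B <#> A"
  proof
    fix g assume g: "g \<in> carrier G"
    then have "inv g \<in> A <#> B" using assms(3) by auto
    then obtain a b where ab: "a \<in> A" "b \<in> B" "inv g = a \<otimes> b" by (rule set_mult_memE)
    then have "g = inv b \<otimes> inv a"
      using g subgroup_mem_carrier[OF A] subgroup_mem_carrier[OF B] inv_inv inv_mult_group by metis
    then show "g \<in> B <#> A" using ab subgroup.m_inv_closed[OF A] subgroup.m_inv_closed[OF B] set_mult_memI by blast
  qed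
  show "B <#> A \<subseteq> carrier G"
    using subgroup.subset[OF A] subgroup.subset[OF B] by (rule setmult_subset_G[rotated])
qed

text \<open>Ito's theorem: \<open>[a, b]\<close> has the same conjugate under \<open>a\<^sub>1 b\<^sub>1\<close> and under \<open>b\<^sub>1 a\<^sub>1\<close>, so the
  commutators of elements of \<open>A\<close> with elements of \<open>B\<close> commute with each other.\<close>

theorem derived_abelian_of_product:
  assumes A: "subgroup A G" and B: "subgroup B G" and AB: "carrier G = A <#> B"
    and cA: "\<And>x y. x \<in> A \<Longrightarrow> y \<in> A \<Longrightarrow> x \<otimes> y = y \<otimes> x"
    and cB: "\<And>x y. x \<in> B \<Longrightarrow> y \<in> B \<Longrightarrow> x \<otimes> y = y \<otimes> x"
    and "u \<in> derived G (carrier G)" "v \<in> derived G (carrier G)"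
  shows "u \<otimes> v = v \<otimes> u"
proof -
  note AG = subgroup_mem_carrier[OF A] and BG = subgroup_mem_carrier[OF B]
  have BA: "carrier G = B <#> A" by (rule set_mult_swap[OF A B AB])
  define k where "k = (\<lambda>a b. a \<otimes> b \<otimes> inv a \<otimes> inv b)"
  have kG: "k a b \<in> carrier G" if "a \<in> carrier G" "b \<in> carrier G" for a b unfolding k_def using that by simp
  define S where "S = {k a b | a b. a \<in> A \<and> b \<in> B}"
  have SG: "S \<subseteq> carrier G" unfolding S_def using kG AG BG by auto
  \<comment> \<open>In \<open>a1 b a1^-1 = b2 a2\<close> the factor \<open>a2\<close> commutes with
    \<open>a\<close> and drops out of the commutator. So conjugation by \<open>A\<close> changes
    only the second entry of \<open>k\<close>, and, in \<open>conjB\<close>, conjugation by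
    \<open>B\<close> only the first.\<close>
  have conjA: "a1 \<otimes> k a b \<otimes> inv a1 = k a b2"
    if m: "a1 \<in> A" "a \<in> A" "b \<in> B" "b2 \<in> B" "a2 \<in> A" and e: "a1 \<otimes> b \<otimes> inv a1 = b2 \<otimes> a2" for a1 a b b2 a2
  proof -
    have G: "a1 \<in> carrier G" "a \<in> carrier G" "b \<in> carrier G" "b2 \<in> carrier G" "a2 \<in> carrier G"
      using m AG BG by auto
    have "a1 \<otimes> k a b \<otimes> inv a1 = (a1 \<otimes> a \<otimes> inv a1) \<otimes> (a1 \<otimes> b \<otimes> inv a1) \<otimes> inv (a1 \<otimes> a \<otimes> inv a1) \<otimes> inv (a1 \<otimes> b \<otimes> inv a1)"
      unfolding k_def using G by (simp add: m_assoc inv_mult_group)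
    also have "a1 \<otimes> a \<otimes> inv a1 = a" using cA[OF m(1,2)] G by (simp add: m_assoc)
    also have "a \<otimes> (a1 \<otimes> b \<otimes> inv a1) \<otimes> inv a \<otimes> inv (a1 \<otimes> b \<otimes> inv a1) = a \<otimes> b2 \<otimes> (a2 \<otimes> inv a \<otimes> inv a2) \<otimes> inv b2"
      unfolding e using G by (simp add: m_assoc inv_mult_group)
    also have "a2 \<otimes> inv a \<otimes> inv a2 = inv a"
      using cA[OF m(5) subgroup.m_inv_closed[OF A m(2)]] G by (simp add: m_assoc)
    finally show ?thesis unfolding k_def .
  qed
  have conjB: "b1 \<otimes> k a b \<otimes> inv b1 = k a3 b"
    if m: "b1 \<in> B" "a \<in> A" "b \<in> B" "a3 \<in> A" "b3 \<in> B" and e: "b1 \<otimes> a \<otimes> inv b1 = a3 \<otimes> b3" for b1 a b a3 b3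
  proof -
    have G: "b1 \<in> carrier G" "a \<in> carrier G" "b \<in> carrier G" "a3 \<in> carrier G" "b3 \<in> carrier G"
      using m AG BG by auto
    have "b1 \<otimes> k a b \<otimes> inv b1 = (b1 \<otimes> a \<otimes> inv b1) \<otimes> (b1 \<otimes> b \<otimes> inv b1) \<otimes> inv (b1 \<otimes> a \<otimes> inv b1) \<otimes> inv (b1 \<otimes> b \<otimes> inv b1)"
      unfolding k_def using G by (simp add: m_assoc inv_mult_group)
    also have "b1 \<otimes> b \<otimes> inv b1 = b" using cB[OF m(1,3)] G by (simp add: m_assoc)
    also have "(b1 \<otimes> a \<otimes> inv b1) \<otimes> b \<otimes> inv (b1 \<otimes> a \<otimes> inv b1) \<otimes> inv b = a3 \<otimes> (b3 \<otimes> b \<otimes> inv b3) \<otimes> inv a3 \<otimes> inv b"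
      unfolding e using G by (simp add: m_assoc inv_mult_group)
    also have "b3 \<otimes> b \<otimes> inv b3 = b" using cB[OF m(5,3)] G by (simp add: m_assoc)
    finally show ?thesis unfolding k_def .
  qed
  have exA: "\<exists>b2\<in>B. \<exists>a2\<in>A. a1 \<otimes> b \<otimes> inv a1 = b2 \<otimes> a2" if "a1 \<in> A" "b \<in> B" for a1 b
  proof -
    have "a1 \<otimes> b \<otimes> inv a1 \<in> carrier G" using AG[OF that(1)] BG[OF that(2)] by simp
    then have "a1 \<otimes> b \<otimes> inv a1 \<in> B <#> A" using BA by simp
    then show ?thesis by (rule set_mult_memE) blast
  qed
  have exB: "\<exists>a3\<in>A. \<exists>b3\<in>B. b1 \<otimes> a \<otimes> inv b1 = a3 \<otimes> b3" if "b1 \<in> B" "a \<in> A" for b1 a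
  proof -
    have "b1 \<otimes> a \<otimes> inv b1 \<in> carrier G" using BG[OF that(1)] AG[OF that(2)] by simp
    then have "b1 \<otimes> a \<otimes> inv b1 \<in> A <#> B" using AB by simp
    then show ?thesis by (rule set_mult_memE) blast
  qed
  \<comment> \<open>\<open>k (inv a1) (inv b1)\<close> equals
    \<open>inv (b1 \<otimes> a1) \<otimes> (a1 \<otimes> b1)\<close>. Both products conjugate
    \<open>k a b\<close> to the same \<open>k a3 b2\<close>, so their quotient centralises
    it.\<close>
  have comm: "k (inv a1) (inv b1) \<otimes> k a b = k a b \<otimes> k (inv a1) (inv b1)"
    if m: "a \<in> A" "a1 \<in> A" "b \<in> B" "b1 \<in> B" for a b a1 b1
  proof -
    have G: "a1 \<in> carrier G" "a \<in> carrier G" "b \<in> carrier G" "b1 \<in> carrier G" using m AG BG by auto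
    obtain b2 a2 where b2: "b2 \<in> B" "a2 \<in> A" "a1 \<otimes> b \<otimes> inv a1 = b2 \<otimes> a2" using exA m by blast
    obtain a3 b3 where a3: "a3 \<in> A" "b3 \<in> B" "b1 \<otimes> a \<otimes> inv b1 = a3 \<otimes> b3" using exB m by blast
    have "b1 \<otimes> (a1 \<otimes> k a b \<otimes> inv a1) \<otimes> inv b1 = k a3 b2"
      using conjA[OF m(2,1,3) b2] conjB[OF m(4,1) b2(1) a3] by simp
    moreover have "a1 \<otimes> (b1 \<otimes> k a b \<otimes> inv b1) \<otimes> inv a1 = k a3 b2"
      using conjB[OF m(4,1,3) a3] conjA[OF m(2) a3(1) m(3) b2] by simp
    ultimately have e: "a1 \<otimes> (b1 \<otimes> k a b \<otimes> inv b1) \<otimes> inv a1 = b1 \<otimes> (a1 \<otimes> k a b \<otimes> inv a1) \<otimes> inv b1" by simp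
    have kab: "k a b \<in> carrier G" using kG G by blast
    have "inv a1 \<otimes> inv b1 \<otimes> (a1 \<otimes> (b1 \<otimes> k a b \<otimes> inv b1) \<otimes> inv a1) \<otimes> (a1 \<otimes> b1)
      = inv a1 \<otimes> inv b1 \<otimes> (b1 \<otimes> (a1 \<otimes> k a b \<otimes> inv a1) \<otimes> inv b1) \<otimes> (a1 \<otimes> b1)" using e by simp
    moreover have "k (inv a1) (inv b1) = inv a1 \<otimes> inv b1 \<otimes> a1 \<otimes> b1" unfolding k_def using G by simp
    ultimately show ?thesis using G kab by (simp add: m_assoc)
  qed
  have cS: "s \<otimes> t = t \<otimes> s" if st: "s \<in> S" "t \<in> S" for s t
  proof -
    obtain a1 b1 a b where "a1 \<in> A" "b1 \<in> B" "s = k a1 b1" "a \<in> A" "b \<in> B" "t = k a b"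
      using st unfolding S_def by blast
    then show ?thesis
      using comm[of a "inv a1" b "inv b1"] subgroup.m_inv_closed[OF A] subgroup.m_inv_closed[OF B] AG BG by simp
  qed
  \<comment> \<open>\<open>T\<close> is normal because \<open>S\<close> is invariant under
    \<open>A\<close> and \<open>B\<close>. Modulo \<open>T\<close> the two abelian factors commute
    with each other, so \<open>G/T\<close> is abelian and \<open>T\<close> contains the derived
    subgroup.\<close>
  define T where "T = generate G S"
  have sT: "subgroup T G" unfolding T_def using SG by (rule generate_is_subgroup)
  have nAB: "g \<otimes> t \<otimes> inv g \<in> S" if t: "t \<in> S" and g: "g \<in> A \<union> B" for g t
  proof -
    obtain a b where ab: "a \<in> A" "b \<in> B" "t = k a b" using t unfolding S_def by blast
    show ?thesis
    proof (cases "g \<in> A")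
      case True
      obtain b2 a2 where "b2 \<in> B" "a2 \<in> A" "g \<otimes> b \<otimes> inv g = b2 \<otimes> a2" using exA True ab by blast
      then have "g \<otimes> t \<otimes> inv g = k a b2" using conjA[OF True ab(1,2)] ab(3) by simp
      then show ?thesis unfolding S_def using ab \<open>b2 \<in> B\<close> by blast
    next
      case False
      then have gB: "g \<in> B" using g by blast
      obtain a3 b3 where "a3 \<in> A" "b3 \<in> B" "g \<otimes> a \<otimes> inv g = a3 \<otimes> b3" using exB gB ab by blast
      then have "g \<otimes> t \<otimes> inv g = k a3 b" using conjB[OF gB ab(1,2)] ab(3) by simp
      then show ?thesis unfolding S_def using ab \<open>a3 \<in> A\<close> by blast
    qed
  qed
  have nT: "T \<lhd> G" unfolding T_def
  proof (rule normal_generateI[OF SG])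
    fix t g assume t: "t \<in> S" and g: "g \<in> carrier G"
    have "g \<in> A <#> B" using g AB by blast
    then obtain a b where ab: "a \<in> A" "b \<in> B" "g = a \<otimes> b" by (rule set_mult_memE)
    have "g \<otimes> t \<otimes> inv g = a \<otimes> (b \<otimes> t \<otimes> inv b) \<otimes> inv a"
      using ab AG BG t SG by (simp add: m_assoc inv_mult_group subset_eq)
    then show "g \<otimes> t \<otimes> inv g \<in> S" using nAB[OF nAB[OF t, of b], of a] ab by simp
  qed
  have gen: "commute_mod G T g h" if g: "g \<in> carrier G" and h: "h \<in> carrier G"
    and c: "\<And>s. s \<in> A \<union> B \<Longrightarrow> commute_mod G T g s" for g h
  proof -
    have s: "subgroup {h \<in> carrier G. commute_mod G T g h} G" by (rule subgroup_commute_mod[OF nT g])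
    have "h \<in> A <#> B" using h AB by blast
    then obtain a b where "a \<in> A" "b \<in> B" "h = a \<otimes> b" by (rule set_mult_memE)
    then show ?thesis using subgroup.m_closed[OF s, of a b] c AG BG by simp
  qed
  have ab: "commute_mod G T a b" if "a \<in> A" "b \<in> B" for a b
    using that unfolding T_def commute_mod_def S_def k_def by (auto intro!: generate.incl)
  have aa: "commute_mod G T a g" if "a \<in> A" "g \<in> carrier G" for a g
  proof (rule gen[OF AG[OF that(1)] that(2)])
    fix s assume "s \<in> A \<union> B"
    then show "commute_mod G T a s"
      using ab[OF that(1)] commute_imp_commute_mod[OF nT AG[OF that(1)] AG cA[OF that(1)]] by auto
  qed
  have bb: "commute_mod G T b g" if "b \<in> B" "g \<in> carrier G" for b g
  proof (rule gen[OF BG[OF that(1)] that(2)])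
    fix s assume "s \<in> A \<union> B"
    then show "commute_mod G T b s"
      using commute_mod_sym[OF nT AG BG[OF that(1)] ab[OF _ that(1)]]
        commute_imp_commute_mod[OF nT BG[OF that(1)] BG cB[OF that(1)]] by auto
  qed
  have "derived G (carrier G) \<subseteq> T"
  proof (rule derived_subset[OF sT])
    fix g h assume g: "g \<in> carrier G" and h: "h \<in> carrier G"
    show "commute_mod G T g h"
    proof (rule gen[OF g h])
      fix s assume "s \<in> A \<union> B"
      then show "commute_mod G T g s"
        using commute_mod_sym[OF nT AG g aa[OF _ g]] commute_mod_sym[OF nT BG g bb[OF _ g]] by auto
    qed
  qed
  then show ?thesis using generate_commute[OF SG cS] assms(6,7) unfolding T_def by blast
qed

end

lemma (in comm_group) finite_generate:
  assumes "finite U" "U \<subseteq> carrier G" "\<And>u. u \<in> U \<Longrightarrow> \<exists>n::nat. n > 0 \<and> u [^] n = \<one>"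
  shows "finite (generate G U)"
  using assms
proof (induction U rule: finite_induct)
  case empty
  have "generate G {} \<subseteq> {\<one>}" by (rule generate_subgroup_incl) (auto simp: triv_subgroup)
  then show ?case by (rule finite_subset) simp
next
  case (insert u U)
  have uG: "u \<in> carrier G" and UG: "U \<subseteq> carrier G" using insert by auto
  have su: "subgroup (generate G {u}) G" and sU: "subgroup (generate G U) G"
    using uG UG by (auto intro: generate_is_subgroup)
  have o: "ord u > 0" using insert.prems(2)[of u] ord_pos[OF uG] by auto
  have "finite (generate G {u})" using o generate_pow_card[OF uG] card_gt_0_iff by metis
  moreover have "finite (generate G U)" using insert by simp
  ultimately have "finite (generate G {u} <#> generate G U)" unfolding set_mult_def by simp
  moreover have "generate G (insert u U) \<subseteq> generate G {u} <#> generate G U"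
  proof (rule generate_subgroup_incl[OF _ mult_subgroups[OF su sU]])
    have "u \<in> generate G {u}" "U \<subseteq> generate G U" by (auto intro: generate.incl)
    then show "insert u U \<subseteq> generate G {u} <#> generate G U" using set_mult_supersets[OF su sU] by blast
  qed
  ultimately show ?case by (rule finite_subset[rotated])
qed

context group
begin

text \<open>Schreier's argument. The image of \<open>H\<close> in the abelian periodic quotient is
  finite, so \<open>H\<close> has a finite set \<open>T\<close> of representatives. The finitely
  many Schreier elements \<open>W\<close> and their conjugates under \<open>T\<close> generate a
  finite subgroup \<open>V\<close> of the abelian periodic group \<open>M\<close>, and each element
  of \<open>H\<close> is a product of one from \<open>V\<close> and one from
  \<open>T\<close>.\<close>

lemma finite_generate_metabelian:
  assumes M: "M \<lhd> G" and cM: "\<And>x y. x \<in> M \<Longrightarrow> y \<in> M \<Longrightarrow> x \<otimes> y = y \<otimes> x"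
    and comm: "\<And>g h. g \<in> carrier G \<Longrightarrow> h \<in> carrier G \<Longrightarrow> commute_mod G M g h"
    and per: "\<And>g. g \<in> carrier G \<Longrightarrow> \<exists>n::nat. n > 0 \<and> g [^] n = \<one>"
    and X: "finite X" "X \<subseteq> carrier G"
  shows "finite (generate G X)"
proof -
  interpret M: normal M G by (rule M)
  note sM = M.subgroup_axioms
  note MG = subgroup_mem_carrier[OF sM]
  interpret Q: group "G Mod M" by (rule M.factorgroup_is_group)
  interpret h: group_hom G "G Mod M" "\<lambda>a. M #> a" by unfold_locales (rule M.r_coset_hom_Mod)
  interpret Q: comm_group "G Mod M"
    by (rule Q.group_comm_groupI) (use comm commute_mod_iff_rcos[OF M] in \<open>auto simp: carrier_FactGroup\<close>)
  interpret MM: group "G\<lparr>carrier := M\<rparr>" using sM by (rule subgroup_imp_group)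
  interpret MM: comm_group "G\<lparr>carrier := M\<rparr>" by (rule MM.group_comm_groupI) (use cM in simp)
  define H where "H = generate G X"
  have sH: "subgroup H G" unfolding H_def using X(2) by (rule generate_is_subgroup)
  note HG = subgroup_mem_carrier[OF sH]
  have "finite (generate (G Mod M) ((\<lambda>a. M #> a) ` X))"
  proof (rule Q.finite_generate)
    show "(\<lambda>a. M #> a) ` X \<subseteq> carrier (G Mod M)" using X rcos_in_FactGroup by blast
    fix u assume "u \<in> (\<lambda>a. M #> a) ` X"
    then obtain x where x: "x \<in> carrier G" "u = M #> x" using X by auto
    obtain n :: nat where "n > 0" "x [^] n = \<one>" using per x by blast
    then have "u [^]\<^bsub>G Mod M\<^esub> n = \<one>\<^bsub>G Mod M\<^esub>"
      using x M.FactGroup_pow[OF x(1), of n] subgroup.subset[OF sM] by simp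
    then show "\<exists>n::nat. n > 0 \<and> u [^]\<^bsub>G Mod M\<^esub> n = \<one>\<^bsub>G Mod M\<^esub>" using \<open>n > 0\<close> by blast
  qed (use X in simp)
  then have finQ: "finite ((\<lambda>a. M #> a) ` H)"
    unfolding H_def using h.generate_img[OF X(2)] by simp
  define \<tau> where "\<tau> = (\<lambda>g. SOME t. t \<in> H \<and> M #> t = M #> g)"
  have \<tau>: "\<tau> g \<in> H" "M #> \<tau> g = M #> g" if "g \<in> H" for g
    using someI[of "\<lambda>t. t \<in> H \<and> M #> t = M #> g" g] that unfolding \<tau>_def by auto
  have \<tau>_cong: "\<tau> g = \<tau> g'" if "M #> g = M #> g'" for g g' unfolding \<tau>_def using that by simp
  define T where "T = \<tau> ` H"
  have "T = (\<lambda>c. SOME t. t \<in> H \<and> M #> t = c) ` ((\<lambda>a. M #> a) ` H)"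
    unfolding T_def \<tau>_def by (simp add: image_image)
  then have finT: "finite T" using finQ by simp
  have TH: "T \<subseteq> H" unfolding T_def using \<tau> by auto
  define S where "S = X \<union> m_inv G ` X"
  have finS: "finite S" unfolding S_def using X by simp
  have SH: "S \<subseteq> H" unfolding S_def H_def by (auto intro: generate.incl generate.inv)
  have one: "\<one> \<in> H" by (rule subgroup.one_closed[OF sH])
  note Hm = subgroup.m_closed[OF sH]
  \<comment> \<open>The representative of \<open>M\<close> itself need not be \<open>\<one>\<close>;
    the extra element \<open>inv (\<tau> \<one>)\<close> accounts for this.\<close>
  define W where "W = insert (inv (\<tau> \<one>)) ((\<lambda>(t, s). t \<otimes> s \<otimes> inv (\<tau> (t \<otimes> s))) ` (T \<times> S))"
  have \<tau>M: "g \<otimes> inv (\<tau> g) \<in> M" if "g \<in> H" for g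
    using rcos_eq_iff[OF sM, of g "\<tau> g"] \<tau>[OF that] HG that by auto
  have WM: "W \<subseteq> M"
  proof -
    have "t \<otimes> s \<otimes> inv (\<tau> (t \<otimes> s)) \<in> M" if "t \<in> T" "s \<in> S" for t s
      using \<tau>M[OF Hm] that TH SH by blast
    moreover have "inv (\<tau> \<one>) \<in> M" using \<tau>M[OF one] HG[OF \<tau>(1)[OF one]] by simp
    ultimately show ?thesis unfolding W_def by auto
  qed
  have finW: "finite W" unfolding W_def using finT finS by simp
  define U where "U = (\<lambda>(t, w). t \<otimes> w \<otimes> inv t) ` (T \<times> W)"
  have finU: "finite U" unfolding U_def using finT finW by simp
  have UM: "U \<subseteq> M" unfolding U_def
    using normal_conj_closed(1)[OF M HG[OF subsetD[OF TH]] subsetD[OF WM]] by auto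
  have conjW: "h \<otimes> w \<otimes> inv h \<in> U" if h: "h \<in> H" and w: "w \<in> W" for h w
  proof -
    define m where "m = h \<otimes> inv (\<tau> h)"
    have m: "m \<in> M" unfolding m_def by (rule \<tau>M[OF h])
    have G: "h \<in> carrier G" "\<tau> h \<in> carrier G" "w \<in> carrier G" "m \<in> carrier G"
      using h HG \<tau>(1) w WM MG m by auto
    have "h = m \<otimes> \<tau> h" unfolding m_def using G by (simp add: m_assoc)
    then have "h \<otimes> w \<otimes> inv h = m \<otimes> (\<tau> h \<otimes> w \<otimes> inv (\<tau> h)) \<otimes> inv m"
      using G by (metis (no_types, lifting) inv_mult_group m_assoc m_closed inv_closed)
    also have "\<dots> = \<tau> h \<otimes> w \<otimes> inv (\<tau> h)"
    proof -
      have n: "\<tau> h \<otimes> w \<otimes> inv (\<tau> h) \<in> M" using normal_conj_closed(1)[OF M G(2)] w WM by blast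
      show ?thesis using cM[OF m n] MG[OF n] G by (simp add: m_assoc)
    qed
    finally show ?thesis unfolding U_def T_def using h w by (auto intro!: image_eqI[of _ _ "(\<tau> h, w)"])
  qed
  have WU: "W \<subseteq> U"
  proof
    fix w assume w: "w \<in> W"
    have "\<one> \<otimes> w \<otimes> inv \<one> \<in> U" by (rule conjW[OF one w])
    then show "w \<in> U" using w WM MG by auto
  qed
  define V where "V = generate G U"
  have "finite (generate (G\<lparr>carrier := M\<rparr>) U)"
  proof (rule MM.finite_generate[OF finU])
    show "U \<subseteq> carrier (G\<lparr>carrier := M\<rparr>)" using UM by simp
    show "\<exists>n::nat. n > 0 \<and> u [^]\<^bsub>G\<lparr>carrier := M\<rparr>\<^esub> n = \<one>\<^bsub>G\<lparr>carrier := M\<rparr>\<^esub>" if "u \<in> U" for u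
      using per[of u] that UM MG by (auto simp flip: nat_pow_consistent)
  qed
  then have finV: "finite V" unfolding V_def using generate_consistent[OF UM sM] by simp
  have UG: "U \<subseteq> carrier G" using UM MG by blast
  have sV: "subgroup V G" unfolding V_def by (rule generate_is_subgroup[OF UG])
  define Y where "Y = {g \<in> H. g \<otimes> inv (\<tau> g) \<in> V}"
  \<comment> \<open>The product is split at the representative \<open>t\<close> of \<open>g\<close>:
    \<open>g \<otimes> inv t\<close> is in \<open>V\<close> by assumption, and the rest is a
    Schreier element.\<close>
  have step: "g \<otimes> s \<in> Y" if g: "g \<in> Y" and s: "s \<in> S" for g s
  proof -
    have gH: "g \<in> H" and gV: "g \<otimes> inv (\<tau> g) \<in> V" using g unfolding Y_def by auto
    define t where "t = \<tau> g"
    have t: "t \<in> T" "t \<in> H" "M #> t = M #> g" unfolding t_def T_def using gH \<tau> by auto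
    have sH': "s \<in> H" using s SH by blast
    have G: "g \<in> carrier G" "t \<in> carrier G" "s \<in> carrier G" using gH t sH' HG by auto
    have "M #> (t \<otimes> s) = M #> (g \<otimes> s)"
      using t(3) M.rcos_sum[OF G(2,3)] M.rcos_sum[OF G(1,3)] by simp
    then have e: "\<tau> (g \<otimes> s) = \<tau> (t \<otimes> s)" by (intro \<tau>_cong) simp
    have "t \<otimes> s \<otimes> inv (\<tau> (t \<otimes> s)) \<in> W" unfolding W_def using t s by auto
    then have "t \<otimes> s \<otimes> inv (\<tau> (t \<otimes> s)) \<in> V" unfolding V_def using WU by (auto intro: generate.incl)
    then have "(g \<otimes> inv t) \<otimes> (t \<otimes> s \<otimes> inv (\<tau> (t \<otimes> s))) \<in> V"
      using gV subgroup.m_closed[OF sV] unfolding t_def by blast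
    moreover have "\<tau> (t \<otimes> s) \<in> carrier G" using \<tau>(1)[OF Hm[OF t(2) sH']] HG by blast
    ultimately have "g \<otimes> s \<otimes> inv (\<tau> (g \<otimes> s)) \<in> V" unfolding e using G by (simp add: m_assoc)
    then show ?thesis unfolding Y_def using Hm[OF gH sH'] by simp
  qed
  have "\<one> \<in> Y"
  proof -
    have "inv (\<tau> \<one>) \<in> V" unfolding V_def using WU by (auto simp: W_def intro: generate.incl)
    then show ?thesis unfolding Y_def using one HG[OF \<tau>(1)[OF one]] by simp
  qed
  have YG: "Y \<subseteq> carrier G" unfolding Y_def using HG by auto
  have "\<forall>g\<in>Y. g \<otimes> h \<in> Y" if "h \<in> generate G X" for h
    using that
  proof (induction h rule: generate.induct)
    case one then show ?case using YG by auto
  next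
    case (incl h) then show ?case using step unfolding S_def by auto
  next
    case (inv h) then show ?case using step unfolding S_def by auto
  next
    case (eng h1 h2)
    have "h1 \<in> carrier G" "h2 \<in> carrier G" using eng generate_in_carrier[OF X(2)] by auto
    then show ?case using eng YG by (auto simp flip: m_assoc)
  qed
  then have "\<one> \<otimes> h \<in> Y" if "h \<in> H" for h using that \<open>\<one> \<in> Y\<close> unfolding H_def by blast
  then have HY: "H \<subseteq> Y" using HG by auto
  have "H \<subseteq> (\<lambda>(v, t). v \<otimes> t) ` (V \<times> T)"
  proof
    fix h assume h: "h \<in> H"
    then have "h \<otimes> inv (\<tau> h) \<in> V" "\<tau> h \<in> T" using HY unfolding Y_def T_def by auto
    moreover have "h = h \<otimes> inv (\<tau> h) \<otimes> \<tau> h" using h HG \<tau>(1)[OF h] by (simp add: m_assoc)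
    ultimately show "h \<in> (\<lambda>(v, t). v \<otimes> t) ` (V \<times> T)" by force
  qed
  then have "finite H" by (rule finite_subset) (use finV finT in simp)
  then show ?thesis unfolding H_def .
qed

end

section \<open>\<open>p\<close>-elements of a product of abelian groups\<close>

definition p_elements :: "('a, 'b) monoid_scheme \<Rightarrow> nat \<Rightarrow> 'a set" where
  "p_elements G p = {g \<in> carrier G. \<exists>k. g [^]\<^bsub>G\<^esub> (p ^ k) = \<one>\<^bsub>G\<^esub>}"

context group
begin

lemma nat_pow_one_mult:
  assumes "x \<in> carrier G" "x [^] (m::nat) = \<one>"
  shows "x [^] (m * n) = \<one>"
  using assms by (simp flip: nat_pow_pow)

text \<open>Bezout for the two coprime parts of an exponent \<open>N\<close> of \<open>a\<close>:
  \<open>n s - p^k t = 1\<close> splits \<open>a\<close> into powers of itself.\<close>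

lemma prime_part_decomposition:
  fixes p :: nat
  assumes A: "subgroup A G" and a: "a \<in> A" and p: "prime p" and per: "\<exists>n::nat. n > 0 \<and> a [^] n = \<one>"
  shows "\<exists>u\<in>A. \<exists>v\<in>A. \<exists>k n. a = u \<otimes> v \<and> a = v \<otimes> u \<and> u [^] (p ^ k) = \<one> \<and> v [^] (n::nat) = \<one> \<and> n > 0 \<and> \<not> p dvd n"
proof -
  note AG = subgroup_mem_carrier[OF A]
  obtain N :: nat where N: "N > 0" "a [^] N = \<one>" using per by blast
  have "\<not> is_unit p" using p not_prime_unit by blast
  then obtain n where n: "N = p ^ multiplicity p N * n" "\<not> p dvd n"
    using N(1) multiplicity_decompose'[of N p] by (metis less_numeral_extra(3))
  define k where "k = multiplicity p N"
  have n0: "n > 0" using n N by (metis gr0I mult_0_right less_numeral_extra(3))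
  have "coprime n (p ^ k)" using prime_imp_coprime[OF p n(2)] by (simp add: coprime_commute)
  then obtain s t where st: "n * s = p ^ k * t + 1"
    using bezout_nat[of n "p ^ k"] n0 by (auto simp: coprime_iff_gcd_eq_1)
  define u v where "u = a [^] (n * s)" and "v = inv (a [^] (p ^ k * t))"
  have aG: "a \<in> carrier G" using a AG by blast
  have uv: "u \<in> A" "v \<in> A" unfolding u_def v_def
    using subgroup_nat_pow_closed[OF A a] subgroup.m_inv_closed[OF A] by auto
  have e: "u = a [^] (p ^ k * t) \<otimes> a" unfolding u_def st by simp
  have e': "u = a \<otimes> a [^] (p ^ k * t)" unfolding e using nat_pow_Suc2[OF aG] by simp
  have auv: "a = u \<otimes> v" unfolding e' v_def using aG by (simp add: m_assoc)
  have avu: "a = v \<otimes> u" unfolding e v_def using aG by simp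
  have "a [^] (n * p ^ k) = \<one>" using N(2) n(1) unfolding k_def by (simp add: mult.commute)
  then have "a [^] ((n * p ^ k) * s) = \<one>" "a [^] ((n * p ^ k) * t) = \<one>"
    using nat_pow_one_mult[OF aG] by blast+
  moreover have ee: "n * s * p ^ k = (n * p ^ k) * s" "p ^ k * t * n = (n * p ^ k) * t" by (simp_all only: ac_simps)
  ultimately have "u [^] (p ^ k) = \<one>" "(a [^] (p ^ k * t)) [^] n = \<one>"
    unfolding u_def nat_pow_pow[OF aG] ee by blast+
  moreover from this(2) have "v [^] n = \<one>" unfolding v_def using aG by (simp add: nat_pow_inv)
  ultimately show ?thesis using auv avu uv n0 n(2) by blast
qed

text \<open>As \<open>M\<close> consists of \<open>p\<close>-elements, an element is a
  \<open>p\<close>-element as soon as some \<open>p ^ k\<close>-th power lies in \<open>M\<close>;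
  in the abelian quotient this condition is closed under products.\<close>

lemma p_elements_subgroup:
  assumes M: "M \<lhd> G" and comm: "\<And>g h. g \<in> carrier G \<Longrightarrow> h \<in> carrier G \<Longrightarrow> commute_mod G M g h"
    and Mp: "M \<subseteq> p_elements G p"
  shows "subgroup (p_elements G p) G"
proof -
  have sM: "subgroup M G" using M by (rule normal_imp_subgroup)
  have up: "x [^] (p ^ (k + l)) \<in> M" if "x \<in> carrier G" "x [^] (p ^ k) \<in> M" for x and k l :: nat
    using subgroup_nat_pow_closed[OF sM that(2), of "p ^ l"] that(1) by (simp add: nat_pow_pow power_add)
  have iff: "x \<in> p_elements G p \<longleftrightarrow> (\<exists>k::nat. x [^] (p ^ k) \<in> M)" if x: "x \<in> carrier G" for x
  proof
    assume "x \<in> p_elements G p"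
    then obtain k where "x [^] (p ^ k) = \<one>" unfolding p_elements_def by blast
    then have "x [^] (p ^ k) \<in> M" using subgroup.one_closed[OF sM] by simp
    then show "\<exists>k::nat. x [^] (p ^ k) \<in> M" ..
  next
    assume "\<exists>k::nat. x [^] (p ^ k) \<in> M"
    then obtain k l :: nat where "(x [^] (p ^ k)) [^] (p ^ l) = \<one>" using Mp unfolding p_elements_def by blast
    then have "x [^] (p ^ (k + l)) = \<one>" using x by (simp add: nat_pow_pow power_add)
    then show "x \<in> p_elements G p" unfolding p_elements_def using x by blast
  qed
  show ?thesis
  proof (rule subgroupI)
    show "p_elements G p \<subseteq> carrier G" unfolding p_elements_def by auto
    show "p_elements G p \<noteq> {}" unfolding p_elements_def by (auto intro!: exI[of _ \<one>])
    fix a assume a: "a \<in> p_elements G p"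
    then show "inv a \<in> p_elements G p" unfolding p_elements_def by (auto simp: nat_pow_inv)
    fix b assume b: "b \<in> p_elements G p"
    have G: "a \<in> carrier G" "b \<in> carrier G" using a b unfolding p_elements_def by auto
    obtain k l :: nat where "a [^] (p ^ k) \<in> M" "b [^] (p ^ l) \<in> M" using a b iff G by blast
    then have "a [^] (p ^ (k + l)) \<in> M" "b [^] (p ^ (k + l)) \<in> M"
      using up[OF G(1), of k l] up[OF G(2), of l k] by (simp_all add: add.commute)
    then have "(a \<otimes> b) [^] (p ^ (k + l)) \<in> M"
      using nat_pow_mult_mem_iff[OF M G comm[OF G]] subgroup.m_closed[OF sM] by blast
    then show "a \<otimes> b \<in> p_elements G p" using iff G by blast
  qed
qed

text \<open>The two cyclic groups generated by \<open>x\<close> and \<open>y\<close> are complements of order prime to \<open>p\<close> of the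
  same \<open>p\<close>-group, hence conjugate; the conjugating element is the average of the cocycle \<open>x\<^sup>i y\<^sup>-\<^sup>i\<close>.
  As \<open>A\<close> and \<open>B\<close> are abelian, an element of \<open>A\<close> conjugate in \<open>G = A B\<close> to an element of \<open>B\<close> equals it.\<close>

lemma coprime_cocycle_trivial:
  fixes p :: nat
  assumes M: "M \<lhd> G" and cM: "\<And>x y. x \<in> M \<Longrightarrow> y \<in> M \<Longrightarrow> x \<otimes> y = y \<otimes> x" and Mp: "M \<subseteq> p_elements G p"
    and A: "subgroup A G" and B: "subgroup B G" and AB: "carrier G = A <#> B"
    and cA: "\<And>x y. x \<in> A \<Longrightarrow> y \<in> A \<Longrightarrow> x \<otimes> y = y \<otimes> x"
    and cB: "\<And>x y. x \<in> B \<Longrightarrow> y \<in> B \<Longrightarrow> x \<otimes> y = y \<otimes> x"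
    and p: "prime p" and x: "x \<in> A" "x [^] (n::nat) = \<one>" and y: "y \<in> B" "y [^] n = \<one>" and n: "n > 0" "\<not> p dvd n"
    and z: "x \<otimes> inv y \<in> M"
  shows "x = y"
proof -
  interpret M: normal M G by (rule M)
  note sM = M.subgroup_axioms
  note MG = subgroup_mem_carrier[OF sM]
  have G: "x \<in> carrier G" "y \<in> carrier G" using x y subgroup_mem_carrier A B by blast+
  define z where "z = x \<otimes> inv y"
  have zM: "z \<in> M" and zG: "z \<in> carrier G" unfolding z_def using assms(16) MG by blast+
  define w where "w = (\<lambda>i::nat. x [^] i \<otimes> inv (y [^] i))"
  have wM: "w i \<in> M" for i
  proof -
    have "M #> x = M #> y" using rcos_eq_iff[OF sM G] zM z_def by simp
    then have "M #> x [^] i = M #> y [^] i" using M.FactGroup_pow[OF G(1), of i] M.FactGroup_pow[OF G(2), of i] by simp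
    then show ?thesis unfolding w_def using rcos_eq_iff[OF sM] G by simp
  qed
  note wG = MG[OF wM]
  have xw: "x \<otimes> w i \<otimes> inv x = w (Suc i) \<otimes> inv z" for i
  proof -
    have e: "x [^] Suc i = x \<otimes> x [^] i" "y [^] Suc i = y \<otimes> y [^] i"
      using nat_pow_Suc2 G by blast+
    show ?thesis unfolding w_def z_def e using G by (simp add: m_assoc inv_mult_group)
  qed
  \<comment> \<open>The product of the first \<open>i\<close> cocycle values. For
    \<open>i = n\<close> conjugation by \<open>x\<close> shifts the factors cyclically, since
    \<open>w n\<close> and \<open>w 0\<close> are both \<open>\<one>\<close>, at the cost of one
    \<open>inv z\<close> for each factor.\<close>
  define V where "V = rec_nat \<one> (\<lambda>i v. v \<otimes> w i)"
  have V: "V 0 = \<one>" "V (Suc i) = V i \<otimes> w i" for i unfolding V_def by simp_all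
  have VM: "V i \<in> M" for i by (induction i) (simp_all add: V wM)
  note VG = MG[OF VM]
  have xV: "x \<otimes> V i \<otimes> inv x = V i \<otimes> w i \<otimes> inv (z [^] i)" for i
  proof (induction i)
    case 0 then show ?case unfolding w_def V using G by simp
  next
    case (Suc i)
    have iz: "inv (z [^] i) \<in> M" using subgroup_nat_pow_closed[OF sM zM] by simp
    have "x \<otimes> V (Suc i) \<otimes> inv x = (x \<otimes> V i \<otimes> inv x) \<otimes> (x \<otimes> w i \<otimes> inv x)"
      unfolding V(2) using G VG wG by (simp add: m_assoc)
    also have "\<dots> = V i \<otimes> w i \<otimes> (inv (z [^] i) \<otimes> w (Suc i)) \<otimes> inv z"
      unfolding Suc xw using zG VG wG by (simp add: m_assoc)
    also have "inv (z [^] i) \<otimes> w (Suc i) = w (Suc i) \<otimes> inv (z [^] i)" by (rule cM[OF iz wM])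
    also have "V i \<otimes> w i \<otimes> (w (Suc i) \<otimes> inv (z [^] i)) \<otimes> inv z = V (Suc i) \<otimes> w (Suc i) \<otimes> (inv (z [^] i) \<otimes> inv z)"
      unfolding V(2) using zG VG wG by (simp add: m_assoc)
    also have "inv (z [^] i) \<otimes> inv z = inv (z [^] Suc i)"
      using zG nat_pow_Suc2[OF zG, of i] by (simp add: inv_mult_group)
    finally show ?case .
  qed
  obtain k where k: "z [^] (p ^ k) = \<one>" using Mp zM unfolding p_elements_def by blast
  have "coprime n (p ^ k)" using prime_imp_coprime[OF p n(2)] by (simp add: coprime_commute)
  \<comment> \<open>\<open>l\<close> inverts \<open>n\<close> modulo the order of \<open>z\<close>.
    Raising \<open>V n\<close> to the power \<open>l\<close> therefore averages and leaves exactly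
    one \<open>inv z\<close>.\<close>
  then obtain l t where lt: "n * l = p ^ k * t + 1"
    using bezout_nat[of n "p ^ k"] n by (auto simp: coprime_iff_gcd_eq_1)
  define u where "u = V n [^] l"
  have uG: "u \<in> carrier G" unfolding u_def using VG by simp
  have "w n = \<one>" unfolding w_def using x y by simp
  then have "x \<otimes> V n \<otimes> inv x = V n \<otimes> inv (z [^] n)" using xV[of n] VG zG by simp
  then have "x \<otimes> u \<otimes> inv x = (V n \<otimes> inv (z [^] n)) [^] l"
    unfolding u_def using conj_nat_pow[OF G(1) VG] by simp
  also have "\<dots> = u \<otimes> inv (z [^] n) [^] l" unfolding u_def
  proof (rule pow_mult_distrib)
    show "V n \<otimes> inv (z [^] n) = inv (z [^] n) \<otimes> V n"
      using cM[OF VM, of "inv (z [^] n)"] subgroup_nat_pow_closed[OF sM zM] by simp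
  qed (use VG zG in simp_all)
  also have "inv (z [^] n) [^] l = inv z"
  proof -
    have "(z [^] n) [^] l = (z [^] (p ^ k)) [^] t \<otimes> z" using zG lt by (simp add: nat_pow_pow)
    then show ?thesis using zG k by (simp add: nat_pow_inv)
  qed
  finally have "x \<otimes> u \<otimes> inv x = u \<otimes> inv z" .
  then have "inv u \<otimes> (x \<otimes> u \<otimes> inv x) \<otimes> x = inv u \<otimes> (u \<otimes> inv z) \<otimes> x" by simp
  then have yu: "inv u \<otimes> x \<otimes> u = y" unfolding z_def using G uG by (simp add: m_assoc inv_mult_group)
  have "u \<in> A <#> B" using uG AB by simp
  then obtain a b where ab: "a \<in> A" "b \<in> B" "u = a \<otimes> b" by (rule set_mult_memE)
  have abG: "a \<in> carrier G" "b \<in> carrier G" using ab subgroup_mem_carrier A B by blast+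
  have "inv a \<otimes> x \<otimes> a = x" using cA[OF x(1) ab(1)] abG G by (simp add: m_assoc)
  moreover have "inv u \<otimes> x \<otimes> u = inv b \<otimes> (inv a \<otimes> x \<otimes> a) \<otimes> b"
    unfolding ab(3) using abG G by (simp add: m_assoc inv_mult_group)
  ultimately have "y = inv b \<otimes> x \<otimes> b" using yu by simp
  then have "b \<otimes> y \<otimes> inv b = x" using abG G by (simp add: m_assoc)
  moreover have "b \<otimes> y \<otimes> inv b = y" using cB[OF ab(2) y(1)] abG G by (simp add: m_assoc)
  ultimately show ?thesis by simp
qed

text \<open>Split \<open>a\<close> and \<open>b\<close> into their \<open>p\<close>-parts and
  prime-to-\<open>p\<close> parts. The middle factor \<open>z = x \<otimes> y\<close> is a
  \<open>p\<close>-element whose order modulo \<open>M\<close> is prime to \<open>p\<close>, so it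
  lies in \<open>M\<close>, and \<open>coprime_cocycle_trivial\<close> makes it vanish.\<close>

lemma p_elements_product:
  fixes p :: nat
  assumes M: "M \<lhd> G" and cM: "\<And>x y. x \<in> M \<Longrightarrow> y \<in> M \<Longrightarrow> x \<otimes> y = y \<otimes> x" and Mp: "M \<subseteq> p_elements G p"
    and comm: "\<And>g h. g \<in> carrier G \<Longrightarrow> h \<in> carrier G \<Longrightarrow> commute_mod G M g h"
    and per: "\<And>g. g \<in> carrier G \<Longrightarrow> \<exists>n::nat. n > 0 \<and> g [^] n = \<one>"
    and A: "subgroup A G" and B: "subgroup B G" and AB: "carrier G = A <#> B"
    and cA: "\<And>x y. x \<in> A \<Longrightarrow> y \<in> A \<Longrightarrow> x \<otimes> y = y \<otimes> x"
    and cB: "\<And>x y. x \<in> B \<Longrightarrow> y \<in> B \<Longrightarrow> x \<otimes> y = y \<otimes> x"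
    and p: "prime p"
  shows "p_elements G p = (A \<inter> p_elements G p) <#> (B \<inter> p_elements G p)"
proof
  have sP: "subgroup (p_elements G p) G" by (rule p_elements_subgroup[OF M comm Mp])
  show "(A \<inter> p_elements G p) <#> (B \<inter> p_elements G p) \<subseteq> p_elements G p"
    unfolding set_mult_def using subgroup.m_closed[OF sP] by auto
  show "p_elements G p \<subseteq> (A \<inter> p_elements G p) <#> (B \<inter> p_elements G p)"
  proof
    fix g assume g: "g \<in> p_elements G p"
    have gG: "g \<in> carrier G" using g unfolding p_elements_def by auto
    then have "g \<in> A <#> B" using AB by simp
    then obtain a b where ab: "a \<in> A" "b \<in> B" "g = a \<otimes> b" by (rule set_mult_memE)
    have abG: "a \<in> carrier G" "b \<in> carrier G" using ab subgroup_mem_carrier A B by blast+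
    obtain a1 x k n1 where a: "a1 \<in> A" "x \<in> A" "a = a1 \<otimes> x" "a1 [^] (p ^ k) = \<one>" "x [^] (n1::nat) = \<one>" "n1 > 0" "\<not> p dvd n1"
      using prime_part_decomposition[OF A ab(1) p per[OF abG(1)]] by blast
    obtain b1 y k' n2 where b: "b1 \<in> B" "y \<in> B" "b = y \<otimes> b1" "b1 [^] (p ^ k') = \<one>" "y [^] (n2::nat) = \<one>" "n2 > 0" "\<not> p dvd n2"
      using prime_part_decomposition[OF B ab(2) p per[OF abG(2)]] by blast
    have G: "a1 \<in> carrier G" "x \<in> carrier G" "b1 \<in> carrier G" "y \<in> carrier G"
      using a b subgroup_mem_carrier A B by blast+
    have P: "a1 \<in> p_elements G p" "b1 \<in> p_elements G p" unfolding p_elements_def using a b G by auto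
    define n where "n = n1 * n2"
    have n: "n > 0" "\<not> p dvd n" unfolding n_def using a b p by (auto simp: prime_dvd_mult_iff)
    have xn: "x [^] n = \<one>" "y [^] n = \<one>"
      unfolding n_def using nat_pow_one_mult[OF G(2) a(5)] nat_pow_one_mult[OF G(4) b(5)]
      by (simp_all add: mult.commute[of n1])
    define z where "z = x \<otimes> y"
    have "z = inv a1 \<otimes> g \<otimes> inv b1" unfolding z_def ab(3) a(3) b(3) using G by (simp add: m_assoc)
    then have zP: "z \<in> p_elements G p"
      using P g subgroup.m_closed[OF sP] subgroup.m_inv_closed[OF sP] by simp
    have sM: "subgroup M G" using M by (rule normal_imp_subgroup)
    have zM: "z \<in> M"
    proof -
      obtain j where j: "z [^] (p ^ j) = \<one>" using zP unfolding p_elements_def by blast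
      have zG: "z \<in> carrier G" unfolding z_def using G by simp
      have "z [^] n \<in> M"
        unfolding z_def using nat_pow_mult_mem_iff[OF M G(2,4) comm[OF G(2,4)]] xn subgroup.one_closed[OF sM] by simp
      moreover have "z [^] (p ^ j) \<in> M" using j subgroup.one_closed[OF sM] by simp
      moreover have "coprime n (p ^ j)" using prime_imp_coprime[OF p n(2)] by (simp add: coprime_commute)
      ultimately show ?thesis using coprime_nat_pow_mem[OF sM zG] by blast
    qed
    have "x = inv y"
      by (rule coprime_cocycle_trivial[OF M cM Mp A B AB cA cB p a(2) xn(1) _ _ n])
        (use zM z_def b(2) xn G subgroup.m_inv_closed[OF B] in \<open>auto simp: nat_pow_inv\<close>)
    then have "g = a1 \<otimes> b1" unfolding ab(3) a(3) b(3) using G by (simp add: m_assoc)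
    then show "g \<in> (A \<inter> p_elements G p) <#> (B \<inter> p_elements G p)"
      using a b P by (auto intro!: set_mult_memI)
  qed
qed

end

section \<open>Products of locally cyclic \<open>p\<close>-groups\<close>

text \<open>Local cyclicity for two elements, expressed with subgroups generated in the ambient
  group. In this form it passes to homomorphic images and to \<open>p\<close>-parts.\<close>

definition pairwise_cyclic :: "('a, 'b) monoid_scheme \<Rightarrow> 'a set \<Rightarrow> bool" where
  "pairwise_cyclic G A \<longleftrightarrow> (\<forall>x\<in>A. \<forall>y\<in>A. \<exists>z\<in>A. x \<in> generate G {z} \<and> y \<in> generate G {z})"

context group
begin

lemma pairwise_cyclic_commute:
  assumes "subgroup A G" "pairwise_cyclic G A" "x \<in> A" "y \<in> A"
  shows "x \<otimes> y = y \<otimes> x"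
proof -
  obtain z where z: "z \<in> A" "x \<in> generate G {z}" "y \<in> generate G {z}"
    using assms unfolding pairwise_cyclic_def by blast
  have "z \<in> carrier G" using z assms(1) subgroup_mem_carrier by blast
  then show ?thesis using generate_commute[of "{z}" x y] z by auto
qed

lemma order_p_power:
  fixes p :: nat
  assumes fin: "finite (carrier G)" and p: "prime p" and el: "carrier G \<subseteq> p_elements G p"
  shows "\<exists>n. order G = p ^ n"
proof -
  have o0: "order G \<noteq> 0" using fin order_gt_0_iff_finite by simp
  have "q = p" if q: "prime q" "q dvd order G" for q
  proof (rule ccontr)
    assume "q \<noteq> p"
    obtain r where r: "order G = q ^ 1 * r" using q(2) by auto
    obtain S where S: "subgroup S G" "card S = q ^ 1" using sylow_thm[OF q(1) group_axioms r fin] by blast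
    have "card S \<noteq> 1" using S(2) q(1) not_prime_1 by auto
    then obtain s where s: "s \<in> S" "s \<noteq> \<one>"
      using subgroup.one_closed[OF S(1)] by (metis is_singletonI' is_singleton_altdef empty_iff)
    have sG: "s \<in> carrier G" using s S subgroup_mem_carrier by blast
    interpret S: group "G\<lparr>carrier := S\<rparr>" using S(1) by (rule subgroup_imp_group)
    have "s [^]\<^bsub>G\<lparr>carrier := S\<rparr>\<^esub> order (G\<lparr>carrier := S\<rparr>) = \<one>\<^bsub>G\<lparr>carrier := S\<rparr>\<^esub>"
      by (rule S.pow_order_eq_1) (use s in simp)
    then have "s [^] q = \<one>" using S(2) by (simp add: order_def flip: nat_pow_consistent)
    moreover obtain k where "s [^] (p ^ k) = \<one>" using el sG unfolding p_elements_def by blast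
    moreover have "coprime q (p ^ k)" using q p \<open>q \<noteq> p\<close> by (simp add: primes_coprime)
    ultimately have "s \<in> {\<one>}" by (intro coprime_nat_pow_mem[OF triv_subgroup sG, of q "p ^ k"]) simp_all
    then show False using s by simp
  qed
  moreover have "\<not> is_unit p" using p not_prime_unit by blast
  then obtain r where r: "order G = p ^ multiplicity p (order G) * r" "\<not> p dvd r"
    using o0 multiplicity_decompose'[of "order G" p] by metis
  ultimately have "r = 1" using prime_factor_nat[of r] by (metis dvd_mult)
  then show ?thesis using r(1) by auto
qed

end

locale p_element_group = group G for G (structure) +
  fixes p :: nat
  assumes prime: "prime p" and p_el: "\<And>g. g \<in> carrier G \<Longrightarrow> \<exists>k. g [^] (p ^ k) = \<one>"
begin

lemma ord_gt_0: "g \<in> carrier G \<Longrightarrow> ord g > 0"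
  using p_el prime prime_gt_0_nat ord_pos by (metis zero_less_power)

lemma finite_cyclic: "g \<in> carrier G \<Longrightarrow> finite (generate G {g})"
  using ord_gt_0 generate_pow_card card_gt_0_iff by metis

lemma finite_subgroup_order:
  assumes "subgroup K G" "finite K"
  shows "\<exists>n. card K = p ^ n"
proof -
  interpret K: group "G\<lparr>carrier := K\<rparr>" using assms(1) by (rule subgroup_imp_group)
  have "carrier (G\<lparr>carrier := K\<rparr>) \<subseteq> p_elements (G\<lparr>carrier := K\<rparr>) p"
    using p_el subgroup_mem_carrier[OF assms(1)] unfolding p_elements_def
    by (auto simp flip: nat_pow_consistent)
  then show ?thesis using K.order_p_power[OF _ prime] assms(2) unfolding order_def by simp
qed

lemma pairwise_cyclic_chain:
  assumes A: "subgroup A G" "pairwise_cyclic G A" and "u \<in> A" "v \<in> A"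
  shows "u \<in> generate G {v} \<or> v \<in> generate G {u}"
proof -
  obtain z where z: "z \<in> A" "u \<in> generate G {z}" "v \<in> generate G {z}"
    using assms unfolding pairwise_cyclic_def by blast
  have zG: "z \<in> carrier G" using z A subgroup_mem_carrier by blast
  obtain i j :: nat where "u = z [^] i" "v = z [^] j"
    using z generate_singleton_nat[OF zG ord_gt_0[OF zG]] by blast
  moreover obtain k where "z [^] (p ^ k) = \<one>" using p_el[OF zG] by blast
  ultimately show ?thesis
    using p_power_chain[OF zG prime, of k i j] generate_nat_pow[of "z [^] i"] generate_nat_pow[of "z [^] j"] zG by auto
qed

lemma finite_subset_cyclic:
  assumes A: "subgroup A G" "pairwise_cyclic G A" and F: "finite F" "F \<subseteq> A"
  shows "\<exists>z\<in>A. F \<subseteq> generate G {z}"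
proof -
  have "\<exists>z\<in>insert \<one> F. insert \<one> F \<subseteq> generate G {z}"
  proof (rule finite_chain_generator)
    have 1: "insert \<one> F \<subseteq> A" using F subgroup.one_closed[OF A(1)] by simp
    then show "insert \<one> F \<subseteq> carrier G" using subgroup.subset[OF A(1)] by blast
    show "u \<in> generate G {v} \<or> v \<in> generate G {u}" if "u \<in> insert \<one> F" "v \<in> insert \<one> F" for u v
      using pairwise_cyclic_chain[OF A] 1 that by blast
  qed (use F in auto)
  then show ?thesis using F subgroup.one_closed[OF A(1)] by blast
qed

text \<open>Cyclic subgroups of \<open>A\<close> are comparable, so all of \<open>U\<close> lies in
  the finite group generated by any \<open>x\<close> outside \<open>U\<close>.\<close>

lemma proper_subgroup_finite:
  assumes A: "subgroup A G" "pairwise_cyclic G A" and U: "subgroup U G" "U \<subset> A"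
  shows "finite U"
proof -
  obtain x where x: "x \<in> A" "x \<notin> U" using U by blast
  have "U \<subseteq> generate G {x}"
  proof
    fix u assume u: "u \<in> U"
    have "\<not> x \<in> generate G {u}" using generate_singleton_subset[OF U(1) u] x by blast
    then show "u \<in> generate G {x}" using pairwise_cyclic_chain[OF A, of u x] u U x by blast
  qed
  then show ?thesis using finite_cyclic x A subgroup_mem_carrier finite_subset by metis
qed

text \<open>In effect, a Pruefer group has no proper subgroup of finite index; the index is bounded by the size of
  the image of \<open>f\<close>.\<close>

lemma infinite_fibre:
  assumes A: "subgroup A G" "pairwise_cyclic G A" "infinite A" and T: "subgroup T G" "T \<subseteq> A"
    and fin: "finite (f ` A)"
    and fib: "\<And>a b. a \<in> A \<Longrightarrow> b \<in> A \<Longrightarrow> f a = f b \<Longrightarrow> a \<otimes> inv b \<in> T"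
  shows "T = A"
proof (rule ccontr)
  assume "T \<noteq> A"
  then have finT: "finite T" using proper_subgroup_finite[OF A(1,2) T(1)] T(2) by blast
  obtain a0 where a0: "a0 \<in> A" "infinite {a \<in> A. f a = f a0}"
    using pigeonhole_infinite[OF A(3) fin] by blast
  have "inj_on (\<lambda>a. a \<otimes> inv a0) {a \<in> A. f a = f a0}"
    using subgroup_mem_carrier[OF A(1)] a0(1) by (intro inj_onI) simp
  moreover have "(\<lambda>a. a \<otimes> inv a0) ` {a \<in> A. f a = f a0} \<subseteq> T" using fib a0(1) by auto
  ultimately show False using a0(2) finite_imageD finite_subset[OF _ finT] by blast
qed

text \<open>The elements of \<open>A\<close> that \<open>g\<close> conjugates into \<open>A\<close>
  form a subgroup whose cosets are separated by the finite set \<open>Y\<close>; by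
  \<open>infinite_fibre\<close> it is all of \<open>A\<close>.\<close>

lemma normalizes_of_finite_index:
  assumes A: "subgroup A G" "pairwise_cyclic G A" "infinite A" and g: "g \<in> carrier G"
    and Fin: "finite Y" "Y \<subseteq> carrier G" and sub: "\<And>a. a \<in> A \<Longrightarrow> g \<otimes> a \<otimes> inv g \<in> A <#> Y"
    and a: "a \<in> A"
  shows "g \<otimes> a \<otimes> inv g \<in> A"
proof -
  note AG = subgroup_mem_carrier[OF A(1)]
  define T where "T = {a \<in> A. g \<otimes> a \<otimes> inv g \<in> A}"
  have "\<forall>a\<in>A. \<exists>y\<in>Y. g \<otimes> a \<otimes> inv g \<otimes> inv y \<in> A"
  proof
    fix a assume a: "a \<in> A"
    obtain a' y where ay: "a' \<in> A" "y \<in> Y" "g \<otimes> a \<otimes> inv g = a' \<otimes> y" using sub[OF a] by (rule set_mult_memE)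
    have "y \<in> carrier G" using ay Fin by blast
    then have "g \<otimes> a \<otimes> inv g \<otimes> inv y = a'" unfolding ay(3) using AG[OF ay(1)] by (simp add: m_assoc)
    then have "g \<otimes> a \<otimes> inv g \<otimes> inv y \<in> A" using ay(1) by simp
    then show "\<exists>y\<in>Y. g \<otimes> a \<otimes> inv g \<otimes> inv y \<in> A" using ay(2) by blast
  qed
  then obtain f where f: "\<And>a. a \<in> A \<Longrightarrow> f a \<in> Y \<and> g \<otimes> a \<otimes> inv g \<otimes> inv (f a) \<in> A" by metis
  have sT: "subgroup T G"
  proof (rule subgroupI)
    show "T \<subseteq> carrier G" unfolding T_def using AG by auto
    show "T \<noteq> {}" unfolding T_def using g subgroup.one_closed[OF A(1)] by auto
    fix u assume u: "u \<in> T"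
    then have uG: "u \<in> carrier G" unfolding T_def using AG by auto
    have "g \<otimes> inv u \<otimes> inv g = inv (g \<otimes> u \<otimes> inv g)" using g uG by (simp add: m_assoc inv_mult_group)
    then show "inv u \<in> T" using u subgroup.m_inv_closed[OF A(1)] unfolding T_def by simp
    fix v assume v: "v \<in> T"
    then have vG: "v \<in> carrier G" unfolding T_def using AG by auto
    have "g \<otimes> (u \<otimes> v) \<otimes> inv g = (g \<otimes> u \<otimes> inv g) \<otimes> (g \<otimes> v \<otimes> inv g)" using g uG vG by (simp add: m_assoc)
    then show "u \<otimes> v \<in> T" using u v subgroup.m_closed[OF A(1)] unfolding T_def by simp
  qed
  have "T = A"
  proof (rule infinite_fibre[OF A sT])
    show "T \<subseteq> A" unfolding T_def by auto
    show "finite (f ` A)" by (rule finite_subset[OF _ Fin(1)]) (use f in blast)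
    fix u v assume uv: "u \<in> A" "v \<in> A" "f u = f v"
    have G: "u \<in> carrier G" "v \<in> carrier G" "f v \<in> carrier G" using uv AG f Fin by blast+
    have "(g \<otimes> u \<otimes> inv g \<otimes> inv (f u)) \<otimes> inv (g \<otimes> v \<otimes> inv g \<otimes> inv (f v)) \<in> A"
      using f uv subgroup.m_closed[OF A(1)] subgroup.m_inv_closed[OF A(1)] by blast
    moreover have "(g \<otimes> u \<otimes> inv g \<otimes> inv (f u)) \<otimes> inv (g \<otimes> v \<otimes> inv g \<otimes> inv (f v)) = g \<otimes> (u \<otimes> inv v) \<otimes> inv g"
      unfolding uv(3) using g G by (simp add: m_assoc inv_mult_group)
    ultimately show "u \<otimes> inv v \<in> T"
      unfolding T_def using uv subgroup.m_closed[OF A(1)] subgroup.m_inv_closed[OF A(1)] by simp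
  qed
  then show ?thesis using a unfolding T_def by auto
qed

text \<open>The stabiliser of \<open>v\<close> in \<open>A\<close> has finite index, so
  \<open>infinite_fibre\<close> makes it all of \<open>A\<close>.\<close>

lemma finite_conjugates_centralize:
  assumes A: "subgroup A G" "pairwise_cyclic G A" "infinite A" and v: "v \<in> carrier G"
    and Y: "finite Y" and sub: "\<And>a. a \<in> A \<Longrightarrow> a \<otimes> v \<otimes> inv a \<in> Y" and a: "a \<in> A"
  shows "a \<otimes> v = v \<otimes> a"
proof -
  note AG = subgroup_mem_carrier[OF A(1)]
  define T where "T = A \<inter> {y \<in> carrier G. v \<otimes> y = y \<otimes> v}"
  have sT: "subgroup T G" unfolding T_def using subgroups_Inter_pair[OF A(1) subgroup_centralizer[OF v]] .
  have "T = A"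
  proof (rule infinite_fibre[OF A sT, of "\<lambda>a. inv a \<otimes> v \<otimes> a"])
    show "T \<subseteq> A" unfolding T_def by auto
    have "inv a \<otimes> v \<otimes> a \<in> Y" if "a \<in> A" for a
      using sub[OF subgroup.m_inv_closed[OF A(1) that]] AG[OF that] by simp
    then show "finite ((\<lambda>a. inv a \<otimes> v \<otimes> a) ` A)" by (intro finite_subset[OF _ Y]) auto
    fix x y assume xy: "x \<in> A" "y \<in> A" and e: "inv x \<otimes> v \<otimes> x = inv y \<otimes> v \<otimes> y"
    have G: "x \<in> carrier G" "y \<in> carrier G" using xy AG by auto
    have "x \<otimes> (inv x \<otimes> v \<otimes> x) \<otimes> inv y = x \<otimes> (inv y \<otimes> v \<otimes> y) \<otimes> inv y" using e by simp
    then have "v \<otimes> (x \<otimes> inv y) = (x \<otimes> inv y) \<otimes> v" using G v by (simp add: m_assoc)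
    then show "x \<otimes> inv y \<in> T"
      unfolding T_def using xy G subgroup.m_closed[OF A(1)] subgroup.m_inv_closed[OF A(1)] by simp
  qed
  then show ?thesis using a unfolding T_def by force
qed

lemma p_productI:
  assumes "x \<in> carrier G" "y \<in> carrier G" "subgroup (cyc_prod G x y) G"
  shows "p_product p x y"
proof -
  have "finite (cyc_prod G x y)"
    unfolding cyc_prod_def set_mult_def using finite_cyclic assms by simp
  then show ?thesis unfolding p_product_def using assms prime finite_subgroup_order by blast
qed

text \<open>The cyclic subgroups of \<open>A\<close> form a chain, so each is the only one of its
  order; as \<open>A\<close> is normal, so is each of them. The product with a cyclic subgroup of
  \<open>B\<close> is then a finite subgroup.\<close>

lemma cover_of_normal_factor:
  assumes A: "subgroup A G" "pairwise_cyclic G A" and B: "subgroup B G" "pairwise_cyclic G B"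
    and AB: "carrier G = A <#> B" and nA: "\<And>g a. g \<in> carrier G \<Longrightarrow> a \<in> A \<Longrightarrow> g \<otimes> a \<otimes> inv g \<in> A"
    and F: "finite F" "F \<subseteq> carrier G"
  shows "\<exists>x\<in>carrier G. \<exists>y\<in>carrier G. p_product p x y \<and> F \<subseteq> cyc_prod G x y"
proof -
  have "\<exists>a b. a \<in> A \<and> b \<in> B \<and> f = a \<otimes> b" if "f \<in> F" for f
  proof -
    have "f \<in> A <#> B" using that F(2) AB by blast
    then show ?thesis by (rule set_mult_memE) blast
  qed
  then obtain r s where rs: "\<And>f. f \<in> F \<Longrightarrow> r f \<in> A \<and> s f \<in> B \<and> f = r f \<otimes> s f" by metis
  obtain x where x: "x \<in> A" "r ` F \<subseteq> generate G {x}"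
    using finite_subset_cyclic[OF A, of "r ` F"] F(1) rs by blast
  obtain y where y: "y \<in> B" "s ` F \<subseteq> generate G {y}"
    using finite_subset_cyclic[OF B, of "s ` F"] F(1) rs by blast
  have G: "x \<in> carrier G" "y \<in> carrier G" using x y A B subgroup_mem_carrier by blast+
  have sx: "subgroup (generate G {x}) G" and sy: "subgroup (generate G {y}) G"
    using G by (auto intro: generate_is_subgroup)
  have conj: "g \<otimes> x \<otimes> inv g \<in> generate G {x}" if g: "g \<in> carrier G" for g
  proof -
    define x' where "x' = g \<otimes> x \<otimes> inv g"
    have x': "x' \<in> A" unfolding x'_def by (rule nA[OF g x(1)])
    have x'G: "x' \<in> carrier G" using x' A subgroup_mem_carrier by blast
    have "x' \<in> generate G {x} \<or> x \<in> generate G {x'}" by (rule pairwise_cyclic_chain[OF A x' x(1)])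
    then show ?thesis
    proof
      assume "x \<in> generate G {x'}"
      then have sub: "generate G {x} \<subseteq> generate G {x'}" using generate_singleton_trans x'G by blast
      have "x' [^] n = \<one> \<longleftrightarrow> x [^] n = \<one>" for n :: nat
      proof -
        have e: "x' [^] n = g \<otimes> x [^] n \<otimes> inv g" unfolding x'_def using conj_nat_pow g G(1) by simp
        have "x [^] n = inv g \<otimes> x' [^] n \<otimes> g" unfolding e using g G(1) by (simp add: m_assoc)
        then show ?thesis using e g by auto
      qed
      then have "ord x' = ord x" using ord_unique[OF x'G] pow_eq_id[OF G(1)] by blast
      then have "card (generate G {x'}) = card (generate G {x})"
        using generate_pow_card[OF x'G] generate_pow_card[OF G(1)] by simp
      then have "generate G {x} = generate G {x'}"
        using card_subset_eq[OF finite_cyclic[OF x'G] sub] by simp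
      then show ?thesis unfolding x'_def[symmetric] by (auto intro: generate.incl)
    qed (simp add: x'_def)
  qed
  have "generate G {x} \<lhd> G" unfolding normal_inv_iff
  proof (intro conjI ballI sx)
    fix g h assume g: "g \<in> carrier G" and h: "h \<in> generate G {x}"
    obtain k :: nat where k: "h = x [^] k" using h generate_singleton_nat[OF G(1) ord_gt_0[OF G(1)]] by blast
    have "g \<otimes> h \<otimes> inv g = (g \<otimes> x \<otimes> inv g) [^] k" unfolding k using conj_nat_pow g G(1) by simp
    then show "g \<otimes> h \<otimes> inv g \<in> generate G {x}" using subgroup_nat_pow_closed[OF sx conj[OF g]] by simp
  qed
  then have "subgroup (cyc_prod G x y) G" unfolding cyc_prod_def using mult_norm_subgroup sy by blast
  moreover have "F \<subseteq> cyc_prod G x y"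
  proof
    fix f assume f: "f \<in> F"
    then have "r f \<in> generate G {x}" "s f \<in> generate G {y}" using x y by auto
    then show "f \<in> cyc_prod G x y" unfolding cyc_prod_def using rs[OF f] set_mult_memI by metis
  qed
  ultimately show ?thesis using p_productI G by blast
qed

section \<open>Normality of an infinite factor\<close>

context
  fixes M A B
  assumes M: "M \<lhd> G" and cM: "\<And>x y. x \<in> M \<Longrightarrow> y \<in> M \<Longrightarrow> x \<otimes> y = y \<otimes> x"
    and comm: "\<And>g h. g \<in> carrier G \<Longrightarrow> h \<in> carrier G \<Longrightarrow> commute_mod G M g h"
    and A: "subgroup A G" "pairwise_cyclic G A" and B: "subgroup B G" "pairwise_cyclic G B"
    and AB: "carrier G = A <#> B"
begin

text \<open>Conjugates of \<open>a\<close> stay in \<open>A <#> M\<close>, which by Dedekind's law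
  is \<open>A <#> ((A <#> M) \<inter> B)\<close>; a finite second factor is what
  \<open>normalizes_of_finite_index\<close> asks for.\<close>

lemma factor_normal:
  assumes infA: "infinite A" and fin: "finite ((A <#> M) \<inter> B)" and g: "g \<in> carrier G" and a: "a \<in> A"
  shows "g \<otimes> a \<otimes> inv g \<in> A"
proof (rule normalizes_of_finite_index[OF A infA g fin _ _ a])
  note AG = subgroup_mem_carrier[OF A(1)] and BG = subgroup_mem_carrier[OF B(1)]
  have sM: "subgroup M G" using M by (rule normal_imp_subgroup)
  have sAM: "subgroup (A <#> M) G" by (rule set_mult_normal_subgroup[OF A(1) M])
  show "(A <#> M) \<inter> B \<subseteq> carrier G" using BG by blast
  fix a assume a: "a \<in> A"
  have sup: "A \<subseteq> A <#> M" "M \<subseteq> A <#> M" using set_mult_supersets[OF A(1) sM] .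
  have "g \<otimes> a \<otimes> inv g \<otimes> inv a \<in> A <#> M"
    using comm[OF g AG[OF a]] sup unfolding commute_mod_def by blast
  then have "(g \<otimes> a \<otimes> inv g \<otimes> inv a) \<otimes> a \<in> A <#> M" using a sup subgroup.m_closed[OF sAM] by blast
  then have h: "g \<otimes> a \<otimes> inv g \<in> A <#> M" using g AG[OF a] by (simp add: m_assoc)
  have "g \<otimes> a \<otimes> inv g \<in> carrier G" using g AG[OF a] by simp
  then have "g \<otimes> a \<otimes> inv g \<in> A <#> B" unfolding AB .
  then obtain a' b where ab: "a' \<in> A" "b \<in> B" "g \<otimes> a \<otimes> inv g = a' \<otimes> b" by (rule set_mult_memE)
  have "b = inv a' \<otimes> (g \<otimes> a \<otimes> inv g)" unfolding ab(3) using AG[OF ab(1)] BG[OF ab(2)] by simp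
  then have "b \<in> A <#> M"
    using h ab(1) sup(1) subgroup.m_closed[OF sAM] subgroup.m_inv_closed[OF sAM] by (metis subsetD)
  then show "g \<otimes> a \<otimes> inv g \<in> A <#> ((A <#> M) \<inter> B)"
    unfolding ab(3) using ab by (intro set_mult_memI) auto
qed

text \<open>If both factors are infinite and supplement \<open>M\<close>, then \<open>C\<^sub>M(a)\<close> is finite for every
  noncentral \<open>a \<in> A\<close>, hence centralised by \<open>A\<close>; a vector of \<open>M\<close> in the second but not in the first term of
  the fixed point series of \<open>a\<close> would then have only finitely many conjugates under \<open>A\<close>.\<close>

lemma factor_centralizes:
  assumes infA: "infinite A" and GB: "carrier G = B <#> M" and a: "a \<in> A" and m: "m \<in> M"
  shows "a \<otimes> m = m \<otimes> a"
proof (rule ccontr)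
  assume neq: "a \<otimes> m \<noteq> m \<otimes> a"
  note AG = subgroup_mem_carrier[OF A(1)] and BG = subgroup_mem_carrier[OF B(1)]
  note cA = pairwise_cyclic_commute[OF A] and cB = pairwise_cyclic_commute[OF B]
  have sM: "subgroup M G" using M by (rule normal_imp_subgroup)
  note MG = subgroup_mem_carrier[OF sM]
  have aG: "a \<in> carrier G" and mG: "m \<in> carrier G" using a AG m MG by auto
  define Cm where "Cm = {w \<in> M. a \<otimes> w = w \<otimes> a}"
  \<comment> \<open>If \<open>B\<close> were inside \<open>M\<close>, then so would be
    \<open>G = B M\<close>, and \<open>a\<close> would commute with \<open>m\<close>. Proper
    subgroups of \<open>B\<close> are finite.\<close>
  have BM: "finite (B \<inter> M)"
  proof -
    have "\<not> B \<subseteq> M"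
    proof
      assume "B \<subseteq> M"
      have "a \<in> B <#> M" using aG GB by simp
      then obtain b n where "b \<in> B" "n \<in> M" "a = b \<otimes> n" by (rule set_mult_memE)
      then have "a \<in> M" using \<open>B \<subseteq> M\<close> subgroup.m_closed[OF sM] by blast
      then show False using neq cM m by blast
    qed
    then show ?thesis
      using proper_subgroup_finite[OF B subgroups_Inter_pair[OF B(1) sM]] by blast
  qed
  have "a \<in> B <#> M" using aG GB by simp
  then obtain b n0 where b: "b \<in> B" "n0 \<in> M" "a = b \<otimes> n0" by (rule set_mult_memE)
  define n where "n = inv n0"
  have n: "n \<in> M" unfolding n_def using subgroup.m_inv_closed[OF sM] b by blast
  have nG: "n \<in> carrier G" using n MG by blast
  have bn: "b = a \<otimes> n" unfolding n_def b(3) using BG[OF b(1)] MG[OF b(2)] by (simp add: m_assoc)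
  \<comment> \<open>\<open>a \<otimes> n\<close> and \<open>c \<otimes> w\<close> commute as
    elements of \<open>B\<close>. Since \<open>a\<close> commutes with \<open>c\<close> and
    \<open>w\<close>, and \<open>w\<close> with \<open>n\<close>, only the commutation of
    \<open>c\<close> and \<open>n\<close> is left.\<close>
  have key: "c \<otimes> n = n \<otimes> c" if w: "w \<in> Cm" and c: "c \<in> A" "c \<otimes> w \<in> B" for w c
  proof -
    have wM: "w \<in> M" and aw: "a \<otimes> w = w \<otimes> a" using w unfolding Cm_def by auto
    have G: "c \<in> carrier G" "w \<in> carrier G" using c AG wM MG by auto
    have e: "(a \<otimes> n) \<otimes> (c \<otimes> w) = (c \<otimes> w) \<otimes> (a \<otimes> n)" using cB[OF b(1) c(2)] bn by simp
    have "(c \<otimes> w) \<otimes> (a \<otimes> n) = c \<otimes> (w \<otimes> a) \<otimes> n" using G aG nG by (simp add: m_assoc)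
    also have "\<dots> = (c \<otimes> a) \<otimes> (w \<otimes> n)" using G aG nG aw[symmetric] by (simp add: m_assoc)
    also have "\<dots> = a \<otimes> c \<otimes> (n \<otimes> w)" using cA[OF c(1) a] cM[OF wM n] by simp
    also have "\<dots> = a \<otimes> ((c \<otimes> n) \<otimes> w)" using G aG nG by (simp add: m_assoc)
    finally have "a \<otimes> ((n \<otimes> c) \<otimes> w) = a \<otimes> ((c \<otimes> n) \<otimes> w)" using e G aG nG by (simp add: m_assoc)
    then show ?thesis using G aG nG by simp
  qed
  define Sn where "Sn = A \<inter> {c \<in> carrier G. n \<otimes> c = c \<otimes> n}"
  have sSn: "subgroup Sn G" unfolding Sn_def using subgroups_Inter_pair[OF A(1) subgroup_centralizer[OF nG]] .
  have ex: "\<exists>c\<in>A. c \<otimes> w \<in> B" if w: "w \<in> carrier G" for w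
  proof -
    have "w \<in> A <#> B" using w AB by simp
    then obtain a' b' where ab: "a' \<in> A" "b' \<in> B" "w = a' \<otimes> b'" by (rule set_mult_memE)
    then have "inv a' \<otimes> w = b'" using AG BG by simp
    then show ?thesis using ab subgroup.m_inv_closed[OF A(1)] by metis
  qed
  \<comment> \<open>The same computation with \<open>m\<close> in place of \<open>w\<close>, read
    backwards: if \<open>c\<close> commuted with \<open>n\<close>, then \<open>a\<close> would
    commute with \<open>m\<close>.\<close>
  have "Sn \<noteq> A"
  proof
    assume SnA: "Sn = A"
    obtain c where c: "c \<in> A" "c \<otimes> m \<in> B" using ex[OF mG] by blast
    have cG: "c \<in> carrier G" using c AG by blast
    have cn: "n \<otimes> c = c \<otimes> n" using c SnA unfolding Sn_def by auto
    have e: "(a \<otimes> n) \<otimes> (c \<otimes> m) = (c \<otimes> m) \<otimes> (a \<otimes> n)" using cB[OF b(1) c(2)] bn by simp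
    have "(a \<otimes> n) \<otimes> (c \<otimes> m) = a \<otimes> (n \<otimes> c) \<otimes> m" using cG aG nG mG by (simp add: m_assoc)
    also have "\<dots> = (a \<otimes> c) \<otimes> (n \<otimes> m)" unfolding cn using cG aG nG mG by (simp add: m_assoc)
    also have "\<dots> = c \<otimes> a \<otimes> (m \<otimes> n)" using cA[OF a c(1)] cM[OF n m] by simp
    also have "\<dots> = c \<otimes> ((a \<otimes> m) \<otimes> n)" using cG aG nG mG by (simp add: m_assoc)
    finally have "c \<otimes> ((a \<otimes> m) \<otimes> n) = c \<otimes> ((m \<otimes> a) \<otimes> n)" using e cG aG nG mG by (simp add: m_assoc)
    then show False using neq cG aG nG mG by simp
  qed
  then have finSn: "finite Sn" using proper_subgroup_finite[OF A sSn] unfolding Sn_def by blast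
  \<comment> \<open>Choosing \<open>f w\<close> in \<open>A\<close> with
    \<open>f w \<otimes> w\<close> in \<open>B\<close> maps \<open>Cm\<close> into the finite
    \<open>Sn\<close>; elements of one fibre differ by the finite
    \<open>B \<inter> M\<close>.\<close>
  have finC: "finite Cm"
  proof (rule ccontr)
    assume inf: "infinite Cm"
    have "\<forall>w\<in>Cm. \<exists>c\<in>A. c \<otimes> w \<in> B" using ex MG unfolding Cm_def by auto
    then obtain f where f: "\<And>w. w \<in> Cm \<Longrightarrow> f w \<in> A \<and> f w \<otimes> w \<in> B" by metis
    have "f ` Cm \<subseteq> Sn" unfolding Sn_def using f key AG by auto
    then have "finite (f ` Cm)" using finSn by (rule finite_subset)
    then obtain w0 where w0: "w0 \<in> Cm" "infinite {w \<in> Cm. f w = f w0}"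
      using pigeonhole_infinite[OF inf] by blast
    have CG: "w \<in> carrier G" "w \<in> M" if "w \<in> Cm" for w using that MG unfolding Cm_def by auto
    have "inj_on (\<lambda>w. inv w0 \<otimes> w) {w \<in> Cm. f w = f w0}"
      using CG w0(1) by (intro inj_onI) simp
    moreover have "(\<lambda>w. inv w0 \<otimes> w) ` {w \<in> Cm. f w = f w0} \<subseteq> B \<inter> M"
    proof clarify
      fix w assume w: "w \<in> Cm" "f w = f w0"
      have fG: "f w0 \<in> carrier G" using f[OF w0(1)] AG by blast
      have "inv (f w0 \<otimes> w0) \<otimes> (f w0 \<otimes> w) \<in> B"
        using f[OF w0(1)] f[OF w(1)] w(2) subgroup.m_closed[OF B(1)] subgroup.m_inv_closed[OF B(1)] by metis
      moreover have "inv (f w0 \<otimes> w0) \<otimes> (f w0 \<otimes> w) = inv w0 \<otimes> w"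
        using fG CG w(1) w0(1) by (simp add: inv_mult_group m_assoc)
      moreover have "inv w0 \<otimes> w \<in> M"
        using CG(2) w(1) w0(1) subgroup.m_closed[OF sM] subgroup.m_inv_closed[OF sM] by blast
      ultimately show "inv w0 \<otimes> w \<in> B \<inter> M" by simp
    qed
    ultimately show False using w0(2) finite_imageD finite_subset[OF _ BM] by blast
  qed
  \<comment> \<open>\<open>Cm\<close> is finite and, \<open>A\<close> being abelian, invariant under
    \<open>A\<close>; so each of its elements has finitely many conjugates under
    \<open>A\<close>.\<close>
  have cen: "c \<otimes> w = w \<otimes> c" if c: "c \<in> A" and w: "w \<in> Cm" for c w
  proof (rule finite_conjugates_centralize[OF A infA _ finC _ c])
    have wM: "w \<in> M" and aw: "a \<otimes> w = w \<otimes> a" using w unfolding Cm_def by auto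
    show wG: "w \<in> carrier G" using wM MG by blast
    fix d assume d: "d \<in> A"
    have dG: "d \<in> carrier G" using d AG by blast
    have ad: "a \<otimes> d = d \<otimes> a" using cA[OF a d] .
    have aid: "a \<otimes> inv d = inv d \<otimes> a" using cA[OF a subgroup.m_inv_closed[OF A(1) d]] .
    have "a \<otimes> (d \<otimes> w \<otimes> inv d) = (a \<otimes> d) \<otimes> w \<otimes> inv d" using aG dG wG by (simp add: m_assoc)
    also have "\<dots> = d \<otimes> (a \<otimes> w) \<otimes> inv d" unfolding ad using aG dG wG by (simp add: m_assoc)
    also have "\<dots> = d \<otimes> w \<otimes> (a \<otimes> inv d)" unfolding aw using aG dG wG by (simp add: m_assoc)
    also have "\<dots> = (d \<otimes> w \<otimes> inv d) \<otimes> a" unfolding aid using aG dG wG by (simp add: m_assoc)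
    finally show "d \<otimes> w \<otimes> inv d \<in> Cm" unfolding Cm_def using normal_conj_closed(1)[OF M dG wM] by simp
  qed
  \<comment> \<open>In the finite \<open>p\<close>-group generated by \<open>a\<close> and
    \<open>m\<close>, the part of \<open>M\<close> is strictly larger than that of
    \<open>Cm\<close>. An element of it outside \<open>Cm\<close> but central modulo
    \<open>Cm\<close> is moved by \<open>a\<close>, and only by a factor from
    \<open>Cm\<close>.\<close>
  have "\<exists>v\<in>M. a \<otimes> v \<noteq> v \<otimes> a \<and> a \<otimes> v \<otimes> inv a \<otimes> inv v \<in> Cm"
  proof -
    define F where "F = generate G {a, m}"
    have sF: "subgroup F G" unfolding F_def using aG mG by (intro generate_is_subgroup) auto
    have "finite F" unfolding F_def
    proof (rule finite_generate_metabelian[OF M cM comm])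
      show "\<exists>n::nat. n > 0 \<and> g [^] n = \<one>" if "g \<in> carrier G" for g
        using ord_gt_0[OF that] pow_ord_eq_1[OF that] by blast
    qed (use aG mG in auto)
    then obtain k where k: "card F = p ^ k" using finite_subgroup_order[OF sF] by blast
    interpret F: finite_p_group "G\<lparr>carrier := F\<rparr>" p
    proof (intro finite_p_group.intro finite_p_group_axioms.intro)
      show "group (G\<lparr>carrier := F\<rparr>)" using sF by (rule subgroup_imp_group)
      show "\<exists>n. order (G\<lparr>carrier := F\<rparr>) = p ^ n" using k unfolding order_def by auto
    qed (rule prime)
    have mem: "a \<in> F" "m \<in> F" unfolding F_def by (auto intro: generate.incl)
    have sub: "subgroup (M \<inter> F) (G\<lparr>carrier := F\<rparr>)"
      using subgroups_Inter_pair[OF sM sF] sF by (intro subgroup_incl) auto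
    have nK: "M \<inter> F \<lhd> (G\<lparr>carrier := F\<rparr>)" unfolding F.normal_inv_iff
    proof (intro conjI ballI sub)
      fix g h assume g: "g \<in> carrier (G\<lparr>carrier := F\<rparr>)" and h: "h \<in> M \<inter> F"
      have gF: "g \<in> F" using g by simp
      have "g \<otimes> h \<otimes> inv g \<in> M" using normal_conj_closed(1)[OF M] h subgroup_mem_carrier[OF sF gF] by blast
      moreover have "g \<otimes> h \<otimes> inv g \<in> F"
        using gF h subgroup.m_closed[OF sF] subgroup.m_inv_closed[OF sF] by blast
      ultimately show "g \<otimes>\<^bsub>G\<lparr>carrier := F\<rparr>\<^esub> h \<otimes>\<^bsub>G\<lparr>carrier := F\<rparr>\<^esub> inv\<^bsub>G\<lparr>carrier := F\<rparr>\<^esub> g \<in> M \<inter> F"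
        using m_inv_consistent[OF sF gF] by simp
    qed
    define N where "N = Cm \<inter> F"
    have CmE: "Cm = M \<inter> {w \<in> carrier G. a \<otimes> w = w \<otimes> a}" unfolding Cm_def using MG by auto
    have sN: "subgroup N G" unfolding N_def CmE
      by (intro subgroups_Inter_pair sM sF subgroup_centralizer aG)
    have NF: "N \<subseteq> F" unfolding N_def by auto
    have "F \<subseteq> {g \<in> carrier G. \<forall>x\<in>N. g \<otimes> x \<otimes> inv g \<in> N \<and> inv g \<otimes> x \<otimes> g \<in> N}"
      unfolding F_def
    proof (rule generate_subgroup_incl[OF _ subgroup_normalizer[OF sN]])
      have "g \<otimes> x \<otimes> inv g = x \<and> inv g \<otimes> x \<otimes> g = x" if "g \<in> {a, m}" "x \<in> N" for g x
      proof -
        have xM: "x \<in> M" "a \<otimes> x = x \<otimes> a" using that unfolding N_def Cm_def by auto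
        have xG: "x \<in> carrier G" using xM MG by blast
        have gx: "g \<otimes> x = x \<otimes> g" using that(1) xM cM[OF m xM(1)] by auto
        have gG: "g \<in> carrier G" using that(1) aG mG by auto
        have "inv g \<otimes> x \<otimes> g = inv g \<otimes> (x \<otimes> g)" using gG xG by (simp add: m_assoc)
        also have "\<dots> = x" unfolding gx[symmetric] using gG xG by simp
        finally have "inv g \<otimes> x \<otimes> g = x" .
        moreover have "g \<otimes> x \<otimes> inv g = x" unfolding gx using gG xG by (simp add: m_assoc)
        ultimately show ?thesis by simp
      qed
      then show "{a, m} \<subseteq> {g \<in> carrier G. \<forall>x\<in>N. g \<otimes> x \<otimes> inv g \<in> N \<and> inv g \<otimes> x \<otimes> g \<in> N}"
        using aG mG by auto
    qed
    then have conjN: "g \<otimes> x \<otimes> inv g \<in> N" if "g \<in> F" "x \<in> N" for g x using that by blast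
    have nN: "N \<lhd> (G\<lparr>carrier := F\<rparr>)" unfolding F.normal_inv_iff
    proof (intro conjI ballI subgroup_incl[OF sN sF NF])
      fix g h assume g: "g \<in> carrier (G\<lparr>carrier := F\<rparr>)" and h: "h \<in> N"
      then show "g \<otimes>\<^bsub>G\<lparr>carrier := F\<rparr>\<^esub> h \<otimes>\<^bsub>G\<lparr>carrier := F\<rparr>\<^esub> inv\<^bsub>G\<lparr>carrier := F\<rparr>\<^esub> g \<in> N"
        using m_inv_consistent[OF sF, of g] conjN by simp
    qed
    have "N \<subset> M \<inter> F"
    proof
      show "N \<subseteq> M \<inter> F" unfolding N_def Cm_def by auto
      have "m \<in> M \<inter> F" "m \<notin> N" using m mem neq unfolding N_def Cm_def by auto
      then show "N \<noteq> M \<inter> F" by blast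
    qed
    then obtain w where w: "w \<in> M \<inter> F" "w \<notin> N" "\<And>g. g \<in> F \<Longrightarrow> commute_mod (G\<lparr>carrier := F\<rparr>) N g w"
      using F.central_mod[OF nN nK] by auto
    have "commute_mod G N a w" using w(3)[OF mem(1)] commute_mod_consistent[OF sF mem(1)] w(1) by simp
    then have "a \<otimes> w \<otimes> inv a \<otimes> inv w \<in> Cm" unfolding commute_mod_def N_def by simp
    moreover have "a \<otimes> w \<noteq> w \<otimes> a" using w(1,2) unfolding N_def Cm_def by auto
    ultimately show ?thesis using w(1) by blast
  qed
  then obtain v where v: "v \<in> M" "a \<otimes> v \<noteq> v \<otimes> a" "a \<otimes> v \<otimes> inv a \<otimes> inv v \<in> Cm" by blast
  have vG: "v \<in> carrier G" using v MG by blast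
  define t where "t = a \<otimes> v \<otimes> inv a \<otimes> inv v"
  have tG: "t \<in> carrier G" unfolding t_def using aG vG by simp
  have tM: "t \<in> M" using v(3) unfolding t_def Cm_def by simp
  have av: "a \<otimes> v \<otimes> inv a = t \<otimes> v" unfolding t_def using aG vG by (simp add: m_assoc)
  have "a \<otimes> v = v \<otimes> a"
  proof (rule finite_conjugates_centralize[OF A infA vG _ _ a])
    show "finite ((\<lambda>w. w \<otimes> v) ` Cm)" using finC by simp
    fix c assume c: "c \<in> A"
    have cG: "c \<in> carrier G" using c AG by blast
    have ct: "c \<otimes> t = t \<otimes> c" using cen[OF c] v(3) unfolding t_def by simp
    have ac: "a \<otimes> c = c \<otimes> a" by (rule cA[OF a c])
    \<comment> \<open>\<open>s\<close> is the change of \<open>v\<close> under \<open>c\<close>. As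
      \<open>c\<close> commutes with \<open>a\<close> and with the change \<open>t\<close> of
      \<open>v\<close> under \<open>a\<close>, comparing the two orders of conjugation shows that
      \<open>a\<close> fixes \<open>s\<close>. So all conjugates of \<open>v\<close> under
      \<open>A\<close> lie in the finite set of products of \<open>Cm\<close> with
      \<open>v\<close>.\<close>
    define s where "s = c \<otimes> v \<otimes> inv c \<otimes> inv v"
    have sM': "s \<in> M" unfolding s_def
      using normal_conj_closed(1)[OF M cG v(1)] v(1) subgroup.m_closed[OF sM] subgroup.m_inv_closed[OF sM] by simp
    have sG: "s \<in> carrier G" using sM' MG by blast
    have cv: "c \<otimes> v \<otimes> inv c = s \<otimes> v" unfolding s_def using cG vG by (simp add: m_assoc)
    have "a \<otimes> (c \<otimes> v \<otimes> inv c) \<otimes> inv a = c \<otimes> (a \<otimes> v \<otimes> inv a) \<otimes> inv c"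
    proof -
      have "a \<otimes> (c \<otimes> v \<otimes> inv c) \<otimes> inv a = (a \<otimes> c) \<otimes> v \<otimes> inv (a \<otimes> c)"
        using aG cG vG by (simp add: m_assoc inv_mult_group)
      also have "\<dots> = c \<otimes> (a \<otimes> v \<otimes> inv a) \<otimes> inv c"
        unfolding ac using aG cG vG by (simp add: m_assoc inv_mult_group)
      finally show ?thesis .
    qed
    also have "\<dots> = (c \<otimes> t) \<otimes> v \<otimes> inv c" unfolding av using cG tG vG by (simp add: m_assoc)
    also have "\<dots> = t \<otimes> (s \<otimes> v)" unfolding ct cv[symmetric] using cG tG vG by (simp add: m_assoc)
    finally have "a \<otimes> (s \<otimes> v) \<otimes> inv a = t \<otimes> (s \<otimes> v)" unfolding cv .
    moreover have "a \<otimes> (s \<otimes> v) \<otimes> inv a = (a \<otimes> s \<otimes> inv a) \<otimes> (a \<otimes> v \<otimes> inv a)"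
      using aG sG vG by (simp add: m_assoc)
    ultimately have "(a \<otimes> s \<otimes> inv a) \<otimes> (t \<otimes> v) = t \<otimes> (s \<otimes> v)" unfolding av by simp
    also have "\<dots> = s \<otimes> (t \<otimes> v)" using cM[OF tM sM'] tG sG vG by (simp flip: m_assoc)
    finally have "a \<otimes> s \<otimes> inv a = s" using aG sG tG vG by simp
    then have "a \<otimes> s = s \<otimes> a" using aG sG inv_solve_right'[of s "a \<otimes> s" a] by simp
    then have "s \<in> Cm" unfolding Cm_def using sM' by simp
    then show "c \<otimes> v \<otimes> inv c \<in> (\<lambda>w. w \<otimes> v) ` Cm" unfolding cv by blast
  qed
  then show False using v(2) by blast
qed

end

text \<open>Proper subgroups of the factors are finite, so an infinite
  \<open>(A <#> M) \<inter> B\<close> is all of \<open>B\<close>. Hence both factors are finite, or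
  \<open>factor_normal\<close> makes one of them normal, or \<open>G = A M = B M\<close>; in the
  last case \<open>M\<close> centralises \<open>A\<close>, which is therefore normal too.\<close>

theorem finite_subset_in_p_product:
  assumes M: "M \<lhd> G" and cM: "\<And>x y. x \<in> M \<Longrightarrow> y \<in> M \<Longrightarrow> x \<otimes> y = y \<otimes> x"
    and comm: "\<And>g h. g \<in> carrier G \<Longrightarrow> h \<in> carrier G \<Longrightarrow> commute_mod G M g h"
    and A: "subgroup A G" "pairwise_cyclic G A" and B: "subgroup B G" "pairwise_cyclic G B"
    and AB: "carrier G = A <#> B" and F: "finite F" "F \<subseteq> carrier G"
  shows "\<exists>x\<in>carrier G. \<exists>y\<in>carrier G. p_product p x y \<and> F \<subseteq> cyc_prod G x y"
proof -
  note AG = subgroup_mem_carrier[OF A(1)] and BG = subgroup_mem_carrier[OF B(1)]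
  have sM: "subgroup M G" using M by (rule normal_imp_subgroup)
  have BA: "carrier G = B <#> A" by (rule set_mult_swap[OF A(1) B(1) AB])
  have sAM: "subgroup (A <#> M) G" and sBM: "subgroup (B <#> M) G"
    using set_mult_normal_subgroup A(1) B(1) M by blast+
  consider (fin) "finite A" "finite B" | (A) "infinite A" "finite ((A <#> M) \<inter> B)"
    | (B) "infinite B" "finite ((B <#> M) \<inter> A)"
    | (inf) "infinite A" "infinite B" "infinite ((A <#> M) \<inter> B)" "infinite ((B <#> M) \<inter> A)"
    using finite_Int by blast
  then show ?thesis
  proof cases
    case fin
    obtain x where x: "x \<in> A" "A \<subseteq> generate G {x}" using finite_subset_cyclic[OF A fin(1)] by blast
    obtain y where y: "y \<in> B" "B \<subseteq> generate G {y}" using finite_subset_cyclic[OF B fin(2)] by blast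
    have "A = generate G {x}" "B = generate G {y}"
      using x y generate_singleton_subset[OF A(1)] generate_singleton_subset[OF B(1)] by blast+
    then have "cyc_prod G x y = carrier G" unfolding cyc_prod_def using AB by simp
    then show ?thesis using p_productI[of x y] x y AG BG F subgroup_self by metis
  next
    case A
    show ?thesis
      by (rule cover_of_normal_factor[OF assms(4,5) B AB factor_normal[OF M cM comm assms(4,5) B AB A] F])
  next
    case B
    show ?thesis
      by (rule cover_of_normal_factor[OF assms(6,7) A BA factor_normal[OF M cM comm assms(6,7) A BA B] F])
  next
    case inf
    have "(A <#> M) \<inter> B = B"
      using proper_subgroup_finite[OF B subgroups_Inter_pair[OF sAM B(1)]] inf by blast
    then have "A <#> B \<subseteq> A <#> M"
      unfolding set_mult_def[of G A B]
      using set_mult_supersets(1)[OF A(1) sM] subgroup.m_closed[OF sAM] by blast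
    then have GA: "carrier G = A <#> M" using AB subgroup.subset[OF sAM] by blast
    have "(B <#> M) \<inter> A = A"
      using proper_subgroup_finite[OF A subgroups_Inter_pair[OF sBM A(1)]] inf by blast
    then have "B <#> A \<subseteq> B <#> M"
      unfolding set_mult_def[of G B A]
      using set_mult_supersets(1)[OF B(1) sM] subgroup.m_closed[OF sBM] by blast
    then have GB: "carrier G = B <#> M" using BA subgroup.subset[OF sBM] by blast
    have "g \<otimes> a \<otimes> inv g \<in> A" if g: "g \<in> carrier G" and a: "a \<in> A" for g a
    proof -
      have "g \<in> A <#> M" using g GA by simp
      then obtain a' m where am: "a' \<in> A" "m \<in> M" "g = a' \<otimes> m" by (rule set_mult_memE)
      have G: "a' \<in> carrier G" "m \<in> carrier G" "a \<in> carrier G"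
        using am a AG subgroup_mem_carrier[OF sM] by auto
      have "a \<otimes> m = m \<otimes> a"
        by (rule factor_centralizes[OF M cM comm A B AB inf(1) GB a am(2)])
      then have "m \<otimes> a \<otimes> inv m = a" using G by (metis inv_solve_right m_closed)
      then have "g \<otimes> a \<otimes> inv g = a' \<otimes> a \<otimes> inv a'"
        unfolding am(3) using G by (simp add: inv_mult_group flip: m_assoc) (simp add: m_assoc)
      then show ?thesis using am a subgroup.m_closed[OF A(1)] subgroup.m_inv_closed[OF A(1)] by simp
    qed
    then show ?thesis by (rule cover_of_normal_factor[OF A B AB _ F])
  qed
qed

end

section \<open>Pruefer rank of periodic products\<close>

context group
begin

lemma pairwise_cyclic_of_locally_cyclic:
  assumes A: "subgroup A G" and "locally_cyclic (G\<lparr>carrier := A\<rparr>)"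
  shows "pairwise_cyclic G A"
  unfolding pairwise_cyclic_def
proof (intro ballI)
  fix x y assume xy: "x \<in> A" "y \<in> A"
  define H where "H = generate G {x, y}"
  have HA: "H \<subseteq> A" unfolding H_def using xy by (intro generate_subgroup_incl[OF _ A]) auto
  have sH: "subgroup H G" unfolding H_def using xy subgroup_mem_carrier[OF A] by (intro generate_is_subgroup) auto
  have "H = generate (G\<lparr>carrier := A\<rparr>) {x, y}"
    unfolding H_def using generate_consistent[of "{x, y}" A] A xy by simp
  then have "fg_subgroup H (G\<lparr>carrier := A\<rparr>)"
    unfolding fg_subgroup_def using xy by (intro exI[of _ "{x, y}"]) simp
  then have "cyclic_group (G\<lparr>carrier := H\<rparr>)" using assms(2) unfolding locally_cyclic_def by fastforce
  interpret H: group "G\<lparr>carrier := H\<rparr>" using sH by (rule subgroup_imp_group)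
  obtain z where z: "z \<in> H" "H = range (\<lambda>n::int. z [^]\<^bsub>G\<lparr>carrier := H\<rparr>\<^esub> n)"
    using \<open>cyclic_group (G\<lparr>carrier := H\<rparr>)\<close> unfolding H.cyclic_group by auto
  have zG: "z \<in> carrier G" using z(1) sH subgroup_mem_carrier by blast
  have "H \<subseteq> generate G {z}"
  proof
    fix h assume "h \<in> H"
    then obtain n :: int where "h = z [^]\<^bsub>G\<lparr>carrier := H\<rparr>\<^esub> n" using z(2) by blast
    then have "h = z [^] n" using int_pow_consistent[OF sH z(1)] by simp
    then show "h \<in> generate G {z}" unfolding generate_pow[OF zG] by blast
  qed
  moreover have "x \<in> H" "y \<in> H" unfolding H_def by (auto intro: generate.incl)
  ultimately show "\<exists>z\<in>A. x \<in> generate G {z} \<and> y \<in> generate G {z}" using z(1) HA by blast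
qed

text \<open>If \<open>x\<close> and \<open>y\<close> are powers of \<open>z\<close>, the
  \<open>p\<close>-part \<open>u\<close> of \<open>z\<close> generates every
  \<open>p\<close>-element among the powers of \<open>z\<close>.\<close>

lemma pairwise_cyclic_p_part:
  fixes p :: nat
  assumes A: "subgroup A G" "pairwise_cyclic G A" and p: "prime p"
    and per: "\<And>g. g \<in> carrier G \<Longrightarrow> \<exists>n::nat. n > 0 \<and> g [^] n = \<one>"
    and P: "subgroup (p_elements G p) G"
  shows "pairwise_cyclic G (A \<inter> p_elements G p)"
  unfolding pairwise_cyclic_def
proof (intro ballI)
  fix x y assume x: "x \<in> A \<inter> p_elements G p" and y: "y \<in> A \<inter> p_elements G p"
  obtain z where z: "z \<in> A" "x \<in> generate G {z}" "y \<in> generate G {z}"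
    using A x y unfolding pairwise_cyclic_def by blast
  have zG: "z \<in> carrier G" using z A subgroup_mem_carrier by blast
  obtain u v k n where uv: "u \<in> A" "v \<in> A" "z = u \<otimes> v" "z = v \<otimes> u" "u [^] (p ^ k) = \<one>"
    "v [^] (n::nat) = \<one>" "n > 0" "\<not> p dvd n"
    using prime_part_decomposition[OF A(1) z(1) p per[OF zG]] by blast
  have G: "u \<in> carrier G" "v \<in> carrier G" using uv A subgroup_mem_carrier by blast+
  have uP: "u \<in> p_elements G p" unfolding p_elements_def using uv(5) G by blast
  have "w \<in> generate G {u}" if w: "w \<in> generate G {z}" "w \<in> p_elements G p" for w
  proof -
    have "ord z > 0" using per[OF zG] ord_pos[OF zG] by blast
    then obtain i :: nat where i: "w = z [^] i" using w(1) generate_singleton_nat[OF zG] by blast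
    have wi: "w = u [^] i \<otimes> v [^] i"
      unfolding i uv(3) using uv(3,4) G by (intro pow_mult_distrib) simp_all
    have "v [^] i = inv (u [^] i) \<otimes> w" unfolding wi using G by simp
    then have "v [^] i \<in> p_elements G p"
      using subgroup_nat_pow_closed[OF P uP] w(2) subgroup.m_closed[OF P] subgroup.m_inv_closed[OF P] by simp
    then obtain j where "(v [^] i) [^] (p ^ j) = \<one>" unfolding p_elements_def by blast
    moreover have "(v [^] i) [^] n = \<one>"
      using nat_pow_one_mult[OF G(2) uv(6), of i] G by (simp add: nat_pow_pow mult.commute)
    moreover have "coprime n (p ^ j)" using prime_imp_coprime[OF p uv(8)] by (simp add: coprime_commute)
    ultimately have "v [^] i \<in> {\<one>}"
      using coprime_nat_pow_mem[OF triv_subgroup nat_pow_closed[OF G(2)], of n "p ^ j" i] by simp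
    then have "w = u [^] i" using wi G by simp
    then show ?thesis using generate_nat_pow[OF G(1)] by simp
  qed
  then show "\<exists>z\<in>A \<inter> p_elements G p. x \<in> generate G {z} \<and> y \<in> generate G {z}"
    using x y z(2,3) uv(1) uP by (intro bexI[of _ u] conjI) simp_all
qed

text \<open>The \<open>p\<close>-elements of \<open>G\<close> need not form a subgroup; they do
  modulo \<open>K\<close>, the elements of \<open>M\<close> of order prime to \<open>p\<close>. A
  \<open>p\<close>-subgroup meets \<open>K\<close> trivially, so \<open>S\<close> embeds into the
  quotient and generators of its image can be pulled back.\<close>

lemma p_subgroup_generated:
  fixes p :: nat
  assumes A: "subgroup A G" "pairwise_cyclic G A" and B: "subgroup B G" "pairwise_cyclic G B"
    and AB: "carrier G = A <#> B"
    and per: "\<And>g. g \<in> carrier G \<Longrightarrow> \<exists>n::nat. n > 0 \<and> g [^] n = \<one>"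
    and p: "prime p" and S: "subgroup S G" "card S = p ^ n"
  shows "generated_by G (if p = 2 then 3 else 2) S"
proof -
  define M where "M = derived G (carrier G)"
  have cA: "x \<otimes> y = y \<otimes> x" if "x \<in> A" "y \<in> A" for x y by (rule pairwise_cyclic_commute[OF A that])
  have cB: "x \<otimes> y = y \<otimes> x" if "x \<in> B" "y \<in> B" for x y by (rule pairwise_cyclic_commute[OF B that])
  have M: "M \<lhd> G" unfolding M_def by (rule derived_is_normal[OF normal_self])
  have cM: "x \<otimes> y = y \<otimes> x" if "x \<in> M" "y \<in> M" for x y
    using derived_abelian_of_product[OF A(1) B(1) AB cA cB] that unfolding M_def by blast
  have sM: "subgroup M G" using M by (rule normal_imp_subgroup)
  note MG = subgroup_mem_carrier[OF sM] and SG = subgroup_mem_carrier[OF S(1)]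
  define K where "K = {m \<in> M. \<exists>n::nat. \<not> p dvd n \<and> m [^] n = \<one>}"
  have sK: "subgroup K G"
  proof (rule subgroupI)
    show "K \<subseteq> carrier G" unfolding K_def using MG by auto
    have "\<not> p dvd 1" using p not_prime_unit by auto
    then show "K \<noteq> {}" unfolding K_def using subgroup.one_closed[OF sM] by (auto intro!: exI[of _ \<one>] exI[of _ "1::nat"])
    fix a assume a: "a \<in> K"
    then show "inv a \<in> K" unfolding K_def using MG subgroup.m_inv_closed[OF sM] by (auto simp: nat_pow_inv)
    fix b assume b: "b \<in> K"
    obtain i j :: nat where ij: "\<not> p dvd i" "a [^] i = \<one>" "\<not> p dvd j" "b [^] j = \<one>" using a b unfolding K_def by blast
    have ab: "a \<in> M" "b \<in> M" "a \<in> carrier G" "b \<in> carrier G" using a b MG unfolding K_def by auto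
    have "(a \<otimes> b) [^] (i * j) = a [^] (i * j) \<otimes> b [^] (i * j)" by (rule pow_mult_distrib[OF cM[OF ab(1,2)] ab(3,4)])
    also have "\<dots> = \<one>"
      using nat_pow_one_mult[OF ab(3) ij(2), of j] nat_pow_one_mult[OF ab(4) ij(4), of i] by (simp add: mult.commute)
    finally have "(a \<otimes> b) [^] (i * j) = \<one>" .
    moreover have "\<not> p dvd i * j" using ij p by (simp add: prime_dvd_mult_iff)
    ultimately show "a \<otimes> b \<in> K" unfolding K_def using subgroup.m_closed[OF sM ab(1,2)] by blast
  qed
  have K: "K \<lhd> G" unfolding normal_inv_iff
  proof (intro conjI ballI sK)
    fix g h assume g: "g \<in> carrier G" and h: "h \<in> K"
    obtain i :: nat where i: "\<not> p dvd i" "h [^] i = \<one>" using h unfolding K_def by blast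
    have hM: "h \<in> M" "h \<in> carrier G" using h MG unfolding K_def by auto
    have "(g \<otimes> h \<otimes> inv g) [^] i = \<one>" using conj_nat_pow[OF g hM(2), of i] i g by simp
    then show "g \<otimes> h \<otimes> inv g \<in> K" unfolding K_def using normal_conj_closed(1)[OF M g hM(1)] i(1) by blast
  qed
  interpret K: normal K G by (rule K)
  define Q where "Q = G Mod K"
  define f where "f = (\<lambda>a. K #> a)"
  interpret Q: group Q unfolding Q_def by (rule K.factorgroup_is_group)
  interpret f: group_hom G Q f
    using K.r_coset_hom_Mod unfolding f_def[symmetric] Q_def[symmetric]
    by (intro group_hom.intro group_hom_axioms.intro group_axioms Q.group_axioms)
  have fsurj: "f ` carrier G = carrier Q" unfolding f_def Q_def by (rule carrier_FactGroup[symmetric])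
  have fpow: "f g [^]\<^bsub>Q\<^esub> k = f (g [^] k)" if "g \<in> carrier G" for g and k :: nat
    unfolding f_def Q_def using K.FactGroup_pow[OF that] .
  have perQ: "\<exists>n::nat. n > 0 \<and> g [^]\<^bsub>Q\<^esub> n = \<one>\<^bsub>Q\<^esub>" if g: "g \<in> carrier Q" for g
  proof -
    obtain h where h: "h \<in> carrier G" "g = f h" using g fsurj by blast
    obtain k :: nat where "k > 0" "h [^] k = \<one>" using per[OF h(1)] by blast
    then show ?thesis using fpow[OF h(1), of k] h(2) by auto
  qed
  have nMQ: "f ` M \<lhd> Q" by (rule normal.surj_hom_normal_subgroup[OF M f.group_hom_axioms fsurj])
  have cMQ: "x \<otimes>\<^bsub>Q\<^esub> y = y \<otimes>\<^bsub>Q\<^esub> x" if xy: "x \<in> f ` M" "y \<in> f ` M" for x y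
  proof -
    obtain a b where ab: "a \<in> M" "b \<in> M" "x = f a" "y = f b" using xy by blast
    show ?thesis unfolding ab(3,4) using cM[OF ab(1,2)] f.hom_mult[OF MG MG] ab(1,2) by metis
  qed
  have commQ: "commute_mod Q (f ` M) x y" if xy: "x \<in> carrier Q" "y \<in> carrier Q" for x y
  proof -
    obtain a b where ab: "a \<in> carrier G" "b \<in> carrier G" "x = f a" "y = f b"
      using xy unfolding fsurj[symmetric] by blast
    have "a \<otimes> b \<otimes> inv a \<otimes> inv b \<in> M" using commute_mod_derived[OF ab(1,2)] unfolding commute_mod_def M_def .
    then have "f (a \<otimes> b \<otimes> inv a \<otimes> inv b) \<in> f ` M" by blast
    then show ?thesis unfolding commute_mod_def ab(3,4) using ab(1,2) by simp
  qed
  have MQp: "f ` M \<subseteq> p_elements Q p"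
  proof
    fix x assume "x \<in> f ` M"
    then obtain m where m: "m \<in> M" "x = f m" by blast
    obtain u v k n where uv: "u \<in> M" "v \<in> M" "m = v \<otimes> u" "u [^] (p ^ k) = \<one>" "v [^] (n::nat) = \<one>" "\<not> p dvd n"
      using prime_part_decomposition[OF sM m(1) p per[OF MG[OF m(1)]]] by blast
    have "v \<in> K" unfolding K_def using uv by blast
    have G: "u \<in> carrier G" "v \<in> carrier G" "m \<in> carrier G" using uv(1,2) m MG by auto
    have "m \<otimes> inv u = v" using uv(3) G by (simp add: m_assoc)
    then have "f m = f u" unfolding f_def using rcos_eq_iff[OF sK G(3,1)] \<open>v \<in> K\<close> by simp
    then have "x [^]\<^bsub>Q\<^esub> (p ^ k) = \<one>\<^bsub>Q\<^esub>" using m fpow[OF G(1), of "p ^ k"] uv(4) by simp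
    then show "x \<in> p_elements Q p" unfolding p_elements_def using m(2) G by auto
  qed
  have img: "subgroup (f ` H) Q" "pairwise_cyclic Q (f ` H)" if H: "subgroup H G" "pairwise_cyclic G H" for H
  proof -
    show "subgroup (f ` H) Q" by (rule f.subgroup_img_is_subgroup[OF H(1)])
    show "pairwise_cyclic Q (f ` H)" unfolding pairwise_cyclic_def
    proof (intro ballI)
      fix x y assume "x \<in> f ` H" "y \<in> f ` H"
      then obtain a b where ab: "a \<in> H" "b \<in> H" "x = f a" "y = f b" by blast
      then obtain z where z: "z \<in> H" "a \<in> generate G {z}" "b \<in> generate G {z}"
        using H(2) unfolding pairwise_cyclic_def by blast
      have "z \<in> carrier G" using z H subgroup_mem_carrier by blast
      then have "generate Q {f z} = f ` generate G {z}" using f.generate_img[of "{z}"] by simp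
      then show "\<exists>z\<in>f ` H. x \<in> generate Q {z} \<and> y \<in> generate Q {z}" using z ab by blast
    qed
  qed
  note AQ = img[OF A] and BQ = img[OF B]
  have ABQ: "carrier Q = f ` A <#>\<^bsub>Q\<^esub> f ` B"
  proof
    show "carrier Q \<subseteq> f ` A <#>\<^bsub>Q\<^esub> f ` B"
    proof
      fix x assume "x \<in> carrier Q"
      then obtain g where g: "g \<in> carrier G" "x = f g" using fsurj by blast
      then have "g \<in> A <#> B" using AB by blast
      then obtain a b where ab: "a \<in> A" "b \<in> B" "g = a \<otimes> b" by (rule set_mult_memE)
      then have "x = f a \<otimes>\<^bsub>Q\<^esub> f b" using g subgroup_mem_carrier[OF A(1)] subgroup_mem_carrier[OF B(1)] by simp
      then show "x \<in> f ` A <#>\<^bsub>Q\<^esub> f ` B" using ab unfolding set_mult_def by blast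
    qed
    show "f ` A <#>\<^bsub>Q\<^esub> f ` B \<subseteq> carrier Q"
      using subgroup.subset[OF AQ(1)] subgroup.subset[OF BQ(1)] by (rule Q.setmult_subset_G)
  qed
  define P where "P = p_elements Q p"
  have sP: "subgroup P Q" unfolding P_def by (rule Q.p_elements_subgroup[OF nMQ commQ MQp])
  have cAQ: "x \<otimes>\<^bsub>Q\<^esub> y = y \<otimes>\<^bsub>Q\<^esub> x" if "x \<in> f ` A" "y \<in> f ` A" for x y
    by (rule Q.pairwise_cyclic_commute[OF AQ that])
  have cBQ: "x \<otimes>\<^bsub>Q\<^esub> y = y \<otimes>\<^bsub>Q\<^esub> x" if "x \<in> f ` B" "y \<in> f ` B" for x y
    by (rule Q.pairwise_cyclic_commute[OF BQ that])
  have Pprod: "P = (f ` A \<inter> P) <#>\<^bsub>Q\<^esub> (f ` B \<inter> P)"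
    unfolding P_def by (rule Q.p_elements_product[OF nMQ cMQ MQp commQ perQ AQ(1) BQ(1) ABQ cAQ cBQ p])
  interpret P: group "Q\<lparr>carrier := P\<rparr>" using sP by (rule Q.subgroup_imp_group)
  interpret P: p_element_group "Q\<lparr>carrier := P\<rparr>" p
  proof (unfold_locales, rule p)
    fix g assume "g \<in> carrier (Q\<lparr>carrier := P\<rparr>)"
    then show "\<exists>k. g [^]\<^bsub>Q\<lparr>carrier := P\<rparr>\<^esub> (p ^ k) = \<one>\<^bsub>Q\<lparr>carrier := P\<rparr>\<^esub>"
      unfolding P_def p_elements_def by (simp flip: Q.nat_pow_consistent)
  qed
  have sAP: "subgroup (f ` A \<inter> P) Q" and sBP: "subgroup (f ` B \<inter> P) Q"
    using Q.subgroups_Inter_pair[OF AQ(1) sP] Q.subgroups_Inter_pair[OF BQ(1) sP] .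
  have pc: "pairwise_cyclic (Q\<lparr>carrier := P\<rparr>) (H \<inter> P)" if H: "subgroup H Q" "pairwise_cyclic Q H" for H
  proof -
    have 1: "pairwise_cyclic Q (H \<inter> P)"
      unfolding P_def by (rule Q.pairwise_cyclic_p_part[OF H p perQ sP[unfolded P_def]])
    have "generate (Q\<lparr>carrier := P\<rparr>) {z} = generate Q {z}" if "z \<in> P" for z
      using Q.generate_consistent[OF _ sP, of "{z}"] that by simp
    then show ?thesis using 1 unfolding pairwise_cyclic_def by (metis IntD2)
  qed
  have sfS: "subgroup (f ` S) Q" by (rule f.subgroup_img_is_subgroup[OF S(1)])
  have Spow: "s [^] (p ^ n) = \<one>" if s: "s \<in> S" for s
  proof -
    interpret S: group "G\<lparr>carrier := S\<rparr>" using S(1) by (rule subgroup_imp_group)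
    have "s [^]\<^bsub>G\<lparr>carrier := S\<rparr>\<^esub> order (G\<lparr>carrier := S\<rparr>) = \<one>\<^bsub>G\<lparr>carrier := S\<rparr>\<^esub>"
      by (rule S.pow_order_eq_1) (use s in simp)
    then show ?thesis using S(2) by (simp add: order_def flip: nat_pow_consistent)
  qed
  have finS: "finite S" using S(2) p by (metis card.infinite prime_gt_0_nat zero_less_power less_numeral_extra(3))
  have fSP: "f ` S \<subseteq> P"
  proof
    fix x assume "x \<in> f ` S"
    then obtain s where s: "s \<in> S" "x = f s" by blast
    then have "x [^]\<^bsub>Q\<^esub> (p ^ n) = \<one>\<^bsub>Q\<^esub>" using fpow[OF SG[OF s(1)], of "p ^ n"] Spow[OF s(1)] by simp
    then show "x \<in> P" unfolding P_def p_elements_def using s SG by auto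
  qed
  have "\<exists>x\<in>carrier (Q\<lparr>carrier := P\<rparr>). \<exists>y\<in>carrier (Q\<lparr>carrier := P\<rparr>).
      P.p_product p x y \<and> f ` S \<subseteq> cyc_prod (Q\<lparr>carrier := P\<rparr>) x y"
  proof (rule P.finite_subset_in_p_product)
    show "f ` M \<lhd> Q\<lparr>carrier := P\<rparr>"
      using Q.normal_restrict_supergroup[OF sP nMQ] MQp unfolding P_def by blast
    show "x \<otimes>\<^bsub>Q\<lparr>carrier := P\<rparr>\<^esub> y = y \<otimes>\<^bsub>Q\<lparr>carrier := P\<rparr>\<^esub> x" if "x \<in> f ` M" "y \<in> f ` M" for x y
      using cMQ[OF that] by simp
    show "commute_mod (Q\<lparr>carrier := P\<rparr>) (f ` M) g h"
      if "g \<in> carrier (Q\<lparr>carrier := P\<rparr>)" "h \<in> carrier (Q\<lparr>carrier := P\<rparr>)" for g h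
      using that Q.commute_mod_consistent[OF sP, of g h] commQ[of g h] Q.subgroup_mem_carrier[OF sP] by simp
    show "subgroup (f ` A \<inter> P) (Q\<lparr>carrier := P\<rparr>)" by (rule Q.subgroup_incl[OF sAP sP]) auto
    show "subgroup (f ` B \<inter> P) (Q\<lparr>carrier := P\<rparr>)" by (rule Q.subgroup_incl[OF sBP sP]) auto
    show "pairwise_cyclic (Q\<lparr>carrier := P\<rparr>) (f ` A \<inter> P)" by (rule pc[OF AQ])
    show "pairwise_cyclic (Q\<lparr>carrier := P\<rparr>) (f ` B \<inter> P)" by (rule pc[OF BQ])
    show "carrier (Q\<lparr>carrier := P\<rparr>) = (f ` A \<inter> P) <#>\<^bsub>Q\<lparr>carrier := P\<rparr>\<^esub> (f ` B \<inter> P)"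
      using Pprod by simp
  qed (use finS fSP in simp_all)
  then obtain x y where xy: "P.p_product p x y" "f ` S \<subseteq> cyc_prod (Q\<lparr>carrier := P\<rparr>) x y" by blast
  define d :: nat where "d = (if p = 2 then 3 else 2)"
  have "generated_by (Q\<lparr>carrier := P\<rparr>) d (f ` S)"
    unfolding d_def by (rule P.p_product_subgroup_generated[OF xy(1) Q.subgroup_incl[OF sfS sP fSP] xy(2)])
  then obtain X where X: "finite X" "card X \<le> d" "X \<subseteq> P" "f ` S = generate (Q\<lparr>carrier := P\<rparr>) X"
    unfolding generated_by_def by auto
  have fX: "f ` S = generate Q X" using X(4) Q.generate_consistent[OF X(3) sP] by simp
  have XS: "X \<subseteq> f ` S" unfolding fX by (auto intro: generate.incl)
  \<comment> \<open>Preimages are taken inside \<open>S\<close>, so that what they generate stays in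
    \<open>S\<close>, where \<open>f\<close> is injective.\<close>
  define Y where "Y = inv_into S f ` X"
  have YS: "Y \<subseteq> S" unfolding Y_def using XS inv_into_into[of _ f S] by blast
  have fY: "f ` Y = X" unfolding Y_def by (rule image_inv_into_cancel[OF refl XS])
  have YG: "Y \<subseteq> carrier G" using YS SG by blast
  have "S \<subseteq> generate G Y"
  proof
    fix s assume s: "s \<in> S"
    have "f s \<in> f ` generate G Y" using s fX f.generate_img[OF YG] fY by auto
    then obtain t where t: "t \<in> generate G Y" "f s = f t" by blast
    have tS: "t \<in> S" using t(1) generate_subgroup_incl[OF YS S(1)] by blast
    have st: "s \<otimes> inv t \<in> K" using t(2) rcos_eq_iff[OF sK SG[OF s] SG[OF tS]] unfolding f_def by blast
    obtain j :: nat where j: "\<not> p dvd j" "(s \<otimes> inv t) [^] j = \<one>" using st unfolding K_def by blast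
    have "s \<otimes> inv t \<in> S" using s tS subgroup.m_closed[OF S(1)] subgroup.m_inv_closed[OF S(1)] by blast
    then have "(s \<otimes> inv t) [^] (p ^ n) = \<one>" by (rule Spow)
    moreover have cop: "coprime j (p ^ n)" using prime_imp_coprime[OF p j(1)] by (simp add: coprime_commute)
    moreover have "s \<otimes> inv t \<in> carrier G" using SG[OF s] SG[OF tS] by simp
    ultimately have "s \<otimes> inv t \<in> {\<one>}"
      using coprime_nat_pow_mem[OF triv_subgroup _ cop, of "s \<otimes> inv t"] j(2) by simp
    then have "s = t" using inv_solve_right'[of \<one> s t] SG[OF s] SG[OF tS] by simp
    then show "s \<in> generate G Y" using t(1) by simp
  qed
  then have "S = generate G Y" using generate_subgroup_incl[OF YS S(1)] by blast
  moreover have "card Y \<le> d" unfolding Y_def by (rule le_trans[OF card_image_le[OF X(1)] X(2)])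
  ultimately show ?thesis
    unfolding generated_by_def d_def[symmetric] using X(1) YG Y_def by (intro exI[of _ Y]) auto
qed

end

theorem corollary1p2:
  fixes G :: "('a, 'b) monoid_scheme" and A B :: "'a set"
  assumes "periodic_group G"
    and "subgroup A G" and "subgroup B G"
    and "carrier G = A <#>\<^bsub>G\<^esub> B"
    and "locally_cyclic (G\<lparr>carrier := A\<rparr>)"
    and "locally_cyclic (G\<lparr>carrier := B\<rparr>)"
  shows "\<exists>r. has_prufer_rank G r \<and> r \<le> 3"
proof -
  interpret group G using assms(1) unfolding periodic_group_def by blast
  have per: "\<exists>n::nat. n > 0 \<and> g [^]\<^bsub>G\<^esub> n = \<one>\<^bsub>G\<^esub>" if "g \<in> carrier G" for g
    using assms(1) that unfolding periodic_group_def by blast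
  have A: "pairwise_cyclic G A" and B: "pairwise_cyclic G B"
    using pairwise_cyclic_of_locally_cyclic assms(2,3,5,6) by blast+
  let ?M = "derived G (carrier G)"
  have M: "?M \<lhd> G" by (rule derived_is_normal[OF normal_self])
  have cM: "x \<otimes>\<^bsub>G\<^esub> y = y \<otimes>\<^bsub>G\<^esub> x" if "x \<in> ?M" "y \<in> ?M" for x y
    by (rule derived_abelian_of_product[OF assms(2-4) pairwise_cyclic_commute[OF assms(2) A]
        pairwise_cyclic_commute[OF assms(3) B] that])
  have "\<exists>S. finite S \<and> card S \<le> 3 \<and> S \<subseteq> carrier G \<and> H = generate G S" if fgH: "fg_subgroup H G" for H
  proof -
    obtain S0 where S0: "finite S0" "S0 \<subseteq> carrier G" "H = generate G S0"
      using fgH unfolding fg_subgroup_def by blast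
    have sH: "subgroup H G" unfolding S0(3) using S0(2) by (rule generate_is_subgroup)
    have HG: "H \<subseteq> carrier G" using sH by (rule subgroup.subset)
    have finH: "finite H"
      unfolding S0(3) by (rule finite_generate_metabelian[OF M cM commute_mod_derived per S0(1,2)])
    interpret H: group "G\<lparr>carrier := H\<rparr>" using sH by (rule subgroup_imp_group)
    have "generated_by (G\<lparr>carrier := H\<rparr>) 3 (carrier (G\<lparr>carrier := H\<rparr>))"
    proof (rule H.generated_by_3_of_p_subgroups)
      show "finite (carrier (G\<lparr>carrier := H\<rparr>))" using finH by simp
      have sub: "derived (G\<lparr>carrier := H\<rparr>) (carrier (G\<lparr>carrier := H\<rparr>)) \<subseteq> ?M"
        using derived_consistent[of H H] sH mono_derived[OF HG] by simp
      show "a \<otimes>\<^bsub>G\<lparr>carrier := H\<rparr>\<^esub> b = b \<otimes>\<^bsub>G\<lparr>carrier := H\<rparr>\<^esub> a"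
        if "a \<in> derived (G\<lparr>carrier := H\<rparr>) (carrier (G\<lparr>carrier := H\<rparr>))"
          "b \<in> derived (G\<lparr>carrier := H\<rparr>) (carrier (G\<lparr>carrier := H\<rparr>))" for a b
        using cM sub that by auto
      fix p n :: nat and S
      assume S: "prime p" "subgroup S (G\<lparr>carrier := H\<rparr>)" "card S = p ^ n"
      have sS: "subgroup S G" by (rule incl_subgroup[OF sH S(2)])
      \<comment> \<open>\<open>H\<close> need not factorise along \<open>A\<close> and
        \<open>B\<close>, so the bound is taken from the product \<open>G\<close>, in which
        \<open>S\<close> is a subgroup as well.\<close>
      have "generated_by G (if p = 2 then 3 else 2) S"
        by (rule p_subgroup_generated[OF assms(2) A assms(3) B assms(4) _ S(1) sS S(3)]) (rule per)
      then show "generated_by (G\<lparr>carrier := H\<rparr>) (if p = 2 then 3 else 2) S"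
        using generated_by_subgroup[OF sH] subgroup.subset[OF S(2)] by simp
    qed
    then obtain S where S: "finite S" "card S \<le> 3" "S \<subseteq> H" "H = generate (G\<lparr>carrier := H\<rparr>) S"
      unfolding generated_by_def by auto
    then show ?thesis using generate_consistent[OF S(3) sH] HG by (intro exI[of _ S]) auto
  qed
  then have three: "fg_subgroups_generated_by G 3" unfolding fg_subgroups_generated_by_def by blast
  define r where "r = (LEAST r. r > 0 \<and> fg_subgroups_generated_by G r)"
  have ex: "3 > (0::nat) \<and> fg_subgroups_generated_by G 3" using three by simp
  have "r > 0 \<and> fg_subgroups_generated_by G r" unfolding r_def by (rule LeastI[where k = 3 and P = "\<lambda>r. r > 0 \<and> fg_subgroups_generated_by G r", OF ex])
  moreover have "r \<le> s" if "s > 0" "fg_subgroups_generated_by G s" for s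
    unfolding r_def using that by (intro Least_le) simp
  moreover have "r \<le> 3" unfolding r_def by (rule Least_le[where k = 3 and P = "\<lambda>r. r > 0 \<and> fg_subgroups_generated_by G r", OF ex])
  ultimately show ?thesis unfolding has_prufer_rank_def by blast
qed

end
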